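(* Let $m,n\in\mathbb{N}$ with $n\geq 2$, and let $L=L_{m,n}$ be the class-$2$ nilpotent $\mathbb{Z}$-Lie lattice defined in the context, so that $\mathrm{rank}_{\mathbb{Z}}L=d=r_1+r_2+r_3$, where $r_1=|\mathbf{E}|=\binom{m+n-2}{n-1}$, $r_2=|\mathbf{F}|=\binom{m+n-1}{n-1}$, $r_3=n$. Then the algebraic automorphism group $\mathsf{Aut}(L)$, regarded as an affine $\mathbb{Z}$-group scheme $\mathsf{G}\subseteq\mathrm{GL}_d$ with respect to the basis $(x_{\mathbf{e}})_{\mathbf{e}\in\mathbf{E}},(y_{\mathbf{f}})_{\mathbf{f}\in\mathbf{F}},(z_j)_{1\le j\le n}$, has the following structure: $\mathsf{G}$ decomposes over $\mathbb{Z}$ as a semidirect product $\mathsf{G}=\mathsf{N}\rtimes\mathsf{H}$ of its unipotent radical $\mathsf{N}$ and a reductive complement $\mathsf{H}$, both defined over $\mathbb{Z}$, such that: (1) $\mathsf{N}$ consists of the elements of the form \[ \begin{pmatrix}\mathrm{Id}_{|\mathbf{E}|}&C&D_1\\0&\mathrm{Id}_{|\mathbf{F}|}&D_2\\0&0&\mathrm{Id}_n\end{pmatrix}, \] where $C\in\mathrm{Mat}_{|\mathbf{E}|,|\mathbf{F}|}$, $D_1\in\mathrm{Mat}_{|\mathbf{E}|,n}$, $D_2\in\mathrm{Mat}_{|\mathbf{F}|,n}$ are subject to the following condition: writing $C=(c_{\mathbf{e},\mathbf{f}})_{(\mathbf{e},\mathbf{f})\in\mathbf{E}\times\mathbf{F}}$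 (rows indexed by $\mathbf{E}$, columns by $\mathbf{F}$), there are parameters $b_{\mathbf{g}}$ indexed by the elements of $\mathbf{G}=\{\mathbf{g}=(g_1,\ldots,g_n)\in\mathbb{N}_0^n\mid g_1+\cdots+g_n=2m-1\}$ such that $c_{\mathbf{e},\mathbf{f}}=b_{\mathbf{e}+\mathbf{f}}$ for all $(\mathbf{e},\mathbf{f})\in\mathbf{E}\times\mathbf{F}$. (2) $\mathsf{H}\cong_{\mathbb{Z}}\mathrm{GL}_n\times\mathrm{GL}_1$ consists of the elements of the form \[ \begin{pmatrix}\lambda\varrho_1(A)&0&0\\0&\lambda^{-1}\varrho_2(A)&0\\0&0&A\end{pmatrix}, \] where $A\in\mathrm{GL}_n$, $\lambda\in\mathsf{G}_{\mathrm{m}}$ and $\varrho_1,\varrho_2$ are suitable symmetric power representations of $\mathrm{GL}_n$ in dimensions $r_1$ and $r_2$ (as specified in the context).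
   Context: Let $\mathbf{E}=\{\mathbf{e}=(e_1,\ldots,e_n)\in\mathbb{N}_0^n\mid e_1+\cdots+e_n=m-1\}$ and $\mathbf{F}=\{\mathbf{f}=(f_1,\ldots,f_n)\in\mathbb{N}_0^n\mid f_1+\cdots+f_n=m\}$. The $\mathbb{Z}$-Lie lattice $L_{m,n}$ is free as a $\mathbb{Z}$-module with basis $x_{\mathbf{e}}$ ($\mathbf{e}\in\mathbf{E}$), $y_{\mathbf{f}}$ ($\mathbf{f}\in\mathbf{F}$), $z_j$ ($1\le j\le n$), with Lie bracket determined by $[x_{\mathbf{e}},x_{\mathbf{e}'}]=[y_{\mathbf{f}},y_{\mathbf{f}'}]=[x_{\mathbf{e}},z_j]=[y_{\mathbf{f}},z_j]=[z_j,z_{j'}]=0$ for all indices, and $[x_{\mathbf{e}},y_{\mathbf{f}}]=z_i$ if $\mathbf{f}-\mathbf{e}$ is the $i$-th standard unit vector for some $i\in\{1,\ldots,n\}$, and $[x_{\mathbf{e}},y_{\mathbf{f}}]=0$ otherwise. The algebraic automorphism group $\mathsf{Aut}(L)$ of a $\mathbb{Z}$-Lie lattice $L$ of rank $d$ with chosen basis is the affine group scheme $\mathsf{G}\subseteq\mathrm{GL}_d$ over $\mathbb{Z}$, realised via the chosen basis, such that $\mathrm{Aut}_K(K\otimes_{\mathbb{Z}}L)\cong\mathsf{G}(K)\subseteq\mathrm{GL}_d(K)$ for every extension field $K$ of $\mathbb{Q}$; with this arithmetic structure $\mathrm{Aut}(L)\cong\mathsf{G}(\mathbb{Z})$ and $\mathrm{Aut}(\mathbb{Z}_p\otimes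 L)\cong\mathsf{G}(\mathbb{Z}_p)$ for every prime $p$. Matrices act from the right on row vectors: the rows of the matrix of an automorphism are the coordinate vectors of the images of the basis elements. The representations: let $\mathrm{GL}_n$ act on the space $V^\vee$ with basis $z_1,\ldots,z_n$ by its natural representation and on the space $V$ with dual basis $\xi_1,\ldots,\xi_n$ by the contragredient representation (inverse transpose matrices). Then $\varrho_1$ is the induced matrix representation on the symmetric power $S^{m-1}V$ with respect to the basis $\xi_1^{e_1}\cdots\xi_n^{e_n}$, $\mathbf{e}\in\mathbf{E}$, and $\varrho_2$ is the induced matrix representation on $S^m(V^\vee)$ with respect to the basis $\big(\prod_{i=1}^n f_i!\big)^{-1}z_1^{f_1}\cdots z_n^{f_n}$, $\mathbf{f}\in\mathbf{F}$. *)

theory Defs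
  imports
    "Jordan_Normal_Form.Matrix"
    "HOL-Analysis.Function_Topology"
    "HOL-Algebra.Coset"
    "HOL-Library.Poly_Mapping"
    "HOL-Computational_Algebra.Polynomial"
begin

text \<open>
  Group schemes over the integers are represented by their functors of points. A functor is a
  polymorphic constant whose instance at a type \<open>'r\<close> of class \<open>comm_ring_1\<close> is its set of
  \<open>'r\<close>-points, a subset of \<open>GL d\<close>.
\<close>

definition GL :: "nat \<Rightarrow> 'r::comm_ring_1 mat monoid" where
  "GL d = units_of (ring_mat TYPE('r) d ())"


section \<open>The Lie lattice and its automorphisms\<close>

definition expos :: "nat \<Rightarrow> nat \<Rightarrow> nat list set" where
  "expos n k = {e. length e = n \<and> sum_list e = k}"

text \<open>An arbitrary but fixed enumeration; the order of the basis elements plays no role.\<close>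

definition expo_list :: "nat \<Rightarrow> nat \<Rightarrow> nat list list" where
  "expo_list n k = (SOME es. distinct es \<and> set es = expos n k)"

definition E_list :: "nat \<Rightarrow> nat \<Rightarrow> nat list list" where
  "E_list m n = expo_list n (m - 1)"

definition F_list :: "nat \<Rightarrow> nat \<Rightarrow> nat list list" where
  "F_list m n = expo_list n m"

text \<open>The index \<open>i\<close> of \<open>z\<^sub>i\<close> runs through \<open>0, ..., n - 1\<close>.\<close>

datatype basis_elem = X "nat list" | Y "nat list" | Z nat

definition basis :: "nat \<Rightarrow> nat \<Rightarrow> basis_elem list" where
  "basis m n = map X (E_list m n) @ map Y (F_list m n) @ map Z [0..<n]"

definition rk :: "nat \<Rightarrow> nat \<Rightarrow> nat" where
  "rk m n = length (basis m n)"

text \<open>\<open>lie_coeff a b c\<close> is the coefficient of \<open>c\<close> in \<open>[a, b]\<close>; in the first equation,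
  \<open>e[i := e ! i + 1]\<close> is \<open>e\<close> plus the \<open>i\<close>-th standard unit vector.\<close>

fun lie_coeff :: "basis_elem \<Rightarrow> basis_elem \<Rightarrow> basis_elem \<Rightarrow> int" where
  "lie_coeff (X e) (Y f) (Z i) = (if f = e[i := e ! i + 1] then 1 else 0)"
| "lie_coeff (Y f) (X e) (Z i) = - (if f = e[i := e ! i + 1] then 1 else 0)"
| "lie_coeff _ _ _ = 0"

text \<open>The Lie bracket of \<open>R \<otimes> L\<close>, in coordinates with respect to \<open>basis m n\<close>;
  the lattice \<open>L\<close> itself is the instance \<open>R = int\<close>.\<close>

definition bracket :: "nat \<Rightarrow> nat \<Rightarrow> 'r::comm_ring_1 vec \<Rightarrow> 'r vec \<Rightarrow> 'r vec" where
  "bracket m n u v = vec (rk m n) (\<lambda>k. \<Sum>i<rk m n. \<Sum>j<rk m n.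
     u $ i * v $ j * of_int (lie_coeff (basis m n ! i) (basis m n ! j) (basis m n ! k)))"

lemma lie_coeff_Z: "lie_coeff (Z i) b c = 0" "lie_coeff a (Z i) c = 0"
  by (cases b; cases c; simp) (cases a; cases c; simp)

lemma lie_coeff_nonzeroD: "lie_coeff a b c \<noteq> 0 \<Longrightarrow> \<exists>i. c = Z i"
  by (cases a; cases b; cases c; simp)

lemma lie_coeff_self: "lie_coeff a a c = 0"
  by (cases a; cases c; simp)

lemma lie_coeff_swap: "lie_coeff a b c = - lie_coeff b a c"
  by (cases a; cases b; cases c; simp)

text \<open>The bracket is alternating, and triple brackets vanish (so that the Jacobi identity is
  trivially satisfied).\<close>

lemma bracket_self:
  fixes u :: "'r::comm_ring_1 vec"
  shows "bracket m n u u = 0\<^sub>v (rk m n)"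
proof -
  have alt: "(\<Sum>i<d. \<Sum>j<d. g i j) = (0 :: 'r)"
    if g0: "\<And>i. g i i = 0" and g1: "\<And>i j. g i j = - g j i" for g :: "nat \<Rightarrow> nat \<Rightarrow> 'r" and d
  proof (induction d)
    case (Suc d)
    have "(\<Sum>j<d. g d j) = - (\<Sum>i<d. g i d)"
      unfolding sum_negf[symmetric] by (intro sum.cong refl g1)
    with Suc show ?case by (simp add: sum.distrib g0)
  qed simp
  have g1: "u $ i * u $ j * of_int (lie_coeff a b c) = - (u $ j * u $ i * of_int (lie_coeff b a c))"
    for i j a b c
    by (subst lie_coeff_swap) (simp add: mult.commute)
  show ?thesis
    unfolding bracket_def zero_vec_def
    by (rule arg_cong2[where f = vec, OF refl], rule ext, rule alt)
       (simp_all only: lie_coeff_self of_int_0 mult_zero_right, rule g1)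
qed

lemma bracket_bracket: "bracket m n (bracket m n u v) w = 0\<^sub>v (rk m n)"
proof -
  have "bracket m n u v $ i * w $ j * of_int (lie_coeff (basis m n ! i) b c) = 0"
    if "i < rk m n" for i j b c
  proof (cases "\<exists>l. basis m n ! i = Z l")
    case True
    then show ?thesis by (auto simp: lie_coeff_Z)
  next
    case False
    then have "lie_coeff a a' (basis m n ! i) = 0" for a a'
      using lie_coeff_nonzeroD by blast
    with that show ?thesis by (simp add: bracket_def)
  qed
  then show ?thesis
    by (subst bracket_def) (simp add: zero_vec_def)
qed

definition lie_auts :: "nat \<Rightarrow> nat \<Rightarrow> ('r::comm_ring_1 vec \<Rightarrow> 'r vec) set" where
  "lie_auts m n = {\<phi>.
     bij_betw \<phi> (carrier_vec (rk m n)) (carrier_vec (rk m n)) \<and>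
     (\<forall>u\<in>carrier_vec (rk m n). \<forall>v\<in>carrier_vec (rk m n). \<phi> (u + v) = \<phi> u + \<phi> v) \<and>
     (\<forall>c. \<forall>u\<in>carrier_vec (rk m n). \<phi> (c \<cdot>\<^sub>v u) = c \<cdot>\<^sub>v \<phi> u) \<and>
     (\<forall>u\<in>carrier_vec (rk m n). \<forall>v\<in>carrier_vec (rk m n).
        \<phi> (bracket m n u v) = bracket m n (\<phi> u) (\<phi> v))}"

text \<open>Matrices act from the right on row vectors: the rows are the images of the basis elements.\<close>

definition row_matrix :: "nat \<Rightarrow> ('r::comm_ring_1 vec \<Rightarrow> 'r vec) \<Rightarrow> 'r mat" where
  "row_matrix d \<phi> = mat_of_rows d (map (\<lambda>i. \<phi> (unit_vec d i)) [0..<d])"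

definition Aut_pts :: "nat \<Rightarrow> nat \<Rightarrow> 'r::comm_ring_1 mat set" where
  "Aut_pts m n = row_matrix (rk m n) ` lie_auts m n"

definition Aut_grp :: "nat \<Rightarrow> nat \<Rightarrow> 'r::comm_ring_1 mat monoid" where
  "Aut_grp m n = (GL (rk m n))\<lparr>carrier := Aut_pts m n\<rparr>"


section \<open>Polynomials in matrix entries and algebraic groups\<close>

text \<open>Polynomials in the indeterminates \<open>T\<^sub>i\<^sub>j\<close> with coefficients in \<open>'c\<close>.\<close>

type_synonym 'c entry_poly = "(nat \<times> nat \<Rightarrow>\<^sub>0 nat) \<Rightarrow>\<^sub>0 'c"

text \<open>Evaluation at a matrix \<open>M\<close>, mapping coefficients by \<open>h\<close>. Indeterminates
  \<open>T\<^sub>i\<^sub>j\<close> with \<open>(i, j)\<close> outside the range of \<open>M\<close> are evaluated to 1.\<close>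

definition peval :: "('c::zero \<Rightarrow> 'r::comm_ring_1) \<Rightarrow> 'r mat \<Rightarrow> 'c entry_poly \<Rightarrow> 'r" where
  "peval h M p = (\<Sum>k\<in>Poly_Mapping.keys p. h (Poly_Mapping.lookup p k) *
     (\<Prod>i<dim_row M. \<Prod>j<dim_col M. (M $$ (i, j)) ^ Poly_Mapping.lookup k (i, j)))"

text \<open>The points of the schematic closure in \<open>GL d\<close> over the integers of a set of complex
  matrices. A functor with \<open>S(R) = Z_closure d S(\<complex>)\<close> for all \<open>R\<close> is the closed subscheme of
  \<open>GL d\<close> cut out by all integer polynomials that vanish on its generic fibre; this is what
  it means for the arithmetic structure to be induced by the chosen basis.\<close>

definition Z_closure :: "nat \<Rightarrow> complex mat set \<Rightarrow> 'r::comm_ring_1 mat set" where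
  "Z_closure d S = {M \<in> carrier (GL d).
     \<forall>p :: int entry_poly. (\<forall>A\<in>S. peval of_int A p = 0) \<longrightarrow> peval of_int M p = 0}"

definition zariski :: "nat \<Rightarrow> 'k::field mat topology" where
  "zariski d = topology_generated_by
     (range (\<lambda>p :: 'k entry_poly. {M \<in> carrier (GL d). peval id M p \<noteq> 0}))"

definition unipotent :: "nat \<Rightarrow> 'k::field mat \<Rightarrow> bool" where
  "unipotent d u \<longleftrightarrow> (\<exists>k. (u - 1\<^sub>m d) ^\<^sub>m k = 0\<^sub>m d d)"

text \<open>\<open>\<Gamma>\<close> is a closed subgroup of \<open>GL d\<close> over an algebraically closed field.\<close>

definition conn_normal_unipotent ::
    "nat \<Rightarrow> 'k::alg_closed_field mat set \<Rightarrow> 'k mat set \<Rightarrow> bool" where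
  "conn_normal_unipotent d \<Gamma> U \<longleftrightarrow>
     closedin (zariski d) U \<and> connectedin (zariski d) U \<and>
     normal U ((GL d)\<lparr>carrier := \<Gamma>\<rparr>) \<and> (\<forall>u\<in>U. unipotent d u)"

definition is_unipotent_radical ::
    "nat \<Rightarrow> 'k::alg_closed_field mat set \<Rightarrow> 'k mat set \<Rightarrow> bool" where
  "is_unipotent_radical d \<Gamma> U \<longleftrightarrow> conn_normal_unipotent d \<Gamma> U \<and>
     (\<forall>U'. conn_normal_unipotent d \<Gamma> U' \<longrightarrow> U' \<subseteq> U)"

definition reductive :: "nat \<Rightarrow> 'k::alg_closed_field mat set \<Rightarrow> bool" where
  "reductive d \<Gamma> \<longleftrightarrow> subgroup \<Gamma> (GL d) \<and> closedin (zariski d) \<Gamma> \<and> connectedin (zariski d) \<Gamma> \<and>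
     is_unipotent_radical d \<Gamma> {1\<^sub>m d}"

definition semidirect :: "'a monoid \<Rightarrow> 'a set \<Rightarrow> 'a set \<Rightarrow> bool" where
  "semidirect G N H \<longleftrightarrow> normal N G \<and> subgroup H G \<and>
     N \<inter> H = {\<one>\<^bsub>G\<^esub>} \<and> N <#>\<^bsub>G\<^esub> H = carrier G"


section \<open>The symmetric power representations\<close>

text \<open>\<open>sym_coeff A e e'\<close> is the coefficient of \<open>t\<^sup>e\<^sup>'\<close> in the image of the monomial \<open>t\<^sup>e\<close> under
  the substitution mapping \<open>t\<^sub>i\<close> to the linear form given by row \<open>i\<close> of \<open>A\<close>.\<close>

definition sym_coeff :: "'r::comm_ring_1 mat \<Rightarrow> nat list \<Rightarrow> nat list \<Rightarrow> 'r" where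
  "sym_coeff A e e' = Poly_Mapping.lookup
     (\<Prod>i<dim_row A. (\<Sum>j<dim_col A. Poly_Mapping.single (Poly_Mapping.single j (1::nat)) (A $$ (i, j)))
        ^ (e ! i))
     (Poly_Mapping.nth e')"

definition rho1 :: "nat \<Rightarrow> nat \<Rightarrow> 'r::comm_ring_1 mat \<Rightarrow> 'r mat" where
  "rho1 m n A = mat (length (E_list m n)) (length (E_list m n))
     (\<lambda>(i, j). sym_coeff (transpose_mat (inv\<^bsub>GL n\<^esub> A)) (E_list m n ! i) (E_list m n ! j))"

text \<open>With respect to the basis \<open>z\<^sup>f / f!\<close>, the coefficient \<open>c\<^sub>f\<^sub>f\<^sub>'\<close> with respect to the monomial
  basis is replaced by \<open>(f'! / f!) c\<^sub>f\<^sub>f\<^sub>'\<close>. As a polynomial in the entries of the generic matrix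
  this is defined over the rationals, but it turns out to have integer coefficients. Hence it
  can be evaluated over every commutative ring; the floor below only performs the
  conversion of these coefficients from type \<open>rat\<close> to type \<open>int\<close>.\<close>

definition generic_mat :: "nat \<Rightarrow> rat entry_poly mat" where
  "generic_mat n = mat n n (\<lambda>ij. Poly_Mapping.single (Poly_Mapping.single ij 1) 1)"

definition expo_fact :: "nat list \<Rightarrow> nat" where
  "expo_fact f = prod_list (map fact f)"

definition rho2_entry :: "nat \<Rightarrow> nat list \<Rightarrow> nat list \<Rightarrow> rat entry_poly" where
  "rho2_entry n f f' =
     Poly_Mapping.single 0 (of_nat (expo_fact f') / of_nat (expo_fact f))
       * sym_coeff (generic_mat n) f f'"

definition rho2 :: "nat \<Rightarrow> nat \<Rightarrow> 'r::comm_ring_1 mat \<Rightarrow> 'r mat" where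
  "rho2 m n A = mat (length (F_list m n)) (length (F_list m n))
     (\<lambda>(i, j). peval (\<lambda>q. of_int \<lfloor>q\<rfloor>) A (rho2_entry n (F_list m n ! i) (F_list m n ! j)))"


section \<open>The unipotent radical and its complement\<close>

text \<open>The block matrix with rows \<open>(P, C, D1)\<close>, \<open>(0, Q, D2)\<close>, \<open>(0, 0, S)\<close>.\<close>

definition tri_block ::
    "'r::zero mat \<Rightarrow> 'r mat \<Rightarrow> 'r mat \<Rightarrow> 'r mat \<Rightarrow> 'r mat \<Rightarrow> 'r mat \<Rightarrow> 'r mat" where
  "tri_block P C D1 Q D2 S = four_block_mat
     (four_block_mat P C (0\<^sub>m (dim_row Q) (dim_col P)) Q)
     (D1 @\<^sub>r D2)
     (0\<^sub>m (dim_row S) (dim_col P + dim_col Q))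
     S"

text \<open>\<open>map2 (+) e f\<close> is \<open>e + f\<close>, so only the values of \<open>b\<close> on \<open>expos n (2 * m - 1)\<close> matter.\<close>

definition N_pts :: "nat \<Rightarrow> nat \<Rightarrow> 'r::comm_ring_1 mat set" where
  "N_pts m n =
    {tri_block (1\<^sub>m (length (E_list m n))) C D1 (1\<^sub>m (length (F_list m n))) D2 (1\<^sub>m n) | C D1 D2.
       C \<in> carrier_mat (length (E_list m n)) (length (F_list m n)) \<and>
       D1 \<in> carrier_mat (length (E_list m n)) n \<and>
       D2 \<in> carrier_mat (length (F_list m n)) n \<and>
       (\<exists>b :: nat list \<Rightarrow> 'r. \<forall>i<length (E_list m n). \<forall>j<length (F_list m n).
          C $$ (i, j) = b (map2 (+) (E_list m n ! i) (F_list m n ! j)))}"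

text \<open>The group \<open>GL\<^sub>1\<close> consists of matrices of size 1, whence the indices \<open>(0, 0)\<close>.\<close>

definition H_map :: "nat \<Rightarrow> nat \<Rightarrow> 'r::comm_ring_1 mat \<times> 'r mat \<Rightarrow> 'r mat" where
  "H_map m n = (\<lambda>(A, l). tri_block
     (l $$ (0, 0) \<cdot>\<^sub>m rho1 m n A)
     (0\<^sub>m (length (E_list m n)) (length (F_list m n)))
     (0\<^sub>m (length (E_list m n)) n)
     ((inv\<^bsub>GL 1\<^esub> l) $$ (0, 0) \<cdot>\<^sub>m rho2 m n A)
     (0\<^sub>m (length (F_list m n)) n)
     A)"

definition H_pts :: "nat \<Rightarrow> nat \<Rightarrow> 'r::comm_ring_1 mat set" where
  "H_pts m n = H_map m n ` carrier (GL n \<times>\<times> GL 1)"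

end

theory Submission
  imports Defs "Jordan_Normal_Form.Determinant"
begin

text \<open>
  In the notation below, let \<open>V\<close> be the free module with basis \<open>t\<^sub>1, ..., t\<^sub>n\<close> over a commutative ring.
  Identify \<open>x\<^sub>e\<close> with the monomial \<open>t\<^sup>e\<close> in \<open>S\<^bsup>m-1\<^esup> V\<close>, the \<open>y\<^sub>f\<close> with the basis of the dual of
  \<open>S\<^sup>m V\<close> that is dual to the monomials, and the \<open>z\<^sub>i\<close> with the basis of the dual of \<open>V\<close>. Then
  the bracket \<open>[x, y]\<close> is the linear form that maps \<open>v\<close> to \<open>y(v x)\<close>: it is the multiplication of
  polynomials \<open>V \<times> S\<^bsup>m-1\<^esup> V \<rightarrow> S\<^sup>m V\<close> in disguise. Hence \<open>GL\<^sub>n\<close> acts by automorphisms, and so do the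
  scalars that act inversely to each other on \<open>S\<^bsup>m-1\<^esup> V\<close> and on the dual of \<open>S\<^sup>m V\<close>
  (\<open>preserves_Hmat\<close>). The only point that concerns integrality is that the second representation,
  which is defined by divided powers, is the transpose of \<open>S\<^sup>m\<close> of the transposed matrix; this
  follows from a recursion and a derivative rule for the coefficients of \<open>S\<^sup>m\<close>
  (\<open>sym_coeff_transpose\<close>, \<open>rho2_entry_eval\<close>).

  Conversely, let \<open>M\<close> be an automorphism over any commutative ring. It preserves the span of the
  \<open>z\<^sub>i\<close>, which is the derived algebra, and after multiplication by an element of the complement it
  fixes the \<open>z\<^sub>i\<close>. The conditions on \<open>M\<close> are quadratic, but multiplied by the inverse matrix \<open>N\<close>
  they become linear in the pair of \<open>M\<close> and \<open>N\<close> (\<open>preserves_linearised\<close>). Read as identities of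
  polynomials in two sets of variables \<open>s\<close>, \<open>t\<close>, they say the following. The component
  \<open>D(s, t)\<close> of \<open>M\<close> that maps the \<open>y\<^sub>f\<close> to the span of the \<open>x\<^sub>e\<close> satisfies
  \<open>t\<^sub>i D(s, t) = - s\<^sub>i D'(t, s)\<close> for all \<open>i\<close>, where \<open>D'\<close> belongs to \<open>N\<close>; so it is annihilated by
  \<open>t\<^sub>i s\<^sub>j - t\<^sub>j s\<^sub>i\<close> and vanishes, because \<open>n \<ge> 2\<close>. The components on the \<open>x\<^sub>e\<close> and on the \<open>y\<^sub>f\<close>
  commute with multiplication by every \<open>t\<^sub>i\<close>, so they are scalars (\<open>shape_of_preserving\<close>). If these
  scalars are 1, then the component \<open>C\<close> is symmetric in the sense that a unit of exponent can be
  moved from one index to the other, and this means that its entries depend only on the sum of the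
  two indices (\<open>symmetric_imp_hankel\<close>). The argument needs no division, so it proves
  \<open>G(R) = N(R) H(R)\<close> for every commutative ring \<open>R\<close> at once (\<open>Aut_decompose\<close>, \<open>semidirect_N_H\<close>).

  The three groups are defined by integer equations in the entries of the matrix, which gives one
  inclusion of each identity with a schematic closure. For the other inclusion, up to a power of
  the determinant and of the scalar, a point is a value of integer polynomials in free parameters.
  After clearing denominators, an integer polynomial that vanishes at the complex points becomes
  a polynomial identity in the parameters, and hence holds over every ring
  (\<open>int_mpoly_eq_0I\<close>, \<open>family_in_Z_closure\<close>).
  Over an algebraically closed field, a line in the parameter space
  provides a rational curve through two given points, so \<open>N\<close> and \<open>H\<close> are connected
  (\<open>connectedin_zariski_curves\<close>). Finally, a normal unipotent subgroup of \<open>G\<close> or of \<open>H\<close> acts on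
  the \<open>z\<^sub>i\<close> by a normal unipotent subgroup of \<open>GL\<^sub>n\<close>. Such a subgroup is trivial, since two conjugates of a unipotent
  matrix other than 1 can have a product that is not unipotent (\<open>normal_unipotent_trivial\<close>).
\<close>

section \<open>Exponent vectors\<close>

definition inc :: "nat \<Rightarrow> nat list \<Rightarrow> nat list" where
  "inc i e = e[i := e ! i + 1]"

text \<open>Where \<open>e ! i = 0\<close>, the subtraction is truncated; in the formulas for coefficients below, such
  terms are excluded by a condition or multiplied by 0.\<close>

definition dec :: "nat \<Rightarrow> nat list \<Rightarrow> nat list" where
  "dec i e = e[i := e ! i - 1]"

lemma length_inc [simp]: "length (inc i e) = length e"
  by (simp add: inc_def)

lemma length_dec [simp]: "length (dec i e) = length e"
  by (simp add: dec_def)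

lemma nth_inc: "i < length e \<Longrightarrow> inc i e ! j = (if j = i then e ! j + 1 else e ! j)"
  by (simp add: inc_def nth_list_update)

lemma nth_dec: "i < length e \<Longrightarrow> dec i e ! j = (if j = i then e ! j - 1 else e ! j)"
  by (simp add: dec_def nth_list_update)

lemma inc_dec: "i < length e \<Longrightarrow> e ! i > 0 \<Longrightarrow> inc i (dec i e) = e"
  by (intro nth_equalityI) (auto simp: nth_inc nth_dec)

lemma dec_inc [simp]: "i < length e \<Longrightarrow> dec i (inc i e) = e"
  by (intro nth_equalityI) (auto simp: nth_inc nth_dec)

lemma inc_inc: "i < length e \<Longrightarrow> j < length e \<Longrightarrow> inc i (inc j e) = inc j (inc i e)"
  by (intro nth_equalityI) (auto simp: nth_inc)

lemma dec_inc_commute: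
  "i < length e \<Longrightarrow> j < length e \<Longrightarrow> e ! i > 0 \<or> i \<noteq> j \<Longrightarrow> dec i (inc j e) = inc j (dec i e)"
  by (intro nth_equalityI) (auto simp: nth_inc nth_dec)

lemma inc_inject: "i < length e \<Longrightarrow> i < length e' \<Longrightarrow> inc i e = inc i e' \<longleftrightarrow> e = e'"
  by (metis dec_inc)

lemma expos_length: "e \<in> expos n k \<Longrightarrow> length e = n"
  by (simp add: expos_def)

lemma expos_inc: "e \<in> expos n k \<Longrightarrow> i < n \<Longrightarrow> inc i e \<in> expos n (Suc k)"
  by (auto simp: expos_def inc_def sum_list_update)

lemma expos_dec: "e \<in> expos n (Suc k) \<Longrightarrow> i < n \<Longrightarrow> e ! i > 0 \<Longrightarrow> dec i e \<in> expos n k"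
  using elem_le_sum_list[of i e] by (auto simp: expos_def dec_def sum_list_update)

lemma expos_Suc_pos: "e \<in> expos n (Suc k) \<Longrightarrow> \<exists>i<n. e ! i > 0"
  by (auto simp: expos_def) (metis bot_nat_0.not_eq_extremum in_set_conv_nth nat.distinct(1) sum_list_eq_0_iff)

lemma expos_Suc_ex_inc: "e \<in> expos n (Suc k) \<Longrightarrow> \<exists>i<n. \<exists>e'\<in>expos n k. e = inc i e'"
  using expos_Suc_pos expos_dec inc_dec expos_length by metis

lemma expos_0: "expos n 0 = {replicate n 0}"
  by (auto simp: expos_def intro!: nth_equalityI)

lemma finite_expos: "finite (expos n k)"
proof -
  have "expos n k \<subseteq> {e. set e \<subseteq> {..k} \<and> length e = n}"
    using member_le_sum_list by (fastforce simp: expos_def)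
  then show ?thesis by (rule finite_subset) (simp add: finite_lists_length_eq)
qed

lemma card_expos: "n \<ge> 1 \<Longrightarrow> card (expos n k) = (k + n - 1) choose (n - 1)"
  using card_length_sum_list[of n k] binomial_symmetric[of k "k + n - 1"] by (simp add: expos_def)

lemma expos_nonempty: "n \<ge> 1 \<Longrightarrow> expos n k \<noteq> {}"
  using card_expos[of n k] by force

lemma expo_list: "distinct (expo_list n k)" "set (expo_list n k) = expos n k"
proof -
  have "\<exists>es. distinct es \<and> set es = expos n k"
    using finite_distinct_list[OF finite_expos] by blast
  from someI_ex[OF this] show "distinct (expo_list n k)" "set (expo_list n k) = expos n k"
    unfolding expo_list_def by auto
qed

text \<open>Multiplication by \<open>t\<^sub>j\<close> is a bijection from the monomials of degree \<open>k\<close> to the monomials of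
  degree \<open>k + 1\<close> that are divisible by \<open>t\<^sub>j\<close>.\<close>

lemma sum_expos_inc:
  assumes "j < n"
  shows "(\<Sum>e\<in>expos n k. g (inc j e)) = (\<Sum>f\<in>expos n (Suc k). if f ! j = 0 then 0 else g f)"
proof -
  have "(\<Sum>f\<in>expos n (Suc k). if f ! j = 0 then 0 else g f) = sum g {f\<in>expos n (Suc k). f ! j \<noteq> 0}"
    unfolding sum.inter_filter[OF finite_expos] by (rule sum.cong) auto
  also have "\<dots> = (\<Sum>e\<in>expos n k. g (inc j e))"
    by (rule sum.reindex_bij_witness[of _ "inc j" "dec j"])
       (use assms in \<open>auto simp: expos_length inc_dec expos_inc expos_dec nth_inc\<close>)
  finally show ?thesis by simp
qed

section \<open>Symmetric powers\<close>

lemma lookup_single_times: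
  fixes p :: "('a \<Rightarrow>\<^sub>0 nat) \<Rightarrow>\<^sub>0 'r::comm_ring_1"
  shows "Poly_Mapping.lookup (Poly_Mapping.single (Poly_Mapping.single j 1) a * p) v
    = (if Poly_Mapping.lookup v j = 0 then 0 else a * Poly_Mapping.lookup p (v - Poly_Mapping.single j 1))"
proof -
  have eq: "v = Poly_Mapping.single j 1 + q \<longleftrightarrow> Poly_Mapping.lookup v j \<noteq> 0 \<and> q = v - Poly_Mapping.single j 1" for q
  proof
    assume "Poly_Mapping.lookup v j \<noteq> 0 \<and> q = v - Poly_Mapping.single j 1"
    then show "v = Poly_Mapping.single j 1 + q"
      by (intro poly_mapping_eqI) (auto simp: lookup_add lookup_minus lookup_single when_def)
  qed (simp add: lookup_add)
  have "Poly_Mapping.lookup (Poly_Mapping.single (Poly_Mapping.single j 1) a * p) v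
     = (\<Sum>l. (a when Poly_Mapping.single j 1 = l) * (\<Sum>q. Poly_Mapping.lookup p q when v = l + q))"
    by (simp only: lookup_mult lookup_single)
  also have "\<dots> = (\<Sum>l. (a * (\<Sum>q. Poly_Mapping.lookup p q when v = l + q)) when Poly_Mapping.single j 1 = l)"
    by (rule arg_cong[of _ _ Sum_any]) (auto simp: when_def)
  also have "\<dots> = a * (\<Sum>q. Poly_Mapping.lookup p q when v = Poly_Mapping.single j 1 + q)"
    by simp
  also have "\<dots> = (if Poly_Mapping.lookup v j = 0 then 0 else a * Poly_Mapping.lookup p (v - Poly_Mapping.single j 1))"
    unfolding eq by simp
  finally show ?thesis .
qed

lemma nth_minus_single:
  "j < length f \<Longrightarrow> Poly_Mapping.nth f - Poly_Mapping.single j 1 = Poly_Mapping.nth (dec j f)"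
  by (intro poly_mapping_eqI) (auto simp: lookup_minus lookup_single nth_default_def nth_dec when_def)

text \<open>The coefficient of \<open>t\<^sup>f\<close> in \<open>t\<^sub>j\<close> times the image of \<open>t\<^sup>e\<close>.\<close>

definition shift_coeff :: "'r::comm_ring_1 mat \<Rightarrow> nat \<Rightarrow> nat list \<Rightarrow> nat list \<Rightarrow> 'r" where
  "shift_coeff A j e f = (if f ! j = 0 then 0 else sym_coeff A e (dec j f))"

text \<open>The substitution is multiplicative, so the image of \<open>t\<^sub>i t\<^sup>e\<close> is the image of \<open>t\<^sup>e\<close> times row \<open>i\<close>
  as a linear form. This recursion on the degree, which starts with \<open>sym_coeff_0\<close>, is all that is
  used about symmetric powers from here on.\<close>

lemma sym_coeff_inc:
  fixes A :: "'r::comm_ring_1 mat"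
  assumes A: "A \<in> carrier_mat n n" and e: "length e = n" and f: "length f = n" and i: "i < n"
  shows "sym_coeff A (inc i e) f = (\<Sum>j<n. A $$ (i, j) * shift_coeff A j e f)"
proof -
  let ?L = "\<lambda>i. \<Sum>j<n. Poly_Mapping.single (Poly_Mapping.single j (1::nat)) (A $$ (i, j))"
  have "(\<Prod>k<n. ?L k ^ (inc i e ! k)) = (\<Prod>k<n. (if k = i then ?L i else 1) * ?L k ^ (e ! k))"
    by (rule prod.cong) (use e i in \<open>auto simp: nth_inc\<close>)
  also have "\<dots> = ?L i * (\<Prod>k<n. ?L k ^ (e ! k))"
    using i by (simp add: prod.distrib prod.delta)
  finally have eq: "(\<Prod>k<n. ?L k ^ (inc i e ! k)) = ?L i * (\<Prod>k<n. ?L k ^ (e ! k))" .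
  have "sym_coeff A (inc i e) f = Poly_Mapping.lookup (?L i * (\<Prod>k<n. ?L k ^ (e ! k))) (Poly_Mapping.nth f)"
    using A by (simp only: sym_coeff_def carrier_matD eq)
  also have "\<dots> = (\<Sum>j<n. A $$ (i, j) * shift_coeff A j e f)"
    unfolding sum_distrib_right lookup_sum
  proof (rule sum.cong[OF refl], goal_cases)
    case (1 j)
    then show ?case
      using A f unfolding lookup_single_times
      by (simp add: shift_coeff_def nth_default_def nth_minus_single[unfolded One_nat_def] sym_coeff_def)
  qed
  finally show ?thesis .
qed

lemma sym_coeff_0: 
  assumes "A \<in> carrier_mat n n" and "e \<in> expos n 0" and "f \<in> expos n 0"
  shows "sym_coeff A e f = 1"
proof -
  have "Poly_Mapping.nth (replicate n (0::nat)) = 0"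
    by (intro poly_mapping_eqI) (simp add: nth_default_def)
  then show ?thesis
    using assms by (simp add: sym_coeff_def expos_0)
qed

lemma (in comm_ring_hom) sym_coeff_hom:
  assumes A: "A \<in> carrier_mat n n"
  shows "e \<in> expos n k \<Longrightarrow> f \<in> expos n k \<Longrightarrow> hom (sym_coeff A e f) = sym_coeff (map_mat hom A) e f"
proof (induction k arbitrary: e f)
  case 0
  then show ?case using A by (simp add: sym_coeff_0[of _ n])
next
  case (Suc k)
  then obtain i e' where e: "i < n" "e' \<in> expos n k" "e = inc i e'"
    using expos_Suc_ex_inc by blast
  have "hom (shift_coeff A j e' f) = shift_coeff (map_mat hom A) j e' f" if "j < n" for j
    using Suc.IH[OF e(2) expos_dec[OF Suc.prems(2) that]] by (simp add: shift_coeff_def)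
  then show ?case
    using A e Suc.prems(2)
    by (simp add: e sym_coeff_inc[of _ n] expos_length[OF Suc.prems(2)] expos_length[OF e(2)] hom_distribs hom_sum hom_mult)
qed

text \<open>The symmetric power is a functor: expanding \<open>A * B\<close> in the recursion for \<open>A * B\<close> and collecting
  the factors of \<open>B\<close> gives the recursion for \<open>B\<close>.\<close>

lemma sym_coeff_mult:
  fixes A B :: "'r::comm_ring_1 mat"
  assumes A: "A \<in> carrier_mat n n" and B: "B \<in> carrier_mat n n"
  shows "e \<in> expos n k \<Longrightarrow> f \<in> expos n k \<Longrightarrow>
    sym_coeff (A * B) e f = (\<Sum>g\<in>expos n k. sym_coeff A e g * sym_coeff B g f)"
proof (induction k arbitrary: e f)
  case 0
  then show ?case using A B by (simp add: sym_coeff_0[of _ n] expos_0)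
next
  case (Suc k)
  then obtain i e' where e: "i < n" "e' \<in> expos n k" "e = inc i e'"
    using expos_Suc_ex_inc by blast
  note len = expos_length[OF e(2)] expos_length[OF Suc.prems(2)]
  have IH: "shift_coeff (A * B) l e' f = (\<Sum>g\<in>expos n k. sym_coeff A e' g * shift_coeff B l g f)" if "l < n" for l
    using Suc.IH[OF e(2) expos_dec[OF Suc.prems(2) that]] by (simp add: shift_coeff_def)
  have "sym_coeff (A * B) e f = (\<Sum>l<n. (\<Sum>j<n. A $$ (i, j) * B $$ (j, l)) * (\<Sum>g\<in>expos n k. sym_coeff A e' g * shift_coeff B l g f))"
    using A B e len by (simp add: sym_coeff_inc[of _ n] IH scalar_prod_def atLeast0LessThan)
  also have "\<dots> = (\<Sum>l<n. \<Sum>j<n. \<Sum>g\<in>expos n k. A $$ (i, j) * (sym_coeff A e' g * (B $$ (j, l) * shift_coeff B l g f)))"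
    unfolding sum_product by (simp add: mult.assoc mult.left_commute)
  also have "\<dots> = (\<Sum>j<n. \<Sum>g\<in>expos n k. \<Sum>l<n. A $$ (i, j) * (sym_coeff A e' g * (B $$ (j, l) * shift_coeff B l g f)))"
    by (subst sum.swap) (intro sum.cong refl sum.swap)
  also have "\<dots> = (\<Sum>j<n. \<Sum>g\<in>expos n k. A $$ (i, j) * (sym_coeff A e' (dec j (inc j g)) * sym_coeff B (inc j g) f))"
  proof (intro sum.cong refl)
    fix j g assume "j \<in> {..<n}" "g \<in> expos n k"
    then show "(\<Sum>l<n. A $$ (i, j) * (sym_coeff A e' g * (B $$ (j, l) * shift_coeff B l g f))) =
      A $$ (i, j) * (sym_coeff A e' (dec j (inc j g)) * sym_coeff B (inc j g) f)"
      using B len by (simp add: sym_coeff_inc[of _ n] expos_length sum_distrib_left)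
  qed
  also have "\<dots> = (\<Sum>j<n. \<Sum>g\<in>expos n (Suc k). A $$ (i, j) * (shift_coeff A j e' g * sym_coeff B g f))"
  proof (rule sum.cong[OF refl])
    fix j assume "j \<in> {..<n}"
    then show "(\<Sum>g\<in>expos n k. A $$ (i, j) * (sym_coeff A e' (dec j (inc j g)) * sym_coeff B (inc j g) f)) =
        (\<Sum>g\<in>expos n (Suc k). A $$ (i, j) * (shift_coeff A j e' g * sym_coeff B g f))"
      by (subst sum_expos_inc[of j n "\<lambda>g. A $$ (i, j) * (sym_coeff A e' (dec j g) * sym_coeff B g f)"])
         (auto simp: shift_coeff_def intro!: sum.cong)
  qed
  also have "\<dots> = (\<Sum>g\<in>expos n (Suc k). (\<Sum>j<n. A $$ (i, j) * shift_coeff A j e' g) * sym_coeff B g f)"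
    unfolding sum_distrib_right by (subst sum.swap) (simp add: mult.assoc)
  also have "\<dots> = (\<Sum>g\<in>expos n (Suc k). sym_coeff A e g * sym_coeff B g f)"
    using A e by (intro sum.cong) (auto simp: sym_coeff_inc[of _ n] expos_length)
  finally show ?case .
qed

lemma sym_coeff_one:
  "e \<in> expos n k \<Longrightarrow> f \<in> expos n k \<Longrightarrow> sym_coeff (1\<^sub>m n :: 'r::comm_ring_1 mat) e f = (if e = f then 1 else 0)"
proof (induction k arbitrary: e f)
  case 0
  then show ?case by (simp add: sym_coeff_0[of _ n]) (simp add: expos_0)
next
  case (Suc k)
  then obtain i e' where e: "i < n" "e' \<in> expos n k" "e = inc i e'"
    using expos_Suc_ex_inc by blast
  note len = expos_length[OF e(2)] expos_length[OF Suc.prems(2)]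
  have "sym_coeff (1\<^sub>m n :: 'r mat) e f = (\<Sum>j<n. (1\<^sub>m n :: 'r mat) $$ (i, j) * shift_coeff (1\<^sub>m n) j e' f)"
    using e len by (simp add: sym_coeff_inc[of _ n])
  also have "\<dots> = (\<Sum>j<n. if i = j then shift_coeff (1\<^sub>m n) j e' f else 0)"
    using e by (intro sum.cong) auto
  also have "\<dots> = shift_coeff (1\<^sub>m n) i e' f"
    using e by simp
  also have "\<dots> = (if e = f then 1 else 0)"
  proof (cases "f ! i = 0")
    case True
    then have "e \<noteq> f" using e len by (auto simp: nth_inc)
    with True show ?thesis by (simp add: shift_coeff_def)
  next
    case False
    then have "e' = dec i f \<longleftrightarrow> e = f"
      using e len by (metis dec_inc inc_dec neq0_conv)
    with False show ?thesis
      using Suc.IH[OF e(2) expos_dec[OF Suc.prems(2) e(1)]] by (simp add: shift_coeff_def)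
  qed
  finally show ?case .
qed

text \<open>This is the product rule for the derivative with respect to \<open>t\<^sub>j\<close> of the image of \<open>t\<^sup>e\<close>, multiplied by
  \<open>t\<^sub>j\<close> and read off at \<open>t\<^sup>f\<close>. Proved on coefficients, it follows from \<open>sym_coeff_inc\<close> by induction on the
  degree.\<close>

lemma sym_coeff_deriv:
  fixes A :: "'r::comm_ring_1 mat"
  assumes A: "A \<in> carrier_mat n n" and j: "j < n"
  shows "e \<in> expos n k \<Longrightarrow> f \<in> expos n k \<Longrightarrow>
    of_nat (f ! j) * sym_coeff A e f = (\<Sum>i<n. of_nat (e ! i) * A $$ (i, j) * shift_coeff A j (dec i e) f)"
proof (induction k arbitrary: e f)
  case 0
  then show ?case using j by (simp add: expos_0)
next
  case (Suc k)
  then obtain r e' where e: "r < n" "e' \<in> expos n k" "e = inc r e'"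
    using expos_Suc_ex_inc by blast
  note len = expos_length[OF e(2)] expos_length[OF Suc.prems(2)]
  show ?case
  proof (cases "f ! j = 0")
    case True
    then show ?thesis by (simp add: shift_coeff_def)
  next
    case False
    define g where "g = dec j f"
    have g: "g \<in> expos n k" "f = inc j g" "length g = n"
      using False Suc.prems(2) j len by (auto simp: g_def expos_dec inc_dec)
    \<comment> \<open>the derivative of \<open>t\<^sub>l\<close> times the image of \<open>t\<^bsup>e'\<^esup>\<close>\<close>
    have *: "of_nat (f ! j) * shift_coeff A l e' f =
        (if l = j then sym_coeff A e' g else 0)
        + (\<Sum>i<n. of_nat (e' ! i) * A $$ (i, j) * shift_coeff A l (dec i e') g)" if l: "l < n" for l
    proof (cases "l = j")
      case True
      then show ?thesis
        using Suc.IH[OF e(2) g(1)] j g by (simp add: shift_coeff_def nth_inc ring_distribs)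
    next
      case lj: False
      show ?thesis
      proof (cases "g ! l = 0")
        case True
        then show ?thesis using lj g j by (simp add: shift_coeff_def nth_inc)
      next
        case gl: False
        then obtain k' where k': "k = Suc k'"
          using g(1) l by (cases k) (auto simp: expos_0)
        have "inc j (dec l g) \<in> expos n k"
          using g(1) gl l j unfolding k' by (auto intro!: expos_inc expos_dec)
        from Suc.IH[OF e(2) this]
        show ?thesis
          using lj gl g j l by (simp add: shift_coeff_def nth_inc nth_dec dec_inc_commute)
      qed
    qed
    have "of_nat (f ! j) * sym_coeff A e f = (\<Sum>l<n. A $$ (r, l) * (of_nat (f ! j) * shift_coeff A l e' f))"
      using A e len by (simp add: sym_coeff_inc[of _ n] sum_distrib_left ac_simps)
    also have "\<dots> = (\<Sum>l<n. A $$ (r, l) * (if l = j then sym_coeff A e' g else 0)) +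
       (\<Sum>l<n. \<Sum>i<n. A $$ (r, l) * (of_nat (e' ! i) * A $$ (i, j) * shift_coeff A l (dec i e') g))"
      by (simp add: * ring_distribs sum.distrib sum_distrib_left)
    also have "(\<Sum>l<n. A $$ (r, l) * (if l = j then sym_coeff A e' g else 0)) = A $$ (r, j) * sym_coeff A e' g"
      using j by (simp add: if_distrib[of "\<lambda>x. _ * x"] cong: if_cong)
    also have "(\<Sum>l<n. \<Sum>i<n. A $$ (r, l) * (of_nat (e' ! i) * A $$ (i, j) * shift_coeff A l (dec i e') g))
       = (\<Sum>i<n. of_nat (e' ! i) * A $$ (i, j) * sym_coeff A (inc r (dec i e')) g)"
      using A e len g by (subst sum.swap) (simp add: sym_coeff_inc[of _ n] sum_distrib_left ac_simps)
    also have "\<dots> = (\<Sum>i<n. of_nat (e' ! i) * A $$ (i, j) * shift_coeff A j (dec i e) f)"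
    proof (intro sum.cong refl)
      fix i assume i: "i \<in> {..<n}"
      show "of_nat (e' ! i) * A $$ (i, j) * sym_coeff A (inc r (dec i e')) g =
        of_nat (e' ! i) * A $$ (i, j) * shift_coeff A j (dec i e) f"
        using i e len j g by (cases "e' ! i = 0") (auto simp: dec_inc_commute shift_coeff_def nth_inc)
    qed
    also have "A $$ (r, j) * sym_coeff A e' g = (\<Sum>i<n. if i = r then A $$ (r, j) * sym_coeff A e' g else 0)"
      using e by simp
    also have "\<dots> + (\<Sum>i<n. of_nat (e' ! i) * A $$ (i, j) * shift_coeff A j (dec i e) f)
       = (\<Sum>i<n. of_nat (e ! i) * A $$ (i, j) * shift_coeff A j (dec i e) f)"
      unfolding sum.distrib[symmetric]
      using e g len j by (intro sum.cong refl) (auto simp: nth_inc shift_coeff_def ring_distribs)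
    finally show ?thesis .
  qed
qed

lemma expo_fact_inc: "i < length e \<Longrightarrow> expo_fact (inc i e) = (e ! i + 1) * expo_fact e"
proof (induction e arbitrary: i)
  case (Cons a e)
  show ?case
  proof (cases i)
    case (Suc i')
    then show ?thesis using Cons.IH[of i'] Cons.prems
      by (simp add: expo_fact_def inc_def mult.left_commute)
  qed (simp add: expo_fact_def inc_def algebra_simps)
qed simp

text \<open>Both sides satisfy the same recursion on the degree: for the left side it is \<open>sym_coeff_inc\<close>, and
  for the right side, where \<open>e\<close> is the exponent of the target monomial, it is the derivative rule
  \<open>sym_coeff_deriv\<close>.\<close>

lemma sym_coeff_transpose:
  fixes A :: "'r::comm_ring_1 mat"
  assumes A: "A \<in> carrier_mat n n"
  shows "e \<in> expos n k \<Longrightarrow> f \<in> expos n k \<Longrightarrow>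
    of_nat (expo_fact f) * sym_coeff A e f = of_nat (expo_fact e) * sym_coeff (transpose_mat A) f e"
proof (induction k arbitrary: e f)
  case 0
  then show ?case using A by (simp add: sym_coeff_0[of _ n] expos_0)
next
  case (Suc k)
  then obtain r e' where e: "r < n" "e' \<in> expos n k" "e = inc r e'"
    using expos_Suc_ex_inc by blast
  note len = expos_length[OF e(2)] expos_length[OF Suc.prems(2)]
  let ?T = "transpose_mat A"
  have T: "?T \<in> carrier_mat n n" using A by simp
  have *: "of_nat (expo_fact f) * shift_coeff A j e' f =
     of_nat (f ! j) * (of_nat (expo_fact e') * shift_coeff ?T r (dec j f) e)" if j: "j < n" for j
  proof (cases "f ! j = 0")
    case False
    then have f: "f = inc j (dec j f)" using len j by (simp add: inc_dec)
    have "of_nat (expo_fact f) = (of_nat (f ! j) * of_nat (expo_fact (dec j f)) :: 'r)"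
      by (subst f, subst expo_fact_inc) (use len j False in \<open>auto simp: nth_dec\<close>)
    then show ?thesis
      using Suc.IH[OF e(2) expos_dec[OF Suc.prems(2) j]] False e len
      by (simp add: shift_coeff_def nth_inc mult.assoc)
  qed (simp add: shift_coeff_def)
  have "of_nat (expo_fact f) * sym_coeff A e f = (\<Sum>j<n. A $$ (r, j) * (of_nat (expo_fact f) * shift_coeff A j e' f))"
    using A e len by (simp add: sym_coeff_inc[of _ n] sum_distrib_left ac_simps)
  also have "\<dots> = of_nat (expo_fact e') * (\<Sum>j<n. of_nat (f ! j) * ?T $$ (j, r) * shift_coeff ?T r (dec j f) e)"
    using A e by (simp add: * sum_distrib_left ac_simps)
  also have "\<dots> = of_nat (expo_fact e') * (of_nat (e ! r) * sym_coeff ?T f e)"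
    using sym_coeff_deriv[OF T e(1) Suc.prems(2,1)] by simp
  also have "\<dots> = of_nat (expo_fact e) * sym_coeff ?T f e"
    using e len by (simp add: expo_fact_inc nth_inc algebra_simps)
  finally show ?case .
qed

section \<open>Evaluation of polynomials in several variables\<close>

definition mon_eval :: "('v \<Rightarrow> 'r::comm_ring_1) \<Rightarrow> ('v \<Rightarrow>\<^sub>0 nat) \<Rightarrow> 'r" where
  "mon_eval a k = (\<Prod>v\<in>Poly_Mapping.keys k. a v ^ Poly_Mapping.lookup k v)"

text \<open>This is \<open>peval\<close> for an arbitrary set of variables, with an assignment in place of a matrix.\<close>

definition mpoly_eval :: "('c::zero \<Rightarrow> 'r::comm_ring_1) \<Rightarrow> ('v \<Rightarrow> 'r) \<Rightarrow> (('v \<Rightarrow>\<^sub>0 nat) \<Rightarrow>\<^sub>0 'c) \<Rightarrow> 'r" where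
  "mpoly_eval h a p = (\<Sum>k\<in>Poly_Mapping.keys p. h (Poly_Mapping.lookup p k) * mon_eval a k)"

lemma mon_eval_superset:
  "finite S \<Longrightarrow> Poly_Mapping.keys k \<subseteq> S \<Longrightarrow> mon_eval a k = (\<Prod>v\<in>S. a v ^ Poly_Mapping.lookup k v)"
  unfolding mon_eval_def by (rule prod.mono_neutral_left) (auto simp: in_keys_iff)

lemma mon_eval_0 [simp]: "mon_eval a 0 = 1"
  by (simp add: mon_eval_def)

lemma mon_eval_single [simp]: "mon_eval a (Poly_Mapping.single v e) = a v ^ e"
  by (cases "e = 0") (simp_all add: mon_eval_def)

lemma mon_eval_add: "mon_eval a (k + l) = mon_eval a k * mon_eval a l"
proof -
  let ?S = "Poly_Mapping.keys k \<union> Poly_Mapping.keys l"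
  have "mon_eval a (k + l) = (\<Prod>v\<in>?S. a v ^ Poly_Mapping.lookup (k + l) v)"
    using keys_add[of k l] by (intro mon_eval_superset) auto
  then show ?thesis
    by (simp add: mon_eval_superset[of ?S] lookup_add power_add prod.distrib)
qed

lemma mpoly_eval_superset:
  assumes "h 0 = 0" and "finite S" and "Poly_Mapping.keys p \<subseteq> S"
  shows "mpoly_eval h a p = (\<Sum>k\<in>S. h (Poly_Mapping.lookup p k) * mon_eval a k)"
  unfolding mpoly_eval_def using assms by (intro sum.mono_neutral_left) (auto simp: in_keys_iff)

lemma mpoly_eval_single: "h 0 = 0 \<Longrightarrow> mpoly_eval h a (Poly_Mapping.single k c) = h c * mon_eval a k"
  by (subst mpoly_eval_superset[of h "{k}"]) auto

lemma poly_mapping_eq_sum_single: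
  "p = (\<Sum>k\<in>Poly_Mapping.keys p. Poly_Mapping.single k (Poly_Mapping.lookup p k))"
  by (rule poly_mapping_eqI) (auto simp: lookup_sum lookup_single when_def in_keys_iff)

lemma comm_ring_hom_mpoly_eval:
  fixes h :: "'c::comm_ring_1 \<Rightarrow> 'r::comm_ring_1"
  assumes "comm_ring_hom h"
  shows "comm_ring_hom (mpoly_eval h a)"
proof -
  interpret h: comm_ring_hom h by fact
  have add: "mpoly_eval h a (p + q) = mpoly_eval h a p + mpoly_eval h a q" for p q
  proof -
    let ?S = "Poly_Mapping.keys p \<union> Poly_Mapping.keys q"
    have "mpoly_eval h a (p + q) = (\<Sum>k\<in>?S. h (Poly_Mapping.lookup (p + q) k) * mon_eval a k)"
      using keys_add[of p q] by (intro mpoly_eval_superset) auto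
    then show ?thesis
      by (simp add: mpoly_eval_superset[of h ?S] lookup_add h.hom_add ring_distribs sum.distrib)
  qed
  have zero: "mpoly_eval h a 0 = 0" by (simp add: mpoly_eval_def)
  have sum: "mpoly_eval h a (sum f S) = (\<Sum>x\<in>S. mpoly_eval h a (f x))" for f and S :: "'x set"
    by (induction S rule: infinite_finite_induct) (simp_all add: add zero)
  have one: "mpoly_eval h a 1 = 1"
    using mpoly_eval_single[of h a 0 1] by simp
  have mult: "mpoly_eval h a (p * q) = mpoly_eval h a p * mpoly_eval h a q" for p q
  proof -
    have "p * q = (\<Sum>k\<in>Poly_Mapping.keys p. \<Sum>l\<in>Poly_Mapping.keys q.
       Poly_Mapping.single (k + l) (Poly_Mapping.lookup p k * Poly_Mapping.lookup q l))"
      using arg_cong2[OF poly_mapping_eq_sum_single[of p] poly_mapping_eq_sum_single[of q], of "(*)"]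
      by (simp only: sum_product mult_single)
    then have "mpoly_eval h a (p * q) = (\<Sum>k\<in>Poly_Mapping.keys p. \<Sum>l\<in>Poly_Mapping.keys q.
       (h (Poly_Mapping.lookup p k) * mon_eval a k) * (h (Poly_Mapping.lookup q l) * mon_eval a l))"
      by (simp add: sum mpoly_eval_single mon_eval_add h.hom_mult ac_simps)
    then show ?thesis by (simp add: mpoly_eval_def sum_product)
  qed
  show ?thesis
    by unfold_locales (fact add mult one zero)+
qed

lemma comm_ring_hom_of_int: "comm_ring_hom (of_int :: int \<Rightarrow> 'r::comm_ring_1)"
  by unfold_locales simp_all

text \<open>The value 1 outside the matrix agrees with the convention of \<open>peval\<close>, which omits such factors.\<close>

definition entry_assign :: "'r::comm_ring_1 mat \<Rightarrow> nat \<times> nat \<Rightarrow> 'r" where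
  "entry_assign M = (\<lambda>(i, j). if i < dim_row M \<and> j < dim_col M then M $$ (i, j) else 1)"

lemma peval_eq_mpoly_eval: "peval h M p = mpoly_eval h (entry_assign M) p"
proof -
  have "(\<Prod>i<dim_row M. \<Prod>j<dim_col M. (M $$ (i, j)) ^ Poly_Mapping.lookup k (i, j)) = mon_eval (entry_assign M) k" for k
  proof -
    let ?I = "{..<dim_row M} \<times> {..<dim_col M}"
    have "mon_eval (entry_assign M) k = (\<Prod>v\<in>?I \<union> Poly_Mapping.keys k. entry_assign M v ^ Poly_Mapping.lookup k v)"
      by (rule mon_eval_superset) auto
    also have "\<dots> = (\<Prod>v\<in>?I. entry_assign M v ^ Poly_Mapping.lookup k v)"
      by (rule prod.mono_neutral_right) (auto simp: entry_assign_def split: if_splits)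
    also have "\<dots> = (\<Prod>(i, j)\<in>?I. (M $$ (i, j)) ^ Poly_Mapping.lookup k (i, j))"
      by (rule prod.cong) (auto simp: entry_assign_def)
    finally show ?thesis by (simp add: prod.cartesian_product)
  qed
  then show ?thesis by (simp add: peval_def mpoly_eval_def)
qed

lemma comm_ring_hom_peval: "comm_ring_hom h \<Longrightarrow> comm_ring_hom (peval h M)"
  using comm_ring_hom_mpoly_eval[of h "entry_assign M"] by (simp add: peval_eq_mpoly_eval[abs_def])

text \<open>Extension of scalars from the integers; as it is an evaluation, it is a ring homomorphism.\<close>

definition int_mpoly :: "(('v \<Rightarrow>\<^sub>0 nat) \<Rightarrow>\<^sub>0 int) \<Rightarrow> (('v \<Rightarrow>\<^sub>0 nat) \<Rightarrow>\<^sub>0 'c::comm_ring_1)" where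
  "int_mpoly = mpoly_eval of_int (\<lambda>v. Poly_Mapping.single (Poly_Mapping.single v 1) 1)"

lemma mon_eval_vars:
  "mon_eval (\<lambda>v. Poly_Mapping.single (Poly_Mapping.single v 1) (1 :: 'c::comm_ring_1)) k = Poly_Mapping.single k 1"
proof -
  have pow: "Poly_Mapping.single (Poly_Mapping.single v 1) (1 :: 'c) ^ e = Poly_Mapping.single (Poly_Mapping.single v e) 1" for v :: 'a and e
    by (induction e) (simp_all add: mult_single single_add[symmetric])
  have "(\<Prod>v\<in>S. Poly_Mapping.single (Poly_Mapping.single v (f v)) (1 :: 'c)) = Poly_Mapping.single (\<Sum>v\<in>S. Poly_Mapping.single v (f v)) 1"
    for S and f :: "'a \<Rightarrow> nat"
    by (induction S rule: infinite_finite_induct) (simp_all add: mult_single)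
  then show ?thesis
    by (simp only: mon_eval_def pow) (simp only: poly_mapping_eq_sum_single[symmetric])
qed

lemma lookup_int_mpoly:
  "Poly_Mapping.lookup (int_mpoly p :: ('v \<Rightarrow>\<^sub>0 nat) \<Rightarrow>\<^sub>0 'c::comm_ring_1) k = of_int (Poly_Mapping.lookup p k)"
proof -
  have "(int_mpoly p :: ('v \<Rightarrow>\<^sub>0 nat) \<Rightarrow>\<^sub>0 'c) = (\<Sum>k\<in>Poly_Mapping.keys p. Poly_Mapping.single k (of_int (Poly_Mapping.lookup p k)))"
    by (simp add: int_mpoly_def mpoly_eval_def mon_eval_vars[unfolded One_nat_def] mult_single flip: single_of_int)
  then show ?thesis
    by (auto simp: lookup_sum lookup_single when_def in_keys_iff)
qed

lemma peval_int_mpoly_rat: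
  "peval (\<lambda>q :: rat. of_int \<lfloor>q\<rfloor>) M (int_mpoly p) = peval of_int M p"
proof -
  have "Poly_Mapping.keys (int_mpoly p :: rat entry_poly) = Poly_Mapping.keys p"
    by (auto simp: in_keys_iff lookup_int_mpoly)
  then show ?thesis by (simp add: peval_def lookup_int_mpoly)
qed

lemma peval_int_mpoly: "peval id M (int_mpoly p) = peval of_int M p"
proof -
  have "Poly_Mapping.keys (int_mpoly p :: 'a entry_poly) \<subseteq> Poly_Mapping.keys p"
    by (auto simp: in_keys_iff lookup_int_mpoly)
  then show ?thesis
    unfolding peval_eq_mpoly_eval by (subst mpoly_eval_superset) (auto simp: lookup_int_mpoly mpoly_eval_def)
qed

section \<open>The general linear group over a commutative ring\<close>

lemma GL_mult [simp]: "x \<otimes>\<^bsub>GL d\<^esub> y = x * y"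
  by (simp add: GL_def units_of_def ring_mat_def)

lemma GL_one [simp]: "\<one>\<^bsub>GL d\<^esub> = 1\<^sub>m d"
  by (simp add: GL_def units_of_def ring_mat_def)

lemma GL_iff: "M \<in> carrier (GL d) \<longleftrightarrow> M \<in> carrier_mat d d \<and> (\<exists>N\<in>carrier_mat d d. M * N = 1\<^sub>m d \<and> N * M = 1\<^sub>m d)"
  by (auto simp: GL_def units_of_def ring_mat_def Units_def)

lemma GL_carrier: "M \<in> carrier (GL d) \<Longrightarrow> M \<in> carrier_mat d d"
  by (simp add: GL_iff)

lemma group_GL: "group (GL d :: 'r::comm_ring_1 mat monoid)"
proof -
  interpret ring "ring_mat TYPE('r) d ()" by (rule ring_mat)
  show ?thesis unfolding GL_def by (rule units_group)
qed

lemma GL_inv: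
  fixes M :: "'r::comm_ring_1 mat"
  assumes "M \<in> carrier (GL d)"
  shows "inv\<^bsub>GL d\<^esub> M \<in> carrier (GL d)" "inv\<^bsub>GL d\<^esub> M \<in> carrier_mat d d"
    "M * inv\<^bsub>GL d\<^esub> M = 1\<^sub>m d" "inv\<^bsub>GL d\<^esub> M * M = 1\<^sub>m d"
proof -
  interpret group "GL d :: 'r mat monoid" by (rule group_GL)
  show "inv\<^bsub>GL d\<^esub> M \<in> carrier (GL d)" using assms by (rule inv_closed)
  then show "inv\<^bsub>GL d\<^esub> M \<in> carrier_mat d d" by (rule GL_carrier)
  show "M * inv\<^bsub>GL d\<^esub> M = 1\<^sub>m d" "inv\<^bsub>GL d\<^esub> M * M = 1\<^sub>m d"
    using r_inv[OF assms] l_inv[OF assms] by simp_all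
qed

lemma GL_inv_eqI:
  fixes M :: "'r::comm_ring_1 mat"
  assumes "M \<in> carrier_mat d d" "N \<in> carrier_mat d d" "M * N = 1\<^sub>m d" "N * M = 1\<^sub>m d"
  shows "inv\<^bsub>GL d\<^esub> M = N"
proof -
  interpret group "GL d :: 'r mat monoid" by (rule group_GL)
  have "M \<in> carrier (GL d)" "N \<in> carrier (GL d)" using assms by (auto simp: GL_iff)
  then show ?thesis using inv_equality[of N M] assms by simp
qed

lemma GL_mult_closed:
  fixes M :: "'r::comm_ring_1 mat"
  shows "M \<in> carrier (GL d) \<Longrightarrow> N \<in> carrier (GL d) \<Longrightarrow> M * N \<in> carrier (GL d)"
  using group.is_monoid[OF group_GL[where 'r='r], of d] monoid.m_closed by fastforce

lemma GL_inv_mult: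
  fixes M :: "'r::comm_ring_1 mat"
  assumes "M \<in> carrier (GL d)" "N \<in> carrier (GL d)"
  shows "inv\<^bsub>GL d\<^esub> (M * N) = inv\<^bsub>GL d\<^esub> N * inv\<^bsub>GL d\<^esub> M"
  using group.inv_mult_group[OF group_GL assms] by simp

lemma one_in_GL: "(1\<^sub>m d :: 'r::comm_ring_1 mat) \<in> carrier (GL d)"
  by (auto simp: GL_iff intro!: bexI[of _ "1\<^sub>m d"])

lemma GL_inv_one: "inv\<^bsub>GL d\<^esub> (1\<^sub>m d :: 'r::comm_ring_1 mat) = 1\<^sub>m d"
  by (rule GL_inv_eqI) simp_all

lemma (in comm_ring_hom) GL_hom:
  assumes "A \<in> carrier (GL n)"
  shows "map_mat hom A \<in> carrier (GL n)" "map_mat hom (inv\<^bsub>GL n\<^esub> A) = inv\<^bsub>GL n\<^esub> (map_mat hom A)"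
proof -
  note c = GL_carrier[OF assms] GL_inv(2)[OF assms]
  have "map_mat hom A * map_mat hom (inv\<^bsub>GL n\<^esub> A) = 1\<^sub>m n"
    "map_mat hom (inv\<^bsub>GL n\<^esub> A) * map_mat hom A = 1\<^sub>m n"
    using GL_inv[OF assms] mat_hom_mult[OF c] mat_hom_mult[OF c(2,1)] mat_hom_one by metis+
  moreover have "map_mat hom A \<in> carrier_mat n n" "map_mat hom (inv\<^bsub>GL n\<^esub> A) \<in> carrier_mat n n"
    using c by simp_all
  ultimately show "map_mat hom A \<in> carrier (GL n)" "map_mat hom (inv\<^bsub>GL n\<^esub> A) = inv\<^bsub>GL n\<^esub> (map_mat hom A)"
    by (auto simp: GL_iff intro!: GL_inv_eqI[symmetric])
qed

lemma GL1_unit: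
  fixes l :: "'r::comm_ring_1 mat"
  assumes "l \<in> carrier (GL 1)"
  shows "l $$ (0, 0) * (inv\<^bsub>GL 1\<^esub> l) $$ (0, 0) = 1"
proof -
  have "(l * inv\<^bsub>GL 1\<^esub> l) $$ (0, 0) = l $$ (0, 0) * (inv\<^bsub>GL 1\<^esub> l) $$ (0, 0)"
    using GL_carrier[OF assms] GL_inv(2)[OF assms] by (simp add: scalar_prod_def)
  then show ?thesis using GL_inv(3)[OF assms] by simp
qed

lemma GL1_of_unit:
  fixes u :: "'r::comm_ring_1"
  assumes "u * u' = 1"
  shows "mat 1 1 (\<lambda>_. u) \<in> carrier (GL 1)" "inv\<^bsub>GL 1\<^esub> (mat 1 1 (\<lambda>_. u)) = mat 1 1 (\<lambda>_. u')"
proof -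
  have "mat 1 1 (\<lambda>_. u) * mat 1 1 (\<lambda>_. u') = 1\<^sub>m 1" "mat 1 1 (\<lambda>_. u') * mat 1 1 (\<lambda>_. u) = 1\<^sub>m 1"
    using assms by (auto intro!: eq_matI simp: scalar_prod_def mult.commute)
  then show "mat 1 1 (\<lambda>_. u) \<in> carrier (GL 1)" "inv\<^bsub>GL 1\<^esub> (mat 1 1 (\<lambda>_. u)) = mat 1 1 (\<lambda>_. u')"
    by (auto simp: GL_iff intro!: GL_inv_eqI bexI[of _ "mat 1 1 (\<lambda>_. u')"])
qed

section \<open>The representations\<close>

lemma E_list: "distinct (E_list m n)" "set (E_list m n) = expos n (m - 1)"
  by (simp_all add: E_list_def expo_list)

lemma F_list: "distinct (F_list m n)" "set (F_list m n) = expos n m"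
  by (simp_all add: F_list_def expo_list)

text \<open>By \<open>sym_coeff_transpose\<close>, applied to the generic matrix, rescaling by factorials turns \<open>S\<^sup>m\<close>
  of a matrix into the transpose of \<open>S\<^sup>m\<close> of its transpose. The entries of the latter come from
  integer polynomials, on which the floor in \<open>rho2\<close> acts as the identity; they specialise to every
  ring by naturality.\<close>

lemma rho2_entry_eval:
  fixes A :: "'r::comm_ring_1 mat"
  assumes A: "A \<in> carrier_mat n n" and f: "f \<in> expos n k" and f': "f' \<in> expos n k"
  shows "peval (\<lambda>q. of_int \<lfloor>q\<rfloor>) A (rho2_entry n f f') = sym_coeff (transpose_mat A) f' f"
proof -
  let ?G = "generic_mat n"
  define GZ :: "int entry_poly mat" where "GZ = mat n n (\<lambda>ij. Poly_Mapping.single (Poly_Mapping.single ij 1) 1)"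
  have G: "?G \<in> carrier_mat n n" by (simp add: generic_mat_def)
  have GZ: "GZ \<in> carrier_mat n n" by (simp add: GZ_def)
  interpret r: comm_ring_hom "int_mpoly :: int entry_poly \<Rightarrow> rat entry_poly"
    unfolding int_mpoly_def by (intro comm_ring_hom_mpoly_eval comm_ring_hom_of_int)
  interpret e: comm_ring_hom "peval of_int A :: int entry_poly \<Rightarrow> 'r"
    by (intro comm_ring_hom_peval comm_ring_hom_of_int)
  have map1: "map_mat int_mpoly (transpose_mat GZ) = transpose_mat ?G"
    by (rule eq_matI) (auto simp: GZ_def generic_mat_def int_mpoly_def mpoly_eval_single)
  have map2: "map_mat (peval of_int A) (transpose_mat GZ) = transpose_mat A"
    using A by (intro eq_matI) (auto simp: GZ_def peval_eq_mpoly_eval mpoly_eval_single entry_assign_def)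
  have nz: "expo_fact f \<noteq> 0" by (auto simp: expo_fact_def prod_list_zero_iff)
  let ?c = "\<lambda>q. Poly_Mapping.single (0 :: nat \<times> nat \<Rightarrow>\<^sub>0 nat) (q :: rat)"
  have "rho2_entry n f f' = ?c (1 / of_nat (expo_fact f)) * (of_nat (expo_fact f') * sym_coeff ?G f f')"
    by (simp add: rho2_entry_def mult_single mult.assoc[symmetric] flip: single_of_nat)
  also have "\<dots> = ?c (1 / of_nat (expo_fact f)) * (of_nat (expo_fact f) * sym_coeff (transpose_mat ?G) f' f)"
    by (simp add: sym_coeff_transpose[OF G f f'])
  also have "\<dots> = sym_coeff (transpose_mat ?G) f' f"
    using nz by (simp add: mult_single mult.assoc[symmetric] flip: single_of_nat)
  also have "\<dots> = int_mpoly (sym_coeff (transpose_mat GZ) f' f)"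
    using GZ by (subst r.sym_coeff_hom[of _ n f' k f]) (auto simp: map1 f f')
  finally have "peval (\<lambda>q. of_int \<lfloor>q\<rfloor>) A (rho2_entry n f f') = peval of_int A (sym_coeff (transpose_mat GZ) f' f)"
    by (simp add: peval_int_mpoly_rat)
  also have "\<dots> = sym_coeff (transpose_mat A) f' f"
    using GZ by (subst e.sym_coeff_hom[of _ n f' k f]) (auto simp: map2 f f')
  finally show ?thesis .
qed

lemma rho2_eq:
  assumes "A \<in> carrier_mat n n"
  shows "rho2 m n A = mat (length (F_list m n)) (length (F_list m n))
     (\<lambda>(i, j). sym_coeff (transpose_mat A) (F_list m n ! j) (F_list m n ! i))"
  unfolding rho2_def using F_list(2)[of m n]
  by (intro cong_mat) (auto intro!: rho2_entry_eval[OF assms, of _ m] simp flip: F_list(2))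

section \<open>Coordinates indexed by basis elements\<close>

text \<open>Matrices of size \<open>rk m n\<close> are described by functions of two basis elements (\<open>mat_of\<close>, \<open>ent\<close>). In
  this form the arbitrary enumeration of the basis disappears, and sums over positions become sums
  over exponent vectors.\<close>

locale lie_lattice =
  fixes m n :: nat
  assumes m: "m \<ge> 1" and n: "n \<ge> 2"
begin

abbreviation "d \<equiv> rk m n"
abbreviation "F \<equiv> expos n m"
abbreviation "B \<equiv> set (basis m n)"

definition E :: "nat list set" where
  "E = expos n (m - 1)"

lemma finite_E [simp]: "finite E" and finite_F [simp]: "finite F"
  by (simp_all add: E_def finite_expos)

lemma set_E_list: "set (E_list m n) = E"
  by (simp add: E_def E_list)

lemma B_eq: "B = X ` E \<union> Y ` F \<union> Z ` {..<n}"
  by (auto simp: basis_def set_E_list F_list)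

lemma B_iff [simp]: "X e \<in> B \<longleftrightarrow> e \<in> E" "Y f \<in> B \<longleftrightarrow> f \<in> F" "Z i \<in> B \<longleftrightarrow> i < n"
  by (auto simp: B_eq)

lemma distinct_basis: "distinct (basis m n)"
  by (auto simp: basis_def distinct_map E_list F_list inj_on_def)

lemma length_lists: "length (E_list m n) = card E" "length (F_list m n) = card F"
  using E_list F_list by (metis distinct_card E_def)+

lemma rk_eq: "d = card E + card F + n"
  by (simp add: rk_def basis_def length_lists)

lemma bij_basis: "bij_betw ((!) (basis m n)) {..<d} B"
  unfolding rk_def by (rule bij_betw_nth[OF distinct_basis]) auto

lemma sum_basis: "(\<Sum>i<d. g (basis m n ! i)) = sum g B"
  by (rule sum.reindex_bij_betw[OF bij_basis])

lemma basis_in_B: "i < d \<Longrightarrow> basis m n ! i \<in> B"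
  by (simp add: rk_def)

lemma sum_B: "sum g B = (\<Sum>e\<in>E. g (X e)) + (\<Sum>f\<in>F. g (Y f)) + (\<Sum>i<n. g (Z i))"
  unfolding B_eq
  by (subst sum.union_disjoint; (subst sum.union_disjoint)?)
     (auto simp: finite_expos sum.reindex inj_on_def)

definition pos :: "basis_elem \<Rightarrow> nat" where
  "pos = inv_into {..<d} ((!) (basis m n))"

lemma pos_less: "a \<in> B \<Longrightarrow> pos a < d"
  using bij_betw_apply[OF bij_betw_inv_into[OF bij_basis]] by (auto simp: pos_def)

lemma basis_pos: "a \<in> B \<Longrightarrow> basis m n ! pos a = a"
  unfolding pos_def by (rule bij_betw_inv_into_right[OF bij_basis])

lemma pos_basis: "i < d \<Longrightarrow> pos (basis m n ! i) = i"
  unfolding pos_def using bij_betw_inv_into_left[OF bij_basis] by simp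

definition mat_of :: "(basis_elem \<Rightarrow> basis_elem \<Rightarrow> 'r) \<Rightarrow> 'r mat" where
  "mat_of g = mat d d (\<lambda>(i, j). g (basis m n ! i) (basis m n ! j))"

definition ent :: "'r mat \<Rightarrow> basis_elem \<Rightarrow> basis_elem \<Rightarrow> 'r" where
  "ent M a b = M $$ (pos a, pos b)"

lemma mat_of_carrier [simp]: "mat_of g \<in> carrier_mat d d"
  by (simp add: mat_of_def)

lemma mat_of_ent: "M \<in> carrier_mat d d \<Longrightarrow> mat_of (ent M) = M"
  by (rule eq_matI) (auto simp: mat_of_def ent_def pos_basis)

lemma ent_mat_of [simp]: "a \<in> B \<Longrightarrow> b \<in> B \<Longrightarrow> ent (mat_of g) a b = g a b"
  by (simp add: mat_of_def ent_def pos_less basis_pos)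

lemma mat_of_cong: "(\<And>a b. a \<in> B \<Longrightarrow> b \<in> B \<Longrightarrow> g a b = h a b) \<Longrightarrow> mat_of g = mat_of h"
  by (rule eq_matI) (auto simp: mat_of_def basis_in_B)

lemma mat_of_eq_iff: "mat_of g = mat_of h \<longleftrightarrow> (\<forall>a\<in>B. \<forall>b\<in>B. g a b = h a b)"
  using ent_mat_of mat_of_cong by metis

lemma mat_eq_iff_ent:
  "M \<in> carrier_mat d d \<Longrightarrow> N \<in> carrier_mat d d \<Longrightarrow> M = N \<longleftrightarrow> (\<forall>a\<in>B. \<forall>b\<in>B. ent M a b = ent N a b)"
  using mat_of_ent mat_of_eq_iff by metis

lemma mat_of_mult:
  fixes g h :: "basis_elem \<Rightarrow> basis_elem \<Rightarrow> 'r::comm_ring_1"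
  shows "mat_of g * mat_of h = mat_of (\<lambda>a c. \<Sum>b\<in>B. g a b * h b c)"
  by (rule eq_matI) (auto simp: mat_of_def scalar_prod_def atLeast0LessThan sum_basis[symmetric])

lemma ent_mult:
  fixes M N :: "'r::comm_ring_1 mat"
  assumes "M \<in> carrier_mat d d" "N \<in> carrier_mat d d" "a \<in> B" "c \<in> B"
  shows "ent (M * N) a c = (\<Sum>b\<in>B. ent M a b * ent N b c)"
  using assms mat_of_mult[of "ent M" "ent N"] by (simp add: mat_of_ent)

lemma mat_of_one: "1\<^sub>m d = mat_of (\<lambda>a b. if a = b then 1 else 0)"
  by (rule eq_matI) (auto simp: mat_of_def rk_def nth_eq_iff_index_eq[OF distinct_basis])

lemma ent_one: "a \<in> B \<Longrightarrow> b \<in> B \<Longrightarrow> ent (1\<^sub>m d) a b = (if a = b then 1 else 0)"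
  by (simp add: mat_of_one)

text \<open>The block matrices \<open>tri_block\<close>, as functions of basis elements.\<close>

fun blk :: "(nat list \<Rightarrow> nat list \<Rightarrow> 'r) \<Rightarrow> (nat list \<Rightarrow> nat list \<Rightarrow> 'r) \<Rightarrow> (nat list \<Rightarrow> nat \<Rightarrow> 'r)
    \<Rightarrow> (nat list \<Rightarrow> nat list \<Rightarrow> 'r) \<Rightarrow> (nat list \<Rightarrow> nat \<Rightarrow> 'r) \<Rightarrow> (nat \<Rightarrow> nat \<Rightarrow> 'r)
    \<Rightarrow> basis_elem \<Rightarrow> basis_elem \<Rightarrow> 'r::zero" where
  "blk p c d1 q d2 s (X e) (X e') = p e e'"
| "blk p c d1 q d2 s (X e) (Y f) = c e f"
| "blk p c d1 q d2 s (X e) (Z i) = d1 e i"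
| "blk p c d1 q d2 s (Y f) (Y f') = q f f'"
| "blk p c d1 q d2 s (Y f) (Z i) = d2 f i"
| "blk p c d1 q d2 s (Z i) (Z j) = s i j"
| "blk p c d1 q d2 s _ _ = 0"

lemma tri_block_eq_mat_of:
  fixes P :: "'r::zero mat"
  assumes P: "P = mat (length (E_list m n)) (length (E_list m n)) (\<lambda>(i, j). p (E_list m n ! i) (E_list m n ! j))"
    and C: "C = mat (length (E_list m n)) (length (F_list m n)) (\<lambda>(i, j). c (E_list m n ! i) (F_list m n ! j))"
    and D1: "D1 = mat (length (E_list m n)) n (\<lambda>(i, j). d1 (E_list m n ! i) j)"
    and Q: "Q = mat (length (F_list m n)) (length (F_list m n)) (\<lambda>(i, j). q (F_list m n ! i) (F_list m n ! j))"
    and D2: "D2 = mat (length (F_list m n)) n (\<lambda>(i, j). d2 (F_list m n ! i) j)"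
    and S: "S = mat n n (\<lambda>(i, j). s i j)"
  shows "tri_block P C D1 Q D2 S = mat_of (blk p c d1 q d2 s)"
proof (rule eq_matI)
  let ?r1 = "length (E_list m n)" and ?r2 = "length (F_list m n)"
  have d: "d = ?r1 + ?r2 + n" by (simp add: rk_def basis_def)
  have b: "basis m n ! i = (if i < ?r1 then X (E_list m n ! i) else if i < ?r1 + ?r2 then Y (F_list m n ! (i - ?r1))
     else Z (i - ?r1 - ?r2))" if "i < d" for i
    using that d by (auto simp: basis_def nth_append)
  show "dim_row (tri_block P C D1 Q D2 S) = dim_row (mat_of (blk p c d1 q d2 s))"
    "dim_col (tri_block P C D1 Q D2 S) = dim_col (mat_of (blk p c d1 q d2 s))"
    by (simp_all add: assms tri_block_def mat_of_def d)
  fix i j assume "i < dim_row (mat_of (blk p c d1 q d2 s))" "j < dim_col (mat_of (blk p c d1 q d2 s))"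
  then have ij: "i < d" "j < d" by (simp_all add: mat_of_def)
  then have "mat_of (blk p c d1 q d2 s) $$ (i, j) = blk p c d1 q d2 s (basis m n ! i) (basis m n ! j)"
    by (simp add: mat_of_def)
  also have "\<dots> = tri_block P C D1 Q D2 S $$ (i, j)"
    unfolding b[OF ij(1)] b[OF ij(2)] using ij unfolding d
    by (auto simp: assms tri_block_def append_rows_def)
  finally show "tri_block P C D1 Q D2 S $$ (i, j) = mat_of (blk p c d1 q d2 s) $$ (i, j)" ..
qed

lemma blk_mult:
  fixes p :: "nat list \<Rightarrow> nat list \<Rightarrow> 'r::comm_ring_1"
  shows "mat_of (blk p c d1 q d2 s) * mat_of (blk p' c' d1' q' d2' s') =
    mat_of (blk (\<lambda>a b. \<Sum>e\<in>E. p a e * p' e b) 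
      (\<lambda>a b. (\<Sum>e\<in>E. p a e * c' e b) + (\<Sum>f\<in>F. c a f * q' f b))
      (\<lambda>a b. (\<Sum>e\<in>E. p a e * d1' e b) + (\<Sum>f\<in>F. c a f * d2' f b) + (\<Sum>i<n. d1 a i * s' i b))
      (\<lambda>a b. \<Sum>f\<in>F. q a f * q' f b)
      (\<lambda>a b. (\<Sum>f\<in>F. q a f * d2' f b) + (\<Sum>i<n. d2 a i * s' i b))
      (\<lambda>a b. \<Sum>i<n. s a i * s' i b))"
  unfolding mat_of_mult
proof (rule mat_of_cong)
  fix a b
  show "(\<Sum>x\<in>B. blk p c d1 q d2 s a x * blk p' c' d1' q' d2' s' x b) = 
    blk (\<lambda>a b. \<Sum>e\<in>E. p a e * p' e b) 
      (\<lambda>a b. (\<Sum>e\<in>E. p a e * c' e b) + (\<Sum>f\<in>F. c a f * q' f b))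
      (\<lambda>a b. (\<Sum>e\<in>E. p a e * d1' e b) + (\<Sum>f\<in>F. c a f * d2' f b) + (\<Sum>i<n. d1 a i * s' i b))
      (\<lambda>a b. \<Sum>f\<in>F. q a f * q' f b)
      (\<lambda>a b. (\<Sum>f\<in>F. q a f * d2' f b) + (\<Sum>i<n. d2 a i * s' i b))
      (\<lambda>a b. \<Sum>i<n. s a i * s' i b) a b"
    unfolding sum_B by (cases a; cases b) simp_all
qed

section \<open>Automorphisms in coordinates\<close>

abbreviation lie :: "basis_elem \<Rightarrow> basis_elem \<Rightarrow> basis_elem \<Rightarrow> 'r::comm_ring_1" where
  "lie a b c \<equiv> of_int (lie_coeff a b c)"

text \<open>The row of \<open>a\<close> is the image of \<open>a\<close>; the two sides are the coefficients of \<open>c\<close> in the image of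
  \<open>[a, b]\<close> and in the bracket of the images.\<close>

definition preserves :: "'r::comm_ring_1 mat \<Rightarrow> bool" where
  "preserves M \<longleftrightarrow> (\<forall>a\<in>B. \<forall>b\<in>B. \<forall>c\<in>B. (\<Sum>x\<in>B. lie a b x * ent M x c) =
     (\<Sum>x\<in>B. \<Sum>y\<in>B. ent M a x * ent M b y * lie x y c))"

lemma preserves_index:
  fixes M :: "'r::comm_ring_1 mat"
  shows "preserves M \<longleftrightarrow> (\<forall>i<d. \<forall>j<d. \<forall>k<d. 
     (\<Sum>x<d. lie (basis m n ! i) (basis m n ! j) (basis m n ! x) * M $$ (x, k)) =
     (\<Sum>x<d. \<Sum>y<d. M $$ (i, x) * M $$ (j, y) * lie (basis m n ! x) (basis m n ! y) (basis m n ! k)))"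
    (is "_ \<longleftrightarrow> ?R")
proof -
  have ball: "(\<forall>a\<in>B. P a) \<longleftrightarrow> (\<forall>i<d. P (basis m n ! i))" for P
    by (metis basis_in_B basis_pos pos_less)
  show ?thesis
    unfolding preserves_def ball sum_basis[symmetric]
    by (simp add: ent_def pos_basis cong: sum.cong_simp)
qed

definition apply_rows :: "'r::comm_ring_1 mat \<Rightarrow> 'r vec \<Rightarrow> 'r vec" where
  "apply_rows M u = vec d (\<lambda>k. \<Sum>i<d. u $ i * M $$ (i, k))"

lemma apply_rows_mult:
  assumes "M \<in> carrier_mat d d" "N \<in> carrier_mat d d" 
  shows "apply_rows N (apply_rows M u) = apply_rows (M * N) u"
proof (rule eq_vecI)
  fix k assume "k < dim_vec (apply_rows (M * N) u)"
  then have k: "k < d" by (simp add: apply_rows_def)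
  have "apply_rows N (apply_rows M u) $ k = (\<Sum>j<d. \<Sum>i<d. u $ i * (M $$ (i, j) * N $$ (j, k)))"
    using k by (simp add: apply_rows_def sum_distrib_right mult.assoc)
  also have "\<dots> = (\<Sum>i<d. \<Sum>j<d. u $ i * (M $$ (i, j) * N $$ (j, k)))"
    by (rule sum.swap)
  also have "\<dots> = apply_rows (M * N) u $ k"
    using k assms by (simp add: apply_rows_def scalar_prod_def atLeast0LessThan sum_distrib_left)
  finally show "apply_rows N (apply_rows M u) $ k = apply_rows (M * N) u $ k" .
qed (simp add: apply_rows_def)

lemma apply_rows_one: "u \<in> carrier_vec d \<Longrightarrow> apply_rows (1\<^sub>m d) u = u"
  by (rule eq_vecI) (auto simp: apply_rows_def if_distrib[of "\<lambda>x. _ * x"] cong: if_cong)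

lemma apply_rows_carrier [simp]: "apply_rows M u \<in> carrier_vec d"
  by (simp add: apply_rows_def)

lemma bracket_unit:
  "i < d \<Longrightarrow> j < d \<Longrightarrow> bracket m n (unit_vec d i) (unit_vec d j) = 
    vec d (\<lambda>k. lie (basis m n ! i) (basis m n ! j) (basis m n ! k) :: 'r::comm_ring_1)"
  by (rule eq_vecI) (auto simp: bracket_def sum_distrib_right if_distrib[of "\<lambda>x. x * _"] if_distrib[of "\<lambda>x. _ * x"] cong: if_cong)

text \<open>By induction on the number of non-zero coordinates taken into account.\<close>

lemma linear_eq_apply_rows:
  fixes \<phi> :: "'r::comm_ring_1 vec \<Rightarrow> 'r vec"
  assumes cl: "\<And>u. u \<in> carrier_vec d \<Longrightarrow> \<phi> u \<in> carrier_vec d"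
    and add: "\<And>u v. u \<in> carrier_vec d \<Longrightarrow> v \<in> carrier_vec d \<Longrightarrow> \<phi> (u + v) = \<phi> u + \<phi> v"
    and smult: "\<And>c u. u \<in> carrier_vec d \<Longrightarrow> \<phi> (c \<cdot>\<^sub>v u) = c \<cdot>\<^sub>v \<phi> u"
    and u: "u \<in> carrier_vec d"
  shows "\<phi> u = apply_rows (row_matrix d \<phi>) u"
proof -
  let ?M = "row_matrix d \<phi>"
  have M: "?M $$ (i, k) = \<phi> (unit_vec d i) $ k" if "i < d" "k < d" for i k
    using that by (simp add: row_matrix_def mat_of_rows_def)
  let ?t = "\<lambda>k. vec d (\<lambda>i. if i < k then u $ i else 0)"
  have "\<phi> (?t k) = vec d (\<lambda>l. \<Sum>i<k. u $ i * ?M $$ (i, l))" if "k \<le> d" for k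
    using that
  proof (induction k)
    case 0
    have "?t 0 = 0 \<cdot>\<^sub>v 0\<^sub>v d" by (auto intro!: eq_vecI)
    then have "\<phi> (?t 0) = 0 \<cdot>\<^sub>v \<phi> (0\<^sub>v d)" by (simp only: smult zero_carrier_vec)
    then show ?case using cl[of "0\<^sub>v d"] by (auto intro!: eq_vecI)
  next
    case (Suc k)
    have "?t (Suc k) = ?t k + u $ k \<cdot>\<^sub>v unit_vec d k"
      using Suc.prems by (intro eq_vecI) (auto simp: less_Suc_eq)
    then have "\<phi> (?t (Suc k)) = \<phi> (?t k) + u $ k \<cdot>\<^sub>v \<phi> (unit_vec d k)"
      by (simp only: add smult vec_carrier smult_carrier_vec unit_vec_carrier)
    then show ?case
      using Suc cl[of "unit_vec d k"] by (auto intro!: eq_vecI simp: M)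
  qed
  from this[of d] have "\<phi> (?t d) = apply_rows ?M u" by (simp add: apply_rows_def)
  moreover have "?t d = u" using u by (intro eq_vecI) auto
  ultimately show ?thesis by simp
qed

lemma apply_rows_bracket:
  fixes M :: "'r::comm_ring_1 mat"
  assumes "preserves M" 
  shows "apply_rows M (bracket m n u v) = bracket m n (apply_rows M u) (apply_rows M v)"
proof (rule eq_vecI)
  let ?l = "\<lambda>i j k. lie (basis m n ! i) (basis m n ! j) (basis m n ! k) :: 'r"
  fix k assume "k < dim_vec (bracket m n (apply_rows M u) (apply_rows M v))"
  then have k: "k < d" by (simp add: bracket_def)
  have "apply_rows M (bracket m n u v) $ k = (\<Sum>x<d. \<Sum>i<d. \<Sum>j<d. u $ i * v $ j * (?l i j x * M $$ (x, k)))"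
    using k by (simp add: apply_rows_def bracket_def sum_distrib_right mult.assoc)
  also have "\<dots> = (\<Sum>i<d. \<Sum>x<d. \<Sum>j<d. u $ i * v $ j * (?l i j x * M $$ (x, k)))"
    by (rule sum.swap)
  also have "\<dots> = (\<Sum>i<d. \<Sum>j<d. \<Sum>x<d. u $ i * v $ j * (?l i j x * M $$ (x, k)))"
    by (intro sum.cong refl sum.swap)
  also have "\<dots> = (\<Sum>i<d. \<Sum>j<d. u $ i * v $ j * (\<Sum>x<d. \<Sum>y<d. M $$ (i, x) * M $$ (j, y) * ?l x y k))"
    using assms k unfolding preserves_index by (simp add: sum_distrib_left[symmetric])
  also have "\<dots> = (\<Sum>i<d. \<Sum>j<d. \<Sum>x<d. \<Sum>y<d. (u $ i * M $$ (i, x)) * (v $ j * M $$ (j, y)) * ?l x y k)"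
    by (simp add: sum_distrib_left ac_simps)
  also have "\<dots> = (\<Sum>i<d. \<Sum>x<d. \<Sum>j<d. \<Sum>y<d. (u $ i * M $$ (i, x)) * (v $ j * M $$ (j, y)) * ?l x y k)"
    by (intro sum.cong refl sum.swap)
  also have "\<dots> = (\<Sum>x<d. \<Sum>i<d. \<Sum>j<d. \<Sum>y<d. (u $ i * M $$ (i, x)) * (v $ j * M $$ (j, y)) * ?l x y k)"
    by (rule sum.swap)
  also have "\<dots> = (\<Sum>x<d. \<Sum>i<d. \<Sum>y<d. \<Sum>j<d. (u $ i * M $$ (i, x)) * (v $ j * M $$ (j, y)) * ?l x y k)"
    by (rule sum.cong[OF refl], rule sum.cong[OF refl], rule sum.swap)
  also have "\<dots> = (\<Sum>x<d. \<Sum>y<d. \<Sum>i<d. \<Sum>j<d. (u $ i * M $$ (i, x)) * (v $ j * M $$ (j, y)) * ?l x y k)"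
    by (intro sum.cong refl sum.swap)
  also have "\<dots> = (\<Sum>x<d. \<Sum>y<d. (\<Sum>i<d. u $ i * M $$ (i, x)) * (\<Sum>j<d. v $ j * M $$ (j, y)) * ?l x y k)"
    by (simp add: sum_product) (simp add: sum_distrib_right)
  also have "\<dots> = bracket m n (apply_rows M u) (apply_rows M v) $ k"
    using k by (simp add: bracket_def apply_rows_def)
  finally show "apply_rows M (bracket m n u v) $ k = bracket m n (apply_rows M u) (apply_rows M v) $ k" .
qed (simp add: apply_rows_def bracket_def)

lemma apply_rows_unit:
  "M \<in> carrier_mat d d \<Longrightarrow> i < d \<Longrightarrow> apply_rows M (unit_vec d i) = row M i"
  by (rule eq_vecI) (auto simp: apply_rows_def if_distrib[of "\<lambda>x. x * _"] cong: if_cong)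

lemma preserves_iff_bracket:
  fixes M :: "'r::comm_ring_1 mat"
  assumes carr: "M \<in> carrier_mat d d"
  shows "preserves M \<longleftrightarrow> (\<forall>u\<in>carrier_vec d. \<forall>v\<in>carrier_vec d.
    apply_rows M (bracket m n u v) = bracket m n (apply_rows M u) (apply_rows M v))"
proof
  assume br: "\<forall>u\<in>carrier_vec d. \<forall>v\<in>carrier_vec d.
    apply_rows M (bracket m n u v) = bracket m n (apply_rows M u) (apply_rows M v)"
  show "preserves M"
    unfolding preserves_index
  proof (intro allI impI)
    fix i j k assume ijk: "i < d" "j < d" "k < d"
    have "apply_rows M (bracket m n (unit_vec d i) (unit_vec d j)) $ k = bracket m n (row M i) (row M j) $ k"
      using ijk carr br by (simp add: apply_rows_unit)
    then show "(\<Sum>x<d. lie (basis m n ! i) (basis m n ! j) (basis m n ! x) * M $$ (x, k)) =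
     (\<Sum>x<d. \<Sum>y<d. M $$ (i, x) * M $$ (j, y) * lie (basis m n ! x) (basis m n ! y) (basis m n ! k))"
      using ijk carr by (simp add: bracket_unit) (simp add: bracket_def apply_rows_def)
  qed
qed (simp add: apply_rows_bracket)

text \<open>A linear bijection is given by a matrix, and so is its inverse, which is linear as well; so the matrix lies
  in \<open>GL d\<close>. Bilinearity reduces the bracket condition to basis elements.\<close>

lemma Aut_pts_iff:
  fixes M :: "'r::comm_ring_1 mat"
  shows "M \<in> Aut_pts m n \<longleftrightarrow> M \<in> carrier (GL d) \<and> preserves M"
proof
  assume "M \<in> Aut_pts m n"
  then obtain \<phi> :: "'r vec \<Rightarrow> 'r vec" where \<phi>: "\<phi> \<in> lie_auts m n" and M: "M = row_matrix d \<phi>"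
    by (auto simp: Aut_pts_def)
  from \<phi> have bij: "bij_betw \<phi> (carrier_vec d) (carrier_vec d)"
    and add: "\<And>u v. u \<in> carrier_vec d \<Longrightarrow> v \<in> carrier_vec d \<Longrightarrow> \<phi> (u + v) = \<phi> u + \<phi> v"
    and smult: "\<And>c u. u \<in> carrier_vec d \<Longrightarrow> \<phi> (c \<cdot>\<^sub>v u) = c \<cdot>\<^sub>v \<phi> u"
    and br: "\<And>u v. u \<in> carrier_vec d \<Longrightarrow> v \<in> carrier_vec d \<Longrightarrow> \<phi> (bracket m n u v) = bracket m n (\<phi> u) (\<phi> v)"
    by (auto simp: lie_auts_def)
  have cl: "\<phi> u \<in> carrier_vec d" if "u \<in> carrier_vec d" for u
    using bij that by (rule bij_betw_apply)
  define \<psi> where "\<psi> = inv_into (carrier_vec d) \<phi>"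
  have \<psi>: "\<psi> u \<in> carrier_vec d" "\<phi> (\<psi> u) = u" if "u \<in> carrier_vec d" for u
    using that bij bij_betw_inv_into[OF bij] 
    by (auto simp: \<psi>_def bij_betw_inv_into_right[OF bij] dest: bij_betw_apply)
  have \<psi>': "\<psi> (\<phi> u) = u" if "u \<in> carrier_vec d" for u
    using that bij_betw_inv_into_left[OF bij] by (simp add: \<psi>_def)
  have \<psi>_add: "\<psi> (u + v) = \<psi> u + \<psi> v" if "u \<in> carrier_vec d" "v \<in> carrier_vec d" for u v
    using \<psi>'[of "\<psi> u + \<psi> v"] add[of "\<psi> u" "\<psi> v"] that \<psi> by simp
  have \<psi>_smult: "\<psi> (c \<cdot>\<^sub>v u) = c \<cdot>\<^sub>v \<psi> u" if "u \<in> carrier_vec d" for c u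
    using \<psi>'[of "c \<cdot>\<^sub>v \<psi> u"] smult[of "\<psi> u" c] that \<psi> by simp
  define N where "N = row_matrix d \<psi>"
  have carr: "M \<in> carrier_mat d d" "N \<in> carrier_mat d d" by (simp_all add: M N_def row_matrix_def mat_of_rows_def)
  have ap: "\<phi> u = apply_rows M u" "\<psi> u = apply_rows N u" if "u \<in> carrier_vec d" for u
    using linear_eq_apply_rows[OF cl add smult that] linear_eq_apply_rows[OF \<psi>(1) \<psi>_add \<psi>_smult that]
    by (simp_all add: M N_def)
  have eq1: "K = 1\<^sub>m d" if "K \<in> carrier_mat d d" "\<And>i. i < d \<Longrightarrow> apply_rows K (unit_vec d i) = unit_vec d i" for K :: "'r mat"
    using that by (intro eq_rowI) (auto simp: apply_rows_unit)
  have "M * N = 1\<^sub>m d" "N * M = 1\<^sub>m d"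
    using carr \<psi> \<psi>' cl by (auto intro!: eq1 simp flip: apply_rows_mult simp: ap[symmetric])
  with carr have "M \<in> carrier (GL d)" by (auto simp: GL_iff)
  moreover have "preserves M"
    using br carr cl unfolding preserves_iff_bracket[OF carr(1)]
    by (simp add: ap(1)[symmetric] bracket_def)
  ultimately show "M \<in> carrier (GL d) \<and> preserves M" ..
next
  assume M: "M \<in> carrier (GL d) \<and> preserves M"
  note inv = GL_inv[OF conjunct1[OF M]]
  have carr: "M \<in> carrier_mat d d" using M by (simp add: GL_iff)
  have "bij_betw (apply_rows M) (carrier_vec d) (carrier_vec d)"
    by (rule bij_betw_byWitness[where f' = "apply_rows (inv\<^bsub>GL d\<^esub> M)"])
       (use carr inv in \<open>auto simp: apply_rows_mult apply_rows_one\<close>)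
  moreover have "apply_rows M (u + v) = apply_rows M u + apply_rows M v"
    if "u \<in> carrier_vec d" "v \<in> carrier_vec d" for u v
    using that by (intro eq_vecI) (auto simp: apply_rows_def ring_distribs sum.distrib)
  moreover have "apply_rows M (c \<cdot>\<^sub>v u) = c \<cdot>\<^sub>v apply_rows M u" if "u \<in> carrier_vec d" for c u
    using that by (intro eq_vecI) (auto simp: apply_rows_def sum_distrib_left mult.assoc)
  ultimately have "apply_rows M \<in> lie_auts m n"
    using M apply_rows_bracket by (auto simp: lie_auts_def)
  moreover have "row_matrix d (apply_rows M) = M"
    using carr by (intro eq_matI) (auto simp: row_matrix_def mat_of_rows_def apply_rows_def if_distrib[of "\<lambda>x. x * _"] cong: if_cong)
  ultimately show "M \<in> Aut_pts m n" unfolding Aut_pts_def by force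
qed

lemma preserves_mult:
  fixes M N :: "'r::comm_ring_1 mat"
  assumes "M \<in> carrier_mat d d" "N \<in> carrier_mat d d" "preserves M" "preserves N"
  shows "preserves (M * N)"
  using assms by (simp add: preserves_iff_bracket apply_rows_mult[symmetric])

lemma bracket_carrier [simp]: "bracket m n u v \<in> carrier_vec d"
  by (simp add: bracket_def)

lemma preserves_inv:
  fixes M :: "'r::comm_ring_1 mat"
  assumes M: "M \<in> carrier (GL d)" "preserves M"
  shows "preserves (inv\<^bsub>GL d\<^esub> M)"
  unfolding preserves_iff_bracket[OF GL_inv(2)[OF M(1)]]
proof (intro ballI)
  let ?N = "inv\<^bsub>GL d\<^esub> M"
  note carr = GL_carrier[OF M(1)] GL_inv(2)[OF M(1)]
  fix u v :: "'r vec" assume uv: "u \<in> carrier_vec d" "v \<in> carrier_vec d"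
  have NM: "apply_rows ?N (apply_rows M w) = w" "apply_rows M (apply_rows ?N w) = w" if "w \<in> carrier_vec d" for w
    using that carr GL_inv(3,4)[OF M(1)] by (simp_all add: apply_rows_mult apply_rows_one)
  have "apply_rows ?N (bracket m n u v) = apply_rows ?N (apply_rows M (bracket m n (apply_rows ?N u) (apply_rows ?N v)))"
    using M(2) carr by (simp add: preserves_iff_bracket NM uv)
  then show "apply_rows ?N (bracket m n u v) = bracket m n (apply_rows ?N u) (apply_rows ?N v)"
    by (simp add: NM)
qed

lemma preserves_one: "preserves (1\<^sub>m d :: 'r::comm_ring_1 mat)"
  by (simp add: preserves_iff_bracket apply_rows_one)

lemma subgroup_Aut: "subgroup (Aut_pts m n) (GL d :: 'r::comm_ring_1 mat monoid)"
  by (rule group.subgroupI[OF group_GL])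
     (use one_in_GL preserves_one in \<open>auto simp: Aut_pts_iff GL_inv(1) preserves_inv GL_mult_closed
       preserves_mult GL_carrier set_eq_iff\<close>)

lemma Suc_m: "Suc (m - 1) = m" using m by simp

lemma inc_E: "e \<in> E \<Longrightarrow> i < n \<Longrightarrow> inc i e \<in> F"
  using expos_inc[of e n "m - 1" i] by (simp only: Suc_m E_def)

lemma dec_F: "f \<in> F \<Longrightarrow> i < n \<Longrightarrow> f ! i > 0 \<Longrightarrow> dec i f \<in> E"
  using expos_dec[of f n "m - 1" i] by (simp only: Suc_m E_def)

lemma length_E: "e \<in> E \<Longrightarrow> length e = n" and length_F: "f \<in> F \<Longrightarrow> length f = n"
  by (simp_all add: E_def expos_length)

lemma inc_eq_iff: "length e = n \<Longrightarrow> i < n \<Longrightarrow> l < n \<Longrightarrow> inc i e = inc l e \<longleftrightarrow> i = l"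
  by (metis n_not_Suc_n nth_inc Suc_eq_plus1)

lemma lie_XYZ: "lie (X e) (Y f) (Z i) = (if f = inc i e then 1 else 0)"
  "lie (Y f) (X e) (Z i) = - (if f = inc i e then 1 else 0)"
  by (simp_all add: inc_def)

lemma lie_zero: "lie a b (X e) = 0" "lie a b (Y f) = 0" "lie (X e) (X e') c = 0" "lie (Y f) (Y f') c = 0"
  "lie (Z i) b c = 0" "lie a (Z i) c = 0"
  subgoal by (cases a; cases b) simp_all
  subgoal by (cases a; cases b) simp_all
  subgoal by (cases c) simp_all
  subgoal by (cases c) simp_all
  subgoal by (cases b; cases c) simp_all
  subgoal by (cases a; cases c) simp_all
  done

text \<open>As \<open>m \<ge> 1\<close>, the general facts about exponents of degrees \<open>k\<close> and \<open>k + 1\<close> apply to \<open>E\<close> and \<open>F\<close>.\<close>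

lemma sum_F_dec:
  fixes g :: "nat list \<Rightarrow> 'r::comm_ring_1"
  assumes "i < n"
  shows "(\<Sum>f\<in>F. if f ! i = 0 then 0 else g f) = (\<Sum>e\<in>E. g (inc i e))"
  using sum_expos_inc[OF assms, of g "m - 1"] by (simp only: Suc_m E_def)

lemma sum_delta_F:
  fixes g :: "nat list \<Rightarrow> 'r::comm_ring_1"
  assumes "e \<in> E" "i < n"
  shows "(\<Sum>f\<in>F. g f * (if f = inc i e then 1 else 0)) = g (inc i e)"
  using inc_E[OF assms] by (simp add: if_distrib[of "\<lambda>x. _ * x"] finite_expos cong: if_cong)

lemma sum_delta_E:
  fixes g :: "nat list \<Rightarrow> 'r::comm_ring_1"
  assumes f: "f \<in> F" and i: "i < n"
  shows "(\<Sum>e\<in>E. g e * (if f = inc i e then 1 else 0)) = (if f ! i = 0 then 0 else g (dec i f))"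
proof (cases "f ! i = 0")
  case True
  then have "f \<noteq> inc i e" if "e \<in> E" for e using that i length_E[OF that] by (auto simp: nth_inc)
  then show ?thesis using True by simp
next
  case False
  then have "f = inc i e \<longleftrightarrow> e = dec i f" if "e \<in> E" for e
    using that i length_E[OF that] length_F[OF f] by (metis dec_inc inc_dec neq0_conv)
  then have "(\<Sum>e\<in>E. g e * (if f = inc i e then 1 else 0)) = (\<Sum>e\<in>E. if e = dec i f then g e else 0)"
    by (intro sum.cong) auto
  then show ?thesis using dec_F[OF f i] False by (simp add: finite_expos)
qed

lemma sum_lie:
  fixes g :: "basis_elem \<Rightarrow> 'r::comm_ring_1"
  assumes "i < n"
  shows "e \<in> E \<Longrightarrow> (\<Sum>y\<in>B. g y * lie (X e) y (Z i)) = g (Y (inc i e))"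
    "e \<in> E \<Longrightarrow> (\<Sum>y\<in>B. g y * lie y (X e) (Z i)) = - g (Y (inc i e))"
    "f \<in> F \<Longrightarrow> (\<Sum>y\<in>B. g y * lie (Y f) y (Z i)) = - (if f ! i = 0 then 0 else g (X (dec i f)))"
    "f \<in> F \<Longrightarrow> (\<Sum>y\<in>B. g y * lie y (Y f) (Z i)) = (if f ! i = 0 then 0 else g (X (dec i f)))"
  using assms unfolding sum_B
  by (simp_all add: lie_zero lie_XYZ sum_negf sum_delta_F sum_delta_E del: lie_coeff.simps)

text \<open>The bilinear form \<open>[u, v]\<^sub>i\<close>, the coefficient of \<open>z\<^sub>i\<close>, pairs \<open>x\<^sub>e\<close> with the one \<open>y\<^sub>f\<close> whose exponent is
  \<open>e\<close> plus the \<open>i\<close>-th unit vector.\<close>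

lemma sum_lie2:
  fixes g h :: "basis_elem \<Rightarrow> 'r::comm_ring_1"
  assumes i: "i < n"
  shows "(\<Sum>x\<in>B. \<Sum>y\<in>B. g x * h y * lie x y (Z i)) =
    (\<Sum>e\<in>E. g (X e) * h (Y (inc i e))) - (\<Sum>e\<in>E. g (Y (inc i e)) * h (X e))"
proof -
  have "(\<Sum>x\<in>B. \<Sum>y\<in>B. g x * h y * lie x y (Z i)) = (\<Sum>x\<in>B. g x * (\<Sum>y\<in>B. h y * lie x y (Z i)))"
    by (simp add: sum_distrib_left mult.assoc)
  also have "\<dots> = (\<Sum>e\<in>E. g (X e) * h (Y (inc i e))) - (\<Sum>f\<in>F. if f ! i = 0 then 0 else g (Y f) * h (X (dec i f)))"
    unfolding sum_B[of "\<lambda>x. g x * (\<Sum>y\<in>B. h y * lie x y (Z i))"]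
    using i by (simp add: sum_lie lie_zero sum_negf[symmetric] del: lie_coeff.simps) (auto intro!: sum.cong)
  also have "\<dots> = (\<Sum>e\<in>E. g (X e) * h (Y (inc i e))) - (\<Sum>e\<in>E. g (Y (inc i e)) * h (X e))"
    using i by (simp add: sum_F_dec[of i "\<lambda>f. g (Y f) * h (X (dec i f))"] length_E)
  finally show ?thesis .
qed

lemma sum_lie_left:
  fixes g :: "basis_elem \<Rightarrow> 'r::comm_ring_1"
  shows "(\<Sum>x\<in>B. lie a b x * g x) = (\<Sum>l<n. lie a b (Z l) * g (Z l))"
  unfolding sum_B by (simp add: lie_zero del: lie_coeff.simps)

text \<open>Let \<open>W\<^sub>i\<close> be the matrix of multiplication by \<open>t\<^sub>i\<close> from \<open>S\<^bsup>m-1\<^esup> V\<close> to \<open>S\<^sup>m V\<close>. For a block triangular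
  matrix, the brackets of two \<open>x\<close> give the second condition, the symmetry of \<open>P W\<^sub>i C\<^sup>T\<close>, and the
  brackets of an \<open>x\<close> and a \<open>y\<close> give the first one, that \<open>P W\<^sub>i Q\<^sup>T\<close> is the sum of the \<open>s\<^sub>l\<^sub>i W\<^sub>l\<close>; the
  brackets of two \<open>y\<close> vanish.\<close>

lemma preserves_blk:
  fixes p :: "nat list \<Rightarrow> nat list \<Rightarrow> 'r::comm_ring_1"
  shows "preserves (mat_of (blk p c d1 q d2 s)) \<longleftrightarrow>
    (\<forall>e\<in>E. \<forall>f\<in>F. \<forall>i<n. (\<Sum>x\<in>E. p e x * q f (inc i x)) = (\<Sum>l<n. if f = inc l e then s l i else 0)) \<and>
    (\<forall>e\<in>E. \<forall>e'\<in>E. \<forall>i<n. (\<Sum>x\<in>E. p e x * c e' (inc i x)) = (\<Sum>x\<in>E. p e' x * c e (inc i x)))"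
    (is "_ \<longleftrightarrow> ?R1 \<and> ?R2")
proof -
  let ?g = "blk p c d1 q d2 s"
  have ball: "(\<forall>a\<in>B. P a) \<longleftrightarrow> (\<forall>e\<in>E. P (X e)) \<and> (\<forall>f\<in>F. P (Y f)) \<and> (\<forall>i<n. P (Z i))" for P
    unfolding B_eq by auto
  have "preserves (mat_of ?g) \<longleftrightarrow> (\<forall>a\<in>B. \<forall>b\<in>B. \<forall>c\<in>B. (\<Sum>l<n. lie a b (Z l) * ?g (Z l) c) =
      (\<Sum>x\<in>B. \<Sum>y\<in>B. ?g a x * ?g b y * lie x y c))"
    unfolding preserves_def by (simp add: sum_lie_left del: lie_coeff.simps)
  also have "\<dots> \<longleftrightarrow> (\<forall>a\<in>B. \<forall>b\<in>B. \<forall>i<n. (\<Sum>l<n. lie a b (Z l) * s l i) =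
      (\<Sum>e\<in>E. ?g a (X e) * ?g b (Y (inc i e))) - (\<Sum>e\<in>E. ?g a (Y (inc i e)) * ?g b (X e)))"
    by (subst (3) ball) (simp add: lie_zero sum_lie2 del: lie_coeff.simps)
  also have "\<dots> \<longleftrightarrow> ?R1 \<and> ?R2"
  proof (intro iffI conjI)
    assume L: "\<forall>a\<in>B. \<forall>b\<in>B. \<forall>i<n. (\<Sum>l<n. lie a b (Z l) * s l i) =
      (\<Sum>e\<in>E. ?g a (X e) * ?g b (Y (inc i e))) - (\<Sum>e\<in>E. ?g a (Y (inc i e)) * ?g b (X e))"
    show ?R1
    proof (intro ballI allI impI)
      fix e f i assume "e \<in> E" "f \<in> F" "i < n"
      then show "(\<Sum>x\<in>E. p e x * q f (inc i x)) = (\<Sum>l<n. if f = inc l e then s l i else 0)"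
        using L[rule_format, of "X e" "Y f" i] 
        by (simp add: lie_XYZ if_distrib[of "\<lambda>x. x * _"] del: lie_coeff.simps cong: if_cong)
    qed
    show ?R2
    proof (intro ballI allI impI)
      fix e e' i assume "e \<in> E" "e' \<in> E" "i < n"
      then show "(\<Sum>x\<in>E. p e x * c e' (inc i x)) = (\<Sum>x\<in>E. p e' x * c e (inc i x))"
        using L[rule_format, of "X e" "X e'" i] by (simp add: lie_zero mult.commute del: lie_coeff.simps)
    qed
  next
    assume R: "?R1 \<and> ?R2"
    have "\<forall>i<n. (\<Sum>l<n. lie a b (Z l) * s l i) =
      (\<Sum>e\<in>E. ?g a (X e) * ?g b (Y (inc i e))) - (\<Sum>e\<in>E. ?g a (Y (inc i e)) * ?g b (X e))"
      if "a \<in> B" "b \<in> B" for a b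
      by (cases a; cases b; insert that R) (simp_all add: lie_XYZ lie_zero if_distrib[of "\<lambda>x. x * _"] if_distrib[of uminus] sum_negf mult.commute[of "c _ _"]
          mult.commute[of "q _ _"] flip: sum_negf del: lie_coeff.simps cong: if_cong)
    then show "\<forall>a\<in>B. \<forall>b\<in>B. \<forall>i<n. (\<Sum>l<n. lie a b (Z l) * s l i) =
      (\<Sum>e\<in>E. ?g a (X e) * ?g b (Y (inc i e))) - (\<Sum>e\<in>E. ?g a (Y (inc i e)) * ?g b (X e))"
      by blast
  qed
  finally show ?thesis .
qed

section \<open>The shape of an automorphism\<close>

text \<open>Every \<open>z\<^sub>i\<close> is a bracket, and brackets have no \<open>x\<close>- and \<open>y\<close>-coordinates.\<close>

lemma preserves_Z_rows:
  fixes M :: "'r::comm_ring_1 mat"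
  assumes "preserves M" "i < n"
  shows "e \<in> E \<Longrightarrow> ent M (Z i) (X e) = 0" "f \<in> F \<Longrightarrow> ent M (Z i) (Y f) = 0"
proof -
  obtain e0 where e0: "e0 \<in> E" using expos_nonempty[of n "m - 1"] n by (auto simp: E_def)
  have "(\<Sum>x\<in>B. lie (X e0) (Y (inc i e0)) x * ent M x c) = ent M (Z i) c" for c
  proof -
    have "(\<Sum>x\<in>B. lie (X e0) (Y (inc i e0)) x * ent M x c) = (\<Sum>l<n. if l = i then ent M (Z l) c else 0)"
      unfolding sum_lie_left using assms(2) length_E[OF e0]
      by (intro sum.cong) (auto simp: lie_XYZ inc_eq_iff simp del: lie_coeff.simps)
    then show ?thesis using assms(2) by simp
  qed
  then have "ent M (Z i) c = (\<Sum>x\<in>B. \<Sum>y\<in>B. ent M (X e0) x * ent M (Y (inc i e0)) y * lie x y c)" if "c \<in> B" for c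
    using assms(1)[unfolded preserves_def, rule_format, of "X e0" "Y (inc i e0)" c] e0 inc_E[OF e0 assms(2)] that by simp
  then show "e \<in> E \<Longrightarrow> ent M (Z i) (X e) = 0" "f \<in> F \<Longrightarrow> ent M (Z i) (Y f) = 0"
    by (simp_all add: lie_zero del: lie_coeff.simps)
qed

text \<open>If \<open>J\<^sub>i\<close> is the matrix of the form \<open>[u, v]\<^sub>i\<close>, then the bracket condition for a matrix \<open>M\<close> that fixes
  every \<open>z\<^sub>i\<close> is \<open>M J\<^sub>i M\<^sup>T = J\<^sub>i\<close>. Multiplied by the inverse \<open>N\<close> it reads \<open>J\<^sub>i M\<^sup>T = N J\<^sub>i\<close>, which is
  linear in the pair of \<open>M\<close> and \<open>N\<close>.\<close>

lemma preserves_linearised: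
  fixes M N :: "'r::comm_ring_1 mat"
  assumes M: "preserves M" "M \<in> carrier_mat d d" "N \<in> carrier_mat d d" "N * M = 1\<^sub>m d"
    and S: "\<And>l i. l < n \<Longrightarrow> i < n \<Longrightarrow> ent M (Z l) (Z i) = (if l = i then 1 else 0)"
    and u: "u \<in> B" and b: "b \<in> B" and i: "i < n"
  shows "(\<Sum>y\<in>B. ent M b y * lie u y (Z i)) = (\<Sum>a\<in>B. ent N u a * lie a b (Z i))"
proof -
  have NM: "(\<Sum>a\<in>B. ent N u a * ent M a x) = (if u = x then 1 else 0)" if "x \<in> B" for x
    using ent_mult[OF M(3,2) u that] M(4) by (simp add: ent_one u that)
  have *: "lie a b (Z i) = (\<Sum>x\<in>B. \<Sum>y\<in>B. ent M a x * ent M b y * lie x y (Z i))" if "a \<in> B" for a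
  proof -
    have "(\<Sum>x\<in>B. lie a b x * ent M x (Z i)) = (\<Sum>l<n. if l = i then lie a b (Z l) else 0)"
      unfolding sum_lie_left using i by (intro sum.cong) (auto simp: S)
    then show ?thesis using M(1) i that b by (auto simp: preserves_def)
  qed
  have "(\<Sum>a\<in>B. ent N u a * lie a b (Z i)) = (\<Sum>a\<in>B. \<Sum>x\<in>B. ent N u a * ent M a x * (\<Sum>y\<in>B. ent M b y * lie x y (Z i)))"
    by (intro sum.cong refl, subst *) (simp_all add: sum_distrib_left mult.assoc)
  also have "\<dots> = (\<Sum>x\<in>B. (\<Sum>a\<in>B. ent N u a * ent M a x) * (\<Sum>y\<in>B. ent M b y * lie x y (Z i)))"
    by (subst sum.swap) (simp add: sum_distrib_right)
  also have "\<dots> = (\<Sum>x\<in>B. if u = x then (\<Sum>y\<in>B. ent M b y * lie x y (Z i)) else 0)"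
    by (intro sum.cong) (simp_all add: NM)
  also have "\<dots> = (\<Sum>y\<in>B. ent M b y * lie u y (Z i))"
    using u by (simp)
  finally show ?thesis by simp
qed

lemma expos_neq_ex_less:
  assumes "e \<in> expos n k" "e' \<in> expos n k" "e \<noteq> e'"
  shows "\<exists>j<n. e ! j < e' ! j"
proof (rule ccontr)
  assume "\<not> (\<exists>j<n. e ! j < e' ! j)"
  then have le: "e' ! j \<le> e ! j" if "j < n" for j using that by (meson not_less)
  obtain j where j: "j < n" "e' ! j \<noteq> e ! j"
    using assms by (metis expos_length nth_equalityI)
  have "sum_list e' = (\<Sum>j<n. e' ! j)" "sum_list e = (\<Sum>j<n. e ! j)"
    using assms by (simp_all add: expos_def sum_list_sum_nth atLeast0LessThan)
  moreover have "(\<Sum>j<n. e' ! j) < (\<Sum>j<n. e ! j)"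
    using j le by (intro sum_strict_mono_ex1) (auto intro!: bexI[of _ j] simp: order_less_le)
  ultimately show False using assms by (simp add: expos_def)
qed

text \<open>Two monomials of the same degree are connected by steps that replace one variable by another
  and decrease the distance.\<close>

lemma expos_exchange_induct [consumes 2, case_names base step]:
  assumes "e \<in> expos n k" "e' \<in> expos n k"
    and base: "P e'"
    and step: "\<And>e i j. e \<in> expos n k \<Longrightarrow> i < n \<Longrightarrow> j < n \<Longrightarrow> i \<noteq> j \<Longrightarrow> e ! i > e' ! i \<Longrightarrow> e ! j < e' ! j
      \<Longrightarrow> P (inc j (dec i e)) \<Longrightarrow> P e"
  shows "P e"
  using assms(1)
proof (induction "\<Sum>l<n. e' ! l - e ! l" arbitrary: e rule: less_induct)
  case less
  show ?case
  proof (cases "e = e'")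
    case False
    then obtain i j where ij: "i < n" "j < n" "e ! j < e' ! j" "e' ! i < e ! i"
      using expos_neq_ex_less[OF less.prems assms(2)] expos_neq_ex_less[OF assms(2) less.prems] by auto
    obtain k' where k: "k = Suc k'"
      using less.prems ij by (cases k) (auto simp: expos_0)
    have mem: "inc j (dec i e) \<in> expos n k"
      using less.prems ij unfolding k by (intro expos_inc expos_dec) auto
    have len: "length e = n" using less.prems by (rule expos_length)
    have "(\<Sum>l<n. e' ! l - inc j (dec i e) ! l) < (\<Sum>l<n. e' ! l - e ! l)"
      using ij len by (intro sum_strict_mono_ex1) (auto simp: nth_inc nth_dec intro!: bexI[of _ j])
    from less.hyps[OF this mem] show ?thesis
      using step[OF less.prems ij(1,2)] ij by (cases "i = j") auto
  qed (simp add: base)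
qed

text \<open>The linear equation with index \<open>i\<close> equates, up to sign, an entry of \<open>M\<close> and an entry of \<open>N\<close>, each of which
  is replaced by 0 if a monomial that has to be divided by \<open>t\<^sub>i\<close> is not divisible by it. Alternating between two
  different positions, which exist because \<open>n \<ge> 2\<close>, one can decrease an exponent until this
  happens.\<close>

lemma shape_of_preserving:
  fixes M N :: "'r::comm_ring_1 mat"
  assumes M: "preserves M" "M \<in> carrier_mat d d" "N \<in> carrier_mat d d" "N * M = 1\<^sub>m d"
    and S: "\<And>l i. l < n \<Longrightarrow> i < n \<Longrightarrow> ent M (Z l) (Z i) = (if l = i then 1 else 0)"
  obtains a b where "a * b = 1"
    and "\<And>e e'. e \<in> E \<Longrightarrow> e' \<in> E \<Longrightarrow> ent M (X e) (X e') = (if e = e' then a else 0)"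
    and "\<And>f f'. f \<in> F \<Longrightarrow> f' \<in> F \<Longrightarrow> ent M (Y f) (Y f') = (if f = f' then b else 0)"
    and "\<And>f e. f \<in> F \<Longrightarrow> e \<in> E \<Longrightarrow> ent M (Y f) (X e) = 0"
proof -
  note lin = preserves_linearised[OF M S]
  have lin_YY: "- (if f ! i = 0 then 0 else ent M (Y f') (X (dec i f))) =
      (if f' ! i = 0 then 0 else ent N (Y f) (X (dec i f')))" if "f \<in> F" "f' \<in> F" "i < n" for f f' i
    using lin[of "Y f" "Y f'" i] that by (simp add: sum_lie[OF that(3)] del: lie_coeff.simps)
  have lin_XY: "ent M (Y f) (Y (inc i e)) = (if f ! i = 0 then 0 else ent N (X e) (X (dec i f)))"
    if "e \<in> E" "f \<in> F" "i < n" for e f i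
    using lin[of "X e" "Y f" i] that by (simp add: sum_lie[OF that(3)] del: lie_coeff.simps)
  \<comment> \<open>A unit passes from position 0 of \<open>f\<close> to position 0 of \<open>e\<close>, while position 1 compensates.\<close>
  have YX: "ent M (Y f) (X e) = 0" if "f \<in> F" "e \<in> E" for f e
    using that
  proof (induction "f ! 0" arbitrary: f e rule: less_induct)
    case less
    note len = length_F[OF less.prems(1)] length_E[OF less.prems(2)]
    have n0: "0 < n" "1 < n" using n by auto
    have *: "- ent M (Y f) (X e) = (if f ! 0 = 0 then 0 else ent N (Y (inc 0 e)) (X (dec 0 f)))"
      using lin_YY[of "inc 0 e" f 0] inc_E[OF less.prems(2) n0(1)] less.prems n0 len by (simp add: nth_inc)
    show ?case
    proof (cases "f ! 0 = 0")
      case False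
      define f' where "f' = inc 1 (dec 0 f)"
      have f': "f' \<in> F" "f' ! 0 < f ! 0" "dec 1 f' = dec 0 f" "f' ! 1 \<noteq> 0"
        using less.prems n0 len False by (auto simp: f'_def inc_E dec_F nth_inc nth_dec)
      have "ent N (Y (inc 0 e)) (X (dec 0 f)) = - (if inc 0 e ! 1 = 0 then 0 else ent M (Y f') (X (dec 1 (inc 0 e))))"
        using lin_YY[of "inc 0 e" f' 1] inc_E[OF less.prems(2) n0(1)] f' n0 by simp
      also have "\<dots> = 0"
        using less.hyps[OF f'(2,1)] dec_F[OF inc_E[OF less.prems(2) n0(1)] n0(2)] by auto
      finally show ?thesis using * False by simp
    qed (use * in simp)
  qed
  \<comment> \<open>If \<open>e \<noteq> e'\<close>, then \<open>t\<^sup>e\<close> is divisible by a higher power of some \<open>t\<^sub>j\<close> than \<open>t\<^bsup>e'\<^esup>\<close>. Divide both by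
     \<open>t\<^sub>j\<close> and multiply both by another \<open>t\<^sub>i\<close>, as long as possible.\<close>
  have XX_aux: "ent N (X e) (X e') = 0" if "e \<in> E" "e' \<in> E" "j < n" "e' ! j < e ! j" for e e' j
    using that(1,2,4)
  proof (induction "e' ! j" arbitrary: e e' rule: less_induct)
    case less
    note len = length_E[OF less.prems(1)] length_E[OF less.prems(2)]
    obtain i where i: "i < n" "i \<noteq> j" using n that[of 0] that[of 1] by (cases "j = 0") auto
    have mem: "inc i e \<in> F" "inc i e' \<in> F" using less.prems i by (auto intro: inc_E)
    have dj: "dec j (inc i e) \<in> E" "inc j (dec j (inc i e)) = inc i e"
      using dec_F[OF mem(1) that(3)] less.prems len i that(3) by (auto simp: nth_inc inc_dec)
    have "ent N (X e) (X e') = ent M (Y (inc i e')) (Y (inc i e))"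
      using lin_XY[OF less.prems(1) mem(2) i(1)] i len by (simp add: nth_inc)
    also have "\<dots> = (if e' ! j = 0 then 0 else ent N (X (dec j (inc i e))) (X (dec j (inc i e'))))"
      using lin_XY[OF dj(1) mem(2) that(3)] dj(2) i len that(3) by (simp add: nth_inc)
    also have "\<dots> = 0"
    proof (cases "e' ! j = 0")
      case False
      have "dec j (inc i e') \<in> E" using dec_F[OF mem(2) that(3)] False i len that(3) by (simp add: nth_inc)
      then show ?thesis
        using less.hyps[of "dec j (inc i e')" "dec j (inc i e)"] dj(1) False less.prems i len that(3)
        by (auto simp: nth_inc nth_dec)
    qed simp
    finally show ?case .
  qed
  have YY_off: "ent M (Y f) (Y f') = 0" if f: "f \<in> F" "f' \<in> F" "f \<noteq> f'" for f f'
  proof -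
    obtain j where j: "j < n" "f ! j < f' ! j" using expos_neq_ex_less[OF f] by auto
    note len = length_F[OF f(1)] length_F[OF f(2)]
    have "ent M (Y f) (Y f') = (if f ! j = 0 then 0 else ent N (X (dec j f')) (X (dec j f)))"
      using lin_XY[of "dec j f'" f j] dec_F[OF f(2) j(1)] j len f by (simp add: inc_dec)
    also have "\<dots> = 0"
      using XX_aux[of "dec j f'" "dec j f" j] dec_F[OF f(1) j(1)] dec_F[OF f(2) j(1)] j len by (auto simp: nth_dec)
    finally show ?thesis .
  qed
  obtain f0 where f0: "f0 \<in> F" using expos_nonempty[of n m] n by auto
  define b where "b = ent M (Y f0) (Y f0)"
  have N_diag: "ent N (X e) (X e) = ent M (Y (inc i e)) (Y (inc i e))" if "e \<in> E" "i < n" for e i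
    using lin_XY[OF that(1) inc_E[OF that] that(2)] that length_E[OF that(1)] by (simp add: nth_inc)
  \<comment> \<open>the diagonal entries agree along the exchange steps that connect all monomials\<close>
  have YY_diag: "ent M (Y f) (Y f) = b" if "f \<in> F" for f
    using that f0
  proof (induction rule: expos_exchange_induct)
    case base
    then show ?case by (simp add: b_def)
  next
    case (step f i j)
    have e: "dec i f \<in> E" "inc i (dec i f) = f" using step by (auto simp: dec_F length_F inc_dec)
    then show ?case using N_diag[OF e(1) step(2)] N_diag[OF e(1) step(3)] step by simp
  qed
  have n0: "0 < n" using n by simp
  have N_XX: "ent N (X e) (X e') = (if e = e' then b else 0)" if "e \<in> E" "e' \<in> E" for e e'
    using lin_XY[OF that(1) inc_E[OF that(2) n0] n0] length_E[OF that(1)] length_E[OF that(2)] n0 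
      YY_diag[OF inc_E[OF that(1) n0]] YY_off[OF inc_E[OF that(2) n0] inc_E[OF that(1) n0]]
    by (cases "e = e'") (auto simp: nth_inc inc_inject)
  have b_M: "b * ent M (X e) (X e') = (if e = e' then 1 else 0)" if e: "e \<in> E" "e' \<in> E" for e e'
  proof -
    have "(if e = e' then 1 else 0) = ent (N * M) (X e) (X e')" using e by (simp add: M(4) ent_one)
    also have "\<dots> = (\<Sum>x\<in>E. ent N (X e) (X x) * ent M (X x) (X e'))"
      using M(1) e by (simp add: ent_mult[OF M(3,2)] sum_B YX preserves_Z_rows)
    also have "\<dots> = (\<Sum>x\<in>E. if x = e then b * ent M (X e) (X e') else 0)"
      using e by (intro sum.cong) (auto simp: N_XX)
    also have "\<dots> = b * ent M (X e) (X e')" using e by simp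
    finally show ?thesis by simp
  qed
  obtain e0 where e0: "e0 \<in> E" using expos_nonempty[of n "m - 1"] n by (auto simp: E_def)
  define a where "a = ent M (X e0) (X e0)"
  have ab: "a * b = 1" using b_M[OF e0 e0] by (simp add: a_def mult.commute)
  have "ent M (X e) (X e') = (if e = e' then a else 0)" if e: "e \<in> E" "e' \<in> E" for e e'
  proof -
    have "ent M (X e) (X e') = a * (b * ent M (X e) (X e'))" using ab by (simp flip: mult.assoc)
    then show ?thesis using b_M[OF e] by simp
  qed
  moreover have "ent M (Y f) (Y f') = (if f = f' then b else 0)" if "f \<in> F" "f' \<in> F" for f f'
    using YY_diag YY_off that by auto
  ultimately show thesis using that ab YX by blast
qed

text \<open>Two applications of the symmetry move a unit of exponent from \<open>e\<close> to \<open>f\<close> and another one back,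
  without changing \<open>e + f\<close>. All pairs with a given sum are connected in this way.\<close>

lemma symmetric_imp_hankel:
  fixes c :: "nat list \<Rightarrow> nat list \<Rightarrow> 'r"
  assumes sym: "\<And>e e' i. e \<in> E \<Longrightarrow> e' \<in> E \<Longrightarrow> i < n \<Longrightarrow> c e' (inc i e) = c e (inc i e')"
  shows "\<exists>b. \<forall>e\<in>E. \<forall>f\<in>F. c e f = b (map2 (+) e f)"
proof -
  have eq: "c e f = c e' f'" if "e \<in> E" "e' \<in> E" "f \<in> F" "f' \<in> F" "map2 (+) e f = map2 (+) e' f'" for e e' f f'
    using that(1)[unfolded E_def] that(2)[unfolded E_def] that(3,5)
  proof (induction arbitrary: f rule: expos_exchange_induct)
    case base
    have "f = f'"
    proof (rule nth_equalityI)
      fix i assume "i < length f"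
      then have "map2 (+) e' f ! i = map2 (+) e' f' ! i" "i < length f" using base by simp_all
      then show "f ! i = f' ! i" using that base(1) by (simp add: length_E length_F)
    qed (use base that in \<open>simp add: length_F\<close>)
    then show ?case by simp
  next
    case (step e i j)
    note len = expos_length[OF step(1)] length_F[OF step.prems(1)] length_E[OF that(2)] length_F[OF that(4)]
    have "e ! j + f ! j = e' ! j + f' ! j"
      using arg_cong[OF step.prems(2), of "\<lambda>x. x ! j"] len step(3) by simp
    then have fj: "f ! j > 0" using step(6) by simp
    have e: "e \<in> E" using step(1) by (simp add: E_def)
    have df: "dec j f \<in> E" "inc j (dec j f) = f"
      using step.prems fj step(3) len by (auto simp: dec_F inc_dec)
    have di: "dec i (inc j e) = inc j (dec i e)" "inc i (inc j (dec i e)) = inc j e"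
      using step(2-5) len by (simp_all add: dec_inc_commute inc_inc[of i _ j] inc_dec)
    have "inc j e \<in> F" using e step(3) by (rule inc_E)
    then have e2: "inc j (dec i e) \<in> E"
      using dec_F[of "inc j e" i] step len unfolding di(1)[symmetric] by (simp add: nth_inc)
    have "c e f = c (dec j f) (inc j e)"
      using sym[OF df(1) e step(3)] df(2) by simp
    also have "\<dots> = c (inc j (dec i e)) (inc i (dec j f))"
      using sym[OF e2 df(1) step(2)] di(2) by simp
    also have "\<dots> = c e' f'"
    proof (rule step.IH)
      show "inc i (dec j f) \<in> F" using df(1) step(2) by (rule inc_E)
      show "map2 (+) (inc j (dec i e)) (inc i (dec j f)) = map2 (+) e' f'"
        unfolding step.prems(2)[symmetric]
        using len step(2-5) fj by (intro nth_equalityI) (auto simp: nth_inc nth_dec)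
    qed
    finally show ?case .
  qed
  define b where "b g = (SOME v. \<exists>e\<in>E. \<exists>f\<in>F. g = map2 (+) e f \<and> v = c e f)" for g
  have "c e f = b (map2 (+) e f)" if "e \<in> E" "f \<in> F" for e f
  proof -
    have "\<exists>e'\<in>E. \<exists>f'\<in>F. map2 (+) e f = map2 (+) e' f' \<and> b (map2 (+) e f) = c e' f'"
      unfolding b_def by (rule someI_ex) (use that in blast)
    then show ?thesis using eq that by metis
  qed
  then show ?thesis by blast
qed

lemma hankel_imp_symmetric:
  assumes "e \<in> E" "e' \<in> E" "i < n"
  shows "map2 (+) e' (inc i e) = map2 (+) e (inc i e')"
  using length_E[OF assms(1)] length_E[OF assms(2)] assms(3) by (intro nth_equalityI) (auto simp: nth_inc)

section \<open>The complement\<close>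

text \<open>The parameters \<open>A'\<close> and \<open>b\<close> stand for the inverses of \<open>A\<close> and \<open>a\<close>. As independent arguments they make
  \<open>Hmat\<close> a polynomial function.\<close>

definition Hmat :: "'r::comm_ring_1 mat \<Rightarrow> 'r mat \<Rightarrow> 'r \<Rightarrow> 'r \<Rightarrow> 'r mat" where
  "Hmat A A' a b = mat_of (blk (\<lambda>e e'. a * sym_coeff (transpose_mat A') e e') (\<lambda>_ _. 0) (\<lambda>_ _. 0)
     (\<lambda>f f'. b * sym_coeff (transpose_mat A) f' f) (\<lambda>_ _. 0) (\<lambda>i j. A $$ (i, j)))"

lemma Hmat_carrier [simp]: "Hmat A A' a b \<in> carrier_mat d d"
  by (simp add: Hmat_def)

lemma H_map_eq_Hmat:
  assumes "A \<in> carrier_mat n n"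
  shows "H_map m n (A, l) = Hmat A (inv\<^bsub>GL n\<^esub> A) (l $$ (0, 0)) ((inv\<^bsub>GL 1\<^esub> l) $$ (0, 0))"
  unfolding H_map_def prod.case Hmat_def
  by (rule tri_block_eq_mat_of) (use assms in \<open>auto simp: rho1_def rho2_eq\<close>)

lemma Hmat_mult:
  fixes A :: "'r::comm_ring_1 mat"
  assumes c: "A \<in> carrier_mat n n" "A' \<in> carrier_mat n n" "A2 \<in> carrier_mat n n" "A2' \<in> carrier_mat n n"
  shows "Hmat A A' a b * Hmat A2 A2' a2 b2 = Hmat (A * A2) (A2' * A') (a * a2) (b * b2)"
proof -
  have t: "transpose_mat A \<in> carrier_mat n n" "transpose_mat A' \<in> carrier_mat n n"
    "transpose_mat A2 \<in> carrier_mat n n" "transpose_mat A2' \<in> carrier_mat n n"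
    using c by simp_all
  have 1: "(\<Sum>x\<in>E. a * sym_coeff (transpose_mat A') e x * (a2 * sym_coeff (transpose_mat A2') x e')) =
      a * a2 * sym_coeff (transpose_mat (A2' * A')) e e'" if "e \<in> E" "e' \<in> E" for e e'
    using that t c unfolding E_def
    by (simp add: transpose_mult[of _ n n _ n] sym_coeff_mult[of _ n] sum_distrib_left ac_simps)
  have 2: "(\<Sum>x\<in>F. b * sym_coeff (transpose_mat A) x f * (b2 * sym_coeff (transpose_mat A2) f' x)) =
      b * b2 * sym_coeff (transpose_mat (A * A2)) f' f" if "f \<in> F" "f' \<in> F" for f f'
    using that t c
    by (simp add: transpose_mult[of _ n n _ n] sym_coeff_mult[of _ n] sum_distrib_left ac_simps)
  have 3: "(\<Sum>x<n. A $$ (i, x) * A2 $$ (x, j)) = (A * A2) $$ (i, j)" if "i < n" "j < n" for i j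
    using that c by (simp add: scalar_prod_def atLeast0LessThan)
  show ?thesis
    unfolding Hmat_def blk_mult
    by (rule mat_of_cong, unfold B_eq) (use 1 2 3 in auto)
qed

lemma Hmat_one: "Hmat (1\<^sub>m n) (1\<^sub>m n) a b = mat_of (blk (\<lambda>e e'. if e = e' then a else 0) (\<lambda>_ _. 0) (\<lambda>_ _. 0)
     (\<lambda>f f'. if f = f' then b else 0) (\<lambda>_ _. 0) (\<lambda>i j. if i = j then 1 else 0))"
  unfolding Hmat_def
  by (rule mat_of_cong, unfold B_eq) (auto simp: E_def sym_coeff_one[of _ n "m - 1"] sym_coeff_one[of _ n m])

lemma Hmat_one_one: "Hmat (1\<^sub>m n) (1\<^sub>m n) 1 1 = (1\<^sub>m d :: 'r::comm_ring_1 mat)"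
  unfolding Hmat_one mat_of_one by (rule mat_of_cong, unfold B_eq) (auto split: if_splits)

lemma Hmat_GL:
  fixes A :: "'r::comm_ring_1 mat"
  assumes "A \<in> carrier_mat n n" "A' \<in> carrier_mat n n" "A * A' = 1\<^sub>m n" "A' * A = 1\<^sub>m n" "a * b = 1"
  shows "Hmat A A' a b \<in> carrier (GL d)" "Hmat A A' a b * Hmat A' A b a = 1\<^sub>m d"
proof -
  have "Hmat A A' a b * Hmat A' A b a = 1\<^sub>m d" "Hmat A' A b a * Hmat A A' a b = 1\<^sub>m d"
    using assms by (simp_all add: Hmat_mult mult.commute[of b a] Hmat_one_one)
  then show "Hmat A A' a b \<in> carrier (GL d)" "Hmat A A' a b * Hmat A' A b a = 1\<^sub>m d"
    by (auto simp: GL_iff intro!: bexI[of _ "Hmat A' A b a"])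
qed

text \<open>The matrix of the action on the dual of \<open>S\<^sup>m V\<close> contains the coefficients of the substitution by \<open>A\<^sup>T\<close>, and
  the matrix on \<open>S\<^bsup>m-1\<^esup> V\<close> those of the inverse substitution. Their composition, applied to \<open>t\<^sub>i t\<^sup>e\<close>, leaves
  the linear form of row \<open>i\<close> of \<open>A\<^sup>T\<close> times \<open>t\<^sup>e\<close>, and this is the action of \<open>A\<close> on the \<open>z\<^sub>l\<close>.\<close>

lemma preserves_Hmat:
  fixes A :: "'r::comm_ring_1 mat"
  assumes A: "A \<in> carrier_mat n n" "A' \<in> carrier_mat n n" "A * A' = 1\<^sub>m n" and ab: "a * b = 1"
  shows "preserves (Hmat A A' a b)"
  unfolding Hmat_def preserves_blk
proof (intro conjI ballI allI impI)
  fix e f i assume e: "e \<in> E" and f: "f \<in> F" and i: "i < n"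
  let ?T = "transpose_mat A" and ?T' = "transpose_mat A'"
  have T: "?T \<in> carrier_mat n n" "?T' \<in> carrier_mat n n" using A by simp_all
  have one: "?T' * ?T = 1\<^sub>m n" using A transpose_mult[OF A(1,2)] by simp
  have orth: "(\<Sum>x\<in>E. sym_coeff ?T' e x * shift_coeff ?T j x f) = (if f = inc j e then 1 else 0)" if j: "j < n" for j
  proof (cases "f ! j = 0")
    case True
    then have "f \<noteq> inc j e" using j length_E[OF e] by (auto simp: nth_inc)
    then show ?thesis using True by (simp add: shift_coeff_def)
  next
    case False
    then have df: "dec j f \<in> E" using dec_F[OF f j] by simp
    have eq: "f = inc j e \<longleftrightarrow> e = dec j f"
      using False j length_E[OF e] length_F[OF f] by (metis dec_inc inc_dec neq0_conv)
    have "(\<Sum>x\<in>E. sym_coeff ?T' e x * sym_coeff ?T x (dec j f)) = sym_coeff (?T' * ?T) e (dec j f)"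
      using sym_coeff_mult[OF T(2,1) e[unfolded E_def] df[unfolded E_def]] by (simp add: E_def)
    also have "\<dots> = (if f = inc j e then 1 else 0)"
      unfolding one eq by (rule sym_coeff_one[OF e[unfolded E_def] df[unfolded E_def]])
    finally show ?thesis using False by (simp add: shift_coeff_def)
  qed
  have "(\<Sum>x\<in>E. a * sym_coeff ?T' e x * (b * sym_coeff ?T (inc i x) f)) =
    a * b * (\<Sum>x\<in>E. \<Sum>j<n. A $$ (j, i) * (sym_coeff ?T' e x * shift_coeff ?T j x f))"
    unfolding sum_distrib_left
  proof (intro sum.cong refl)
    fix x assume "x \<in> E"
    then have "sym_coeff ?T (inc i x) f = (\<Sum>j<n. A $$ (j, i) * shift_coeff ?T j x f)"
      using sym_coeff_inc[OF T(1) _ length_F[OF f] i, of x] A(1) i by (simp add: length_E)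
    then show "a * sym_coeff ?T' e x * (b * sym_coeff ?T (inc i x) f) = (\<Sum>j<n. a * b * (A $$ (j, i) * (sym_coeff ?T' e x * shift_coeff ?T j x f)))"
      by (simp add: sum_distrib_left ac_simps)
  qed
  also have "\<dots> = (\<Sum>j<n. A $$ (j, i) * (\<Sum>x\<in>E. sym_coeff ?T' e x * shift_coeff ?T j x f))"
    by (subst sum.swap) (simp add: sum_distrib_left ab)
  also have "\<dots> = (\<Sum>l<n. if f = inc l e then A $$ (l, i) else 0)"
    by (intro sum.cong) (auto simp: orth)
  finally show "(\<Sum>x\<in>E. a * sym_coeff ?T' e x * (b * sym_coeff ?T (inc i x) f)) = (\<Sum>l<n. if f = inc l e then A $$ (l, i) else 0)" .
qed simp

lemma H_pts_eq:
  "H_pts m n = {Hmat A (inv\<^bsub>GL n\<^esub> A) a b |A a b. A \<in> carrier (GL n) \<and> a * b = (1 :: 'r::comm_ring_1)}" (is "_ = ?R")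
proof (intro equalityI subsetI)
  fix M :: "'r mat" assume "M \<in> H_pts m n"
  then obtain A l where "A \<in> carrier (GL n)" "l \<in> carrier (GL 1)" "M = H_map m n (A, l)"
    by (auto simp: H_pts_def DirProd_def)
  then show "M \<in> ?R" using GL1_unit[of l] GL_carrier[of A n] by (auto simp: H_map_eq_Hmat)
next
  fix M :: "'r mat" assume "M \<in> ?R"
  then obtain A a b where A: "A \<in> carrier (GL n)" "a * b = 1" "M = Hmat A (inv\<^bsub>GL n\<^esub> A) a b" by auto
  then have "M = H_map m n (A, mat 1 1 (\<lambda>_. a))"
    using GL1_of_unit[of a b] GL_carrier[of A n] by (simp add: H_map_eq_Hmat)
  then show "M \<in> H_pts m n" using A GL1_of_unit[of a b] by (auto simp: H_pts_def DirProd_def)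
qed

lemma H_pts_subset_Aut: "H_pts m n \<subseteq> (Aut_pts m n :: 'r::comm_ring_1 mat set)"
  using GL_inv GL_carrier by (fastforce simp: H_pts_eq Aut_pts_iff intro!: Hmat_GL preserves_Hmat)

lemma H_map_mult:
  fixes A A2 l l2 :: "'r::comm_ring_1 mat"
  assumes A: "A \<in> carrier (GL n)" "A2 \<in> carrier (GL n)" and l: "l \<in> carrier (GL 1)" "l2 \<in> carrier (GL 1)"
  shows "H_map m n (A * A2, l * l2) = H_map m n (A, l) * H_map m n (A2, l2)"
proof -
  note c = GL_carrier[OF A(1)] GL_carrier[OF A(2)] GL_inv(2)[OF A(1)] GL_inv(2)[OF A(2)]
  have 1: "(x * y) $$ (0, 0) = x $$ (0, 0) * y $$ (0, 0)"
    if "x \<in> carrier_mat 1 1" "y \<in> carrier_mat 1 1" for x y :: "'r mat"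
    using that by (simp add: scalar_prod_def)
  have "(l * l2) $$ (0, 0) = l $$ (0, 0) * l2 $$ (0, 0)"
    "(inv\<^bsub>GL 1\<^esub> (l * l2)) $$ (0, 0) = (inv\<^bsub>GL 1\<^esub> l) $$ (0, 0) * (inv\<^bsub>GL 1\<^esub> l2) $$ (0, 0)"
    using l by (simp_all only: GL_inv_mult 1 GL_carrier GL_inv(2) mult.commute)
  then show ?thesis using c A by (simp add: H_map_eq_Hmat Hmat_mult GL_inv_mult)
qed

lemma ent_Hmat:
  "e \<in> E \<Longrightarrow> e' \<in> E \<Longrightarrow> ent (Hmat A A' a b) (X e) (X e') = a * sym_coeff (transpose_mat A') e e'"
  "i < n \<Longrightarrow> j < n \<Longrightarrow> ent (Hmat A A' a b) (Z i) (Z j) = A $$ (i, j)"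
  by (simp_all add: Hmat_def)

text \<open>The \<open>z\<close>-block is \<open>A\<close>. After multiplication by the inverse of \<open>A\<close>, the \<open>x\<close>-block is the scalar matrix of \<open>a\<close>.\<close>

lemma Hmat_inj:
  fixes A :: "'r::comm_ring_1 mat"
  assumes A: "A \<in> carrier (GL n)" "A2 \<in> carrier (GL n)"
    and eq: "Hmat A (inv\<^bsub>GL n\<^esub> A) a b = Hmat A2 (inv\<^bsub>GL n\<^esub> A2) a2 b2"
  shows "A = A2 \<and> a = a2"
proof -
  note c = GL_carrier[OF A(1)] GL_carrier[OF A(2)] GL_inv(2)[OF A(1)] GL_inv(2)[OF A(2)]
  have "A $$ (i, j) = A2 $$ (i, j)" if "i < n" "j < n" for i j
    using ent_Hmat(2)[OF that] eq by metis
  then have AA: "A = A2" using c by (intro eq_matI) auto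
  have "Hmat (1\<^sub>m n) (1\<^sub>m n) a b = Hmat A (inv\<^bsub>GL n\<^esub> A) a b * Hmat (inv\<^bsub>GL n\<^esub> A) A 1 1"
    "Hmat (1\<^sub>m n) (1\<^sub>m n) a2 b2 = Hmat A (inv\<^bsub>GL n\<^esub> A) a2 b2 * Hmat (inv\<^bsub>GL n\<^esub> A) A 1 1"
    using c GL_inv(3)[OF A(1)] by (simp_all add: Hmat_mult)
  then have eq1: "Hmat (1\<^sub>m n) (1\<^sub>m n) a b = Hmat (1\<^sub>m n) (1\<^sub>m n) a2 b2"
    using eq AA by simp
  obtain e0 where e0: "e0 \<in> E" using expos_nonempty[of n "m - 1"] n by (auto simp: E_def)
  have "ent (Hmat (1\<^sub>m n) (1\<^sub>m n) a b) (X e0) (X e0) = a" "ent (Hmat (1\<^sub>m n) (1\<^sub>m n) a2 b2) (X e0) (X e0) = a2"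
    using e0 by (simp_all add: Hmat_one)
  with eq1 AA show ?thesis by simp
qed

lemma group_subgroup_GL:
  "subgroup H (GL d) \<Longrightarrow> group ((GL d :: 'r::comm_ring_1 mat monoid)\<lparr>carrier := H\<rparr>)"
  by (rule group.subgroup_imp_group[OF group_GL])

lemma H_map_iso:
  "H_map m n \<in> iso (GL n \<times>\<times> GL 1) ((GL d :: 'r::comm_ring_1 mat monoid)\<lparr>carrier := H_pts m n\<rparr>)"
proof (rule isoI)
  show "H_map m n \<in> hom (GL n \<times>\<times> GL 1) ((GL d :: 'r::comm_ring_1 mat monoid)\<lparr>carrier := H_pts m n\<rparr>)"
    by (rule homI) (auto simp: DirProd_def H_pts_def H_map_mult)
  have "inj_on (H_map m n) (carrier (GL n) \<times> carrier (GL 1) :: ('r mat \<times> 'r mat) set)"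
  proof (rule inj_onI, clarify)
    fix A l A2 l2 :: "'r mat"
    assume A: "A \<in> carrier (GL n)" "A2 \<in> carrier (GL n)" and l: "l \<in> carrier (GL 1)" "l2 \<in> carrier (GL 1)"
      and eq: "H_map m n (A, l) = H_map m n (A2, l2)"
    from eq have "A = A2 \<and> l $$ (0, 0) = l2 $$ (0, 0)"
      using A GL_carrier[OF A(1)] GL_carrier[OF A(2)] by (intro Hmat_inj) (simp_all add: H_map_eq_Hmat)
    then show "A = A2 \<and> l = l2"
      using GL_carrier[OF l(1)] GL_carrier[OF l(2)] by (auto intro!: eq_matI)
  qed
  then show "bij_betw (H_map m n) (carrier (GL n \<times>\<times> GL 1)) (carrier ((GL d :: 'r::comm_ring_1 mat monoid)\<lparr>carrier := H_pts m n\<rparr>))"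
    by (simp add: bij_betw_def H_pts_def DirProd_def)
qed

lemma subgroup_H: "subgroup (H_pts m n) (GL d :: 'r::comm_ring_1 mat monoid)"
proof (rule group.subgroupI[OF group_GL])
  show "H_pts m n \<subseteq> carrier (GL d :: 'r mat monoid)"
    using H_pts_subset_Aut by (auto simp: Aut_pts_iff)
  have "Hmat (1\<^sub>m n) (inv\<^bsub>GL n\<^esub> (1\<^sub>m n)) 1 1 \<in> (H_pts m n :: 'r mat set)"
    unfolding H_pts_eq using one_in_GL by fastforce
  then show "H_pts m n \<noteq> ({} :: 'r mat set)" by auto
next
  fix M :: "'r mat" assume "M \<in> H_pts m n"
  then obtain A a b where A: "A \<in> carrier (GL n)" "a * b = 1" "M = Hmat A (inv\<^bsub>GL n\<^esub> A) a b"
    by (auto simp: H_pts_eq)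
  note c = GL_carrier[OF A(1)] GL_inv[OF A(1)]
  have ba: "b * a = 1" using A(2) by (simp add: mult.commute)
  have "inv\<^bsub>GL d\<^esub> M = Hmat (inv\<^bsub>GL n\<^esub> A) A b a"
    unfolding A(3) using Hmat_GL(2)[OF c(1,3,4,5) A(2)] Hmat_GL(2)[OF c(3,1,5,4) ba]
    by (intro GL_inv_eqI) auto
  moreover have "inv\<^bsub>GL n\<^esub> (inv\<^bsub>GL n\<^esub> A) = A"
    using c by (intro GL_inv_eqI) auto
  ultimately show "inv\<^bsub>GL d\<^esub> M \<in> H_pts m n"
    using c(2) ba unfolding H_pts_eq by force
next
  fix M M2 :: "'r mat" assume "M \<in> H_pts m n" "M2 \<in> H_pts m n"
  then show "M \<otimes>\<^bsub>GL d\<^esub> M2 \<in> H_pts m n"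
    unfolding H_pts_def DirProd_def by (force simp: H_map_mult[symmetric] GL_mult_closed)
qed

lemma map_mat_of_blk:
  assumes "h 0 = 0"
  shows "map_mat h (mat_of (blk p c d1 q d2 s)) = mat_of (blk (\<lambda>e e'. h (p e e')) (\<lambda>e f. h (c e f)) (\<lambda>e i. h (d1 e i))
    (\<lambda>f f'. h (q f f')) (\<lambda>f i. h (d2 f i)) (\<lambda>i j. h (s i j)))"
proof -
  have "h (blk p c d1 q d2 s x y) = blk (\<lambda>e e'. h (p e e')) (\<lambda>e f. h (c e f)) (\<lambda>e i. h (d1 e i))
    (\<lambda>f f'. h (q f f')) (\<lambda>f i. h (d2 f i)) (\<lambda>i j. h (s i j)) x y" for x y
    using assms by (cases x; cases y) simp_all
  then show ?thesis by (intro eq_matI) (auto simp: mat_of_def)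
qed

lemma Hmat_natural:
  fixes h :: "'r::comm_ring_1 \<Rightarrow> 's::comm_ring_1"
  assumes "comm_ring_hom h" and c: "A \<in> carrier_mat n n" "A' \<in> carrier_mat n n"
  shows "map_mat h (Hmat A A' a b) = Hmat (map_mat h A) (map_mat h A') (h a) (h b)"
proof -
  interpret h: comm_ring_hom h by fact
  have t: "transpose_mat A \<in> carrier_mat n n" "transpose_mat A' \<in> carrier_mat n n"
    using c by simp_all
  have tm: "map_mat h (transpose_mat A) = transpose_mat (map_mat h A)" "map_mat h (transpose_mat A') = transpose_mat (map_mat h A')"
    by (simp_all add: map_mat_transpose)
  have "h (a * sym_coeff (transpose_mat A') e e') = h a * sym_coeff (transpose_mat (map_mat h A')) e e'" if "e \<in> E" "e' \<in> E" for e e'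
    using h.sym_coeff_hom[OF t(2) that[unfolded E_def]] by (simp add: h.hom_mult tm)
  moreover have "h (b * sym_coeff (transpose_mat A) f' f) = h b * sym_coeff (transpose_mat (map_mat h A)) f' f" if "f \<in> F" "f' \<in> F" for f f'
    using h.sym_coeff_hom[OF t(1) that(2,1)] by (simp add: h.hom_mult tm)
  ultimately show ?thesis
    unfolding Hmat_def map_mat_of_blk[of h, OF h.hom_zero] using c
    by (intro mat_of_cong, unfold B_eq) auto
qed

lemma H_map_natural:
  fixes h :: "'r::comm_ring_1 \<Rightarrow> 's::comm_ring_1"
  assumes h: "comm_ring_hom h" and A: "A \<in> carrier (GL n)" and l: "l \<in> carrier (GL 1)"
  shows "map_mat h (H_map m n (A, l)) = H_map m n (map_mat h A, map_mat h l)"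
proof -
  note c = GL_carrier[OF A] GL_inv(2)[OF A] GL_carrier[OF l] GL_inv(2)[OF l]
  have "map_mat h l $$ (0, 0) = h (l $$ (0, 0))"
    "(inv\<^bsub>GL 1\<^esub> (map_mat h l)) $$ (0, 0) = h ((inv\<^bsub>GL 1\<^esub> l) $$ (0, 0))"
    using c comm_ring_hom.GL_hom(2)[OF h l, symmetric] by simp_all
  then show ?thesis
    using c comm_ring_hom.GL_hom(2)[OF h A] by (simp add: H_map_eq_Hmat Hmat_natural[OF h])
qed

section \<open>The normal subgroup\<close>

abbreviation delta :: "'a \<Rightarrow> 'a \<Rightarrow> 'r::comm_ring_1" where
  "delta \<equiv> \<lambda>x y. if x = y then 1 else 0"

definition triang :: "'r::comm_ring_1 mat \<Rightarrow> bool" where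
  "triang M \<longleftrightarrow> (\<forall>f\<in>F. \<forall>e\<in>E. ent M (Y f) (X e) = 0) \<and>
     (\<forall>i<n. (\<forall>e\<in>E. ent M (Z i) (X e) = 0) \<and> (\<forall>f\<in>F. ent M (Z i) (Y f) = 0))"

definition unitriang :: "'r::comm_ring_1 mat \<Rightarrow> bool" where
  "unitriang M \<longleftrightarrow> triang M \<and> (\<forall>e\<in>E. \<forall>e'\<in>E. ent M (X e) (X e') = (if e = e' then 1 else 0)) \<and>
     (\<forall>f\<in>F. \<forall>f'\<in>F. ent M (Y f) (Y f') = (if f = f' then 1 else 0)) \<and>
     (\<forall>i<n. \<forall>j<n. ent M (Z i) (Z j) = (if i = j then 1 else 0))"

lemma sum_delta_right:
  fixes g k :: "'a \<Rightarrow> 'r::comm_ring_1"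
  assumes "finite S" "b \<in> S" "\<And>x. x \<in> S \<Longrightarrow> k x = (if x = b then 1 else 0)"
  shows "(\<Sum>x\<in>S. g x * k x) = g b"
proof -
  have "(\<Sum>x\<in>S. g x * k x) = (\<Sum>x\<in>S. if x = b then g x else 0)"
    by (intro sum.cong) (auto simp: assms(3))
  then show ?thesis using assms by simp
qed

lemma sum_delta_left:
  fixes g k :: "'a \<Rightarrow> 'r::comm_ring_1"
  assumes "finite S" "b \<in> S" "\<And>x. x \<in> S \<Longrightarrow> k x = (if b = x then 1 else 0)"
  shows "(\<Sum>x\<in>S. k x * g x) = g b"
  using sum_delta_right[of S b k g] assms by (simp add: mult.commute eq_commute[of b])

lemma unitriangD:
  assumes "unitriang M"
  shows "triang M" "\<And>e e'. e \<in> E \<Longrightarrow> e' \<in> E \<Longrightarrow> ent M (X e) (X e') = (if e = e' then 1 else 0)"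
     "\<And>f f'. f \<in> F \<Longrightarrow> f' \<in> F \<Longrightarrow> ent M (Y f) (Y f') = (if f = f' then 1 else 0)"
     "\<And>i j. i < n \<Longrightarrow> j < n \<Longrightarrow> ent M (Z i) (Z j) = (if i = j then 1 else 0)"
  using assms by (auto simp: unitriang_def)

lemma triang_mult:
  fixes M K :: "'r::comm_ring_1 mat"
  assumes c: "M \<in> carrier_mat d d" "K \<in> carrier_mat d d" and t: "triang M" "triang K"
  shows "triang (M * K)"
    "\<And>e e'. e \<in> E \<Longrightarrow> e' \<in> E \<Longrightarrow> ent (M * K) (X e) (X e') = (\<Sum>x\<in>E. ent M (X e) (X x) * ent K (X x) (X e'))"
    "\<And>f f'. f \<in> F \<Longrightarrow> f' \<in> F \<Longrightarrow> ent (M * K) (Y f) (Y f') = (\<Sum>x\<in>F. ent M (Y f) (Y x) * ent K (Y x) (Y f'))"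
    "\<And>i j. i < n \<Longrightarrow> j < n \<Longrightarrow> ent (M * K) (Z i) (Z j) = (\<Sum>x<n. ent M (Z i) (Z x) * ent K (Z x) (Z j))"
  using t by (simp_all add: triang_def ent_mult[OF c] sum_B)

text \<open>On block triangular matrices this is multiplicative, with kernel \<open>unitriang\<close>; so \<open>N\<close> is the
  kernel of a homomorphism on the automorphism group.\<close>

definition diag_part :: "'r::comm_ring_1 mat \<Rightarrow> 'r mat" where
  "diag_part M = mat_of (blk (\<lambda>e e'. ent M (X e) (X e')) (\<lambda>_ _. 0) (\<lambda>_ _. 0)
     (\<lambda>f f'. ent M (Y f) (Y f')) (\<lambda>_ _. 0) (\<lambda>i j. ent M (Z i) (Z j)))"

lemma diag_part_carrier [simp]: "diag_part M \<in> carrier_mat d d"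
  by (simp add: diag_part_def)

lemma diag_part_mult:
  fixes M K :: "'r::comm_ring_1 mat"
  assumes "M \<in> carrier_mat d d" "K \<in> carrier_mat d d" "triang M" "triang K"
  shows "diag_part (M * K) = diag_part M * diag_part K"
  unfolding diag_part_def blk_mult
  by (rule mat_of_cong, unfold B_eq) (auto simp: triang_mult[OF assms])

lemma diag_part_one: "diag_part (1\<^sub>m d) = (1\<^sub>m d :: 'r::comm_ring_1 mat)"
  unfolding diag_part_def mat_of_one
  by (rule mat_of_cong, unfold B_eq) (auto simp: mat_of_one[symmetric] ent_one split: if_splits)

lemma unitriang_iff_diag_part: "unitriang M \<longleftrightarrow> triang M \<and> diag_part M = (1\<^sub>m d :: 'r::comm_ring_1 mat)"
proof -
  have "diag_part M = 1\<^sub>m d \<longleftrightarrow> (\<forall>e\<in>E. \<forall>e'\<in>E. ent M (X e) (X e') = (if e = e' then 1 else 0)) \<and>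
     (\<forall>f\<in>F. \<forall>f'\<in>F. ent M (Y f) (Y f') = (if f = f' then 1 else 0)) \<and>
     (\<forall>i<n. \<forall>j<n. ent M (Z i) (Z j) = (if i = j then 1 else 0))"
    unfolding diag_part_def mat_of_one mat_of_eq_iff B_eq by (simp add: ball_Un Ball_image_comp lessThan_def)
  then show ?thesis by (auto simp: unitriang_def)
qed

definition Nmat :: "(nat list \<Rightarrow> 'r) \<Rightarrow> (nat list \<Rightarrow> nat \<Rightarrow> 'r) \<Rightarrow> (nat list \<Rightarrow> nat \<Rightarrow> 'r) \<Rightarrow> 'r::comm_ring_1 mat" where
  "Nmat b d1 d2 = mat_of (blk delta (\<lambda>e f. b (map2 (+) e f)) d1
     delta d2 delta)"

lemma Nmat_carrier [simp]: "Nmat b d1 d2 \<in> carrier_mat d d"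
  by (simp add: Nmat_def)

text \<open>Every matrix arises from a function of the elements of an index list, provided that the list has no
  repetitions.\<close>

lemma mat_eq_mat_indexed:
  fixes D :: "'r mat"
  assumes "D \<in> carrier_mat (length xs) k" "distinct xs"
  obtains g where "D = mat (length xs) k (\<lambda>(i, j). g (xs ! i) j)"
proof
  show "D = mat (length xs) k (\<lambda>(i, j). (\<lambda>x j. D $$ (inv_into {..<length xs} ((!) xs) x, j)) (xs ! i) j)"
    using assms by (intro eq_matI) (auto simp: inv_into_f_f inj_on_nth)
qed

lemma N_pts_eq: "(N_pts m n :: 'r::comm_ring_1 mat set) = {Nmat b d1 d2 |b d1 d2. True}"
proof (intro equalityI subsetI)
  fix M :: "'r mat" assume "M \<in> N_pts m n"
  then obtain C D1 D2 b where M: "M = tri_block (1\<^sub>m (length (E_list m n))) C D1 (1\<^sub>m (length (F_list m n))) D2 (1\<^sub>m n)"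
    and C: "C \<in> carrier_mat (length (E_list m n)) (length (F_list m n))"
    and D: "D1 \<in> carrier_mat (length (E_list m n)) n" "D2 \<in> carrier_mat (length (F_list m n)) n"
    and b: "\<forall>i<length (E_list m n). \<forall>j<length (F_list m n). C $$ (i, j) = b (map2 (+) (E_list m n ! i) (F_list m n ! j))"
    unfolding N_pts_def by blast
  obtain d1 where d1: "D1 = mat (length (E_list m n)) n (\<lambda>(i, j). d1 (E_list m n ! i) j)"
    using mat_eq_mat_indexed[OF D(1) E_list(1)] .
  obtain d2 where d2: "D2 = mat (length (F_list m n)) n (\<lambda>(i, j). d2 (F_list m n ! i) j)"
    using mat_eq_mat_indexed[OF D(2) F_list(1)] .
  have "M = Nmat b d1 d2"
    unfolding M Nmat_def using C b
    by (intro tri_block_eq_mat_of d1 d2)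
       (auto intro!: eq_matI simp: nth_eq_iff_index_eq[OF E_list(1)] nth_eq_iff_index_eq[OF F_list(1)])
  then show "M \<in> {Nmat b d1 d2 |b d1 d2. True}" by blast
next
  fix M :: "'r mat" assume "M \<in> {Nmat b d1 d2 |b d1 d2. True}"
  then obtain b d1 d2 where M: "M = Nmat b d1 d2" by blast
  let ?C = "mat (length (E_list m n)) (length (F_list m n)) (\<lambda>(i, j). b (map2 (+) (E_list m n ! i) (F_list m n ! j)))"
  let ?D1 = "mat (length (E_list m n)) n (\<lambda>(i, j). d1 (E_list m n ! i) j)"
  let ?D2 = "mat (length (F_list m n)) n (\<lambda>(i, j). d2 (F_list m n ! i) j)"
  have "M = tri_block (1\<^sub>m (length (E_list m n))) ?C ?D1 (1\<^sub>m (length (F_list m n))) ?D2 (1\<^sub>m n)"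
    unfolding M Nmat_def
    by (intro tri_block_eq_mat_of[symmetric])
       (auto intro!: eq_matI simp: nth_eq_iff_index_eq[OF E_list(1)] nth_eq_iff_index_eq[OF F_list(1)])
  then show "M \<in> N_pts m n"
    unfolding N_pts_def by (intro CollectI exI[of _ ?C] exI[of _ ?D1] exI[of _ ?D2] conjI exI[of _ b]) auto
qed

lemma unitriang_iff:
  fixes M :: "'r::comm_ring_1 mat"
  assumes "M \<in> carrier_mat d d"
  shows "unitriang M \<longleftrightarrow> (\<exists>c d1 d2. M = mat_of (blk delta c d1
     delta d2 delta))" (is "_ \<longleftrightarrow> (\<exists>c d1 d2. M = ?m c d1 d2)")
proof
  assume u: "unitriang M"
  have "M = ?m (\<lambda>e f. ent M (X e) (Y f)) (\<lambda>e i. ent M (X e) (Z i)) (\<lambda>f i. ent M (Y f) (Z i))"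
    using u unfolding mat_eq_iff_ent[OF assms mat_of_carrier] 
    by (auto simp: B_eq unitriang_def triang_def)
  then show "\<exists>c d1 d2. M = ?m c d1 d2" by blast
next
  assume "\<exists>c d1 d2. M = ?m c d1 d2"
  then show "unitriang M" by (auto simp: unitriang_def triang_def)
qed

lemma unitriang_GL:
  fixes M :: "'r::comm_ring_1 mat"
  assumes c: "M \<in> carrier_mat d d" and u: "unitriang M"
  shows "M \<in> carrier (GL d)"
proof -
  let ?m = "\<lambda>c d1 d2. mat_of (blk delta c d1
     delta d2 delta) :: 'r mat"
  obtain c d1 d2 where M: "M = ?m c d1 d2" using u unitriang_iff[OF c] by blast
  define K where "K = ?m (\<lambda>e f. - c e f) (\<lambda>e i. - d1 e i + (\<Sum>f\<in>F. c e f * d2 f i)) (\<lambda>f i. - d2 f i)"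
  have "M * K = 1\<^sub>m d"
    unfolding M K_def blk_mult mat_of_one
    by (rule mat_of_cong, unfold B_eq)
       (auto simp: if_distrib[of "\<lambda>x. x * _"] if_distrib[of "\<lambda>x. _ * x"] if_distrib[of uminus] sum_negf
         cong: if_cong split: if_splits)
  moreover have "K * M = 1\<^sub>m d"
    unfolding M K_def blk_mult mat_of_one
    by (rule mat_of_cong, unfold B_eq)
       (auto simp: if_distrib[of "\<lambda>x. x * _"] if_distrib[of "\<lambda>x. _ * x"] if_distrib[of uminus] sum_negf
         cong: if_cong split: if_splits)
  ultimately show ?thesis by (auto simp: GL_iff c K_def intro!: bexI[of _ K])
qed

text \<open>For a unitriangular matrix the first condition of \<open>preserves_blk\<close> always holds, and the second one is the
  symmetry of \<open>C\<close> in \<open>symmetric_imp_hankel\<close>.\<close>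

lemma N_pts_iff: "M \<in> N_pts m n \<longleftrightarrow> M \<in> Aut_pts m n \<and> unitriang (M :: 'r::comm_ring_1 mat)"
proof
  assume "M \<in> N_pts m n"
  then obtain b d1 d2 where M: "M = Nmat b d1 d2" by (auto simp: N_pts_eq)
  then have c: "M \<in> carrier_mat d d" by simp
  have u: "unitriang M" unfolding unitriang_iff[OF c] using M by (auto simp: Nmat_def)
  have "preserves M"
    unfolding M Nmat_def preserves_blk
  proof (intro conjI ballI allI impI)
    fix e f i assume "e \<in> E" "f \<in> F" "i < n"
    moreover have "(\<Sum>l<n. if f = inc l e then if l = i then 1 else 0 else 0) =
      (\<Sum>l<n. if l = i then if f = inc i e then 1 else 0 else (0 :: 'r))"
      by (intro sum.cong) auto
    ultimately show "(\<Sum>x\<in>E. (if e = x then 1 else 0) * (if f = inc i x then 1 else 0)) =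
      (\<Sum>l<n. if f = inc l e then if l = i then 1 else 0 else (0 :: 'r))"
      by (simp add: if_distrib[of "\<lambda>x. x * _"] cong: if_cong)
  next
    fix e e' i assume "e \<in> E" "e' \<in> E" "i < n"
    then show "(\<Sum>x\<in>E. (if e = x then 1 else 0) * b (map2 (+) e' (inc i x))) =
      (\<Sum>x\<in>E. (if e' = x then 1 else 0) * b (map2 (+) e (inc i x)))"
      using hankel_imp_symmetric[of e e' i] by (simp add: if_distrib[of "\<lambda>x. x * _"] cong: if_cong)
  qed
  then show "M \<in> Aut_pts m n \<and> unitriang M" using u unitriang_GL[OF c u] by (simp add: Aut_pts_iff)
next
  assume M: "M \<in> Aut_pts m n \<and> unitriang M"
  then have c: "M \<in> carrier_mat d d" by (simp add: Aut_pts_iff GL_carrier)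
  obtain c d1 d2 where Mc: "M = mat_of (blk delta c d1
     delta d2 delta)" using M unitriang_iff[OF c] by blast
  have "c e' (inc i e) = c e (inc i e')" if "e \<in> E" "e' \<in> E" "i < n" for e e' i
  proof -
    have "(\<Sum>x\<in>E. (if e = x then 1 else 0) * c e' (inc i x)) = (\<Sum>x\<in>E. (if e' = x then 1 else 0) * c e (inc i x))"
      using M that unfolding Aut_pts_iff Mc preserves_blk by blast
    then show ?thesis using that by (simp add: if_distrib[of "\<lambda>x. x * _"] cong: if_cong)
  qed
  from symmetric_imp_hankel[of c, OF this] obtain b where "\<forall>e\<in>E. \<forall>f\<in>F. c e f = b (map2 (+) e f)" by blast
  then have "M = Nmat b d1 d2"
    unfolding Mc Nmat_def by (intro mat_of_cong, unfold B_eq) auto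
  then show "M \<in> N_pts m n" by (auto simp: N_pts_eq)
qed

section \<open>The semidirect decomposition\<close>

text \<open>The \<open>z\<close>-block \<open>A\<close> of \<open>M\<close> is invertible, since \<open>M\<close> and its inverse map the span of the \<open>z\<^sub>i\<close> to itself.
  Dividing by the element of the complement that belongs to \<open>A\<close> leads to \<open>shape_of_preserving\<close>,
  which yields the scalar.\<close>

lemma Aut_decompose:
  fixes M :: "'r::comm_ring_1 mat"
  assumes M: "M \<in> Aut_pts m n"
  obtains K A a b where "K \<in> N_pts m n" "A \<in> carrier (GL n)" "a * b = 1" "M = K * Hmat A (inv\<^bsub>GL n\<^esub> A) a b"
proof -
  interpret G: group "GL d :: 'r mat monoid" by (rule group_GL)
  let ?M' = "inv\<^bsub>GL d\<^esub> M"
  from M have GL: "M \<in> carrier (GL d)" and pM: "preserves M" by (simp_all add: Aut_pts_iff)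
  note c = GL_carrier[OF GL] GL_inv[OF GL]
  have pM': "preserves ?M'" using GL pM by (rule preserves_inv)
  define A where "A = mat n n (\<lambda>(i, j). ent M (Z i) (Z j))"
  define A' where "A' = mat n n (\<lambda>(i, j). ent ?M' (Z i) (Z j))"
  have ZZ: "ent (P * Q) (Z i) (Z j) = (\<Sum>l<n. ent P (Z i) (Z l) * ent Q (Z l) (Z j))"
    if "P \<in> carrier_mat d d" "Q \<in> carrier_mat d d" "preserves P" "i < n" "j < n" for P Q :: "'r mat" and i j
    using that by (simp add: ent_mult sum_B preserves_Z_rows)
  have A: "A \<in> carrier_mat n n" "A' \<in> carrier_mat n n" by (simp_all add: A_def A'_def)
  have AA': "A * A' = 1\<^sub>m n"
    using ZZ[OF c(1,3) pM] c by (intro eq_matI) (simp_all add: A_def A'_def scalar_prod_def atLeast0LessThan ent_one)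
  have A'A: "A' * A = 1\<^sub>m n"
    using ZZ[OF c(3,1) pM'] c by (intro eq_matI) (simp_all add: A_def A'_def scalar_prod_def atLeast0LessThan ent_one)
  have AGL: "A \<in> carrier (GL n)" "inv\<^bsub>GL n\<^esub> A = A'"
    using A AA' A'A by (auto simp: GL_iff intro: GL_inv_eqI)
  have H: "Hmat A' A 1 1 \<in> carrier (GL d)" "preserves (Hmat A' A 1 1)"
    using A AA' A'A by (auto intro!: Hmat_GL preserves_Hmat)
  define K where "K = M * Hmat A' A 1 1"
  have K: "K \<in> carrier (GL d)" "preserves K"
    unfolding K_def using GL H pM c by (auto intro: GL_mult_closed preserves_mult)
  have SK: "ent K (Z l) (Z i) = (if l = i then 1 else 0)" if "l < n" "i < n" for l i
  proof -
    have "ent K (Z l) (Z i) = (A * A') $$ (l, i)"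
      unfolding K_def using A that by (simp add: ZZ[OF c(1) _ pM] ent_Hmat scalar_prod_def atLeast0LessThan A_def)
    then show ?thesis using that AA' by simp
  qed
  obtain a b where ab: "a * b = 1"
    and sh: "\<And>e e'. e \<in> E \<Longrightarrow> e' \<in> E \<Longrightarrow> ent K (X e) (X e') = (if e = e' then a else 0)"
      "\<And>f f'. f \<in> F \<Longrightarrow> f' \<in> F \<Longrightarrow> ent K (Y f) (Y f') = (if f = f' then b else 0)"
      "\<And>f e. f \<in> F \<Longrightarrow> e \<in> E \<Longrightarrow> ent K (Y f) (X e) = 0"
    using shape_of_preserving[OF K(2) GL_carrier[OF K(1)] GL_inv(2,4)[OF K(1)] SK] by blast
  have ba: "b * a = 1" using ab by (simp add: mult.commute)
  let ?S = "Hmat (1\<^sub>m n) (1\<^sub>m n) b a :: 'r mat"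
  define L where "L = K * ?S"
  have S: "?S \<in> carrier (GL d)" "preserves ?S" using ba by (auto intro!: Hmat_GL preserves_Hmat)
  have L: "L \<in> carrier (GL d)" "preserves L"
    unfolding L_def using K S by (auto intro: GL_mult_closed preserves_mult GL_carrier)
  have tK: "triang K" using sh preserves_Z_rows[OF K(2)] by (simp add: triang_def)
  have tS: "triang ?S" by (simp add: triang_def Hmat_def)
  have "diag_part K = Hmat (1\<^sub>m n) (1\<^sub>m n) a b"
    unfolding diag_part_def Hmat_one by (rule mat_of_cong, unfold B_eq) (auto simp: sh SK)
  moreover have "diag_part ?S = ?S"
    unfolding diag_part_def by (rule trans[OF mat_of_cong Hmat_one[symmetric]], unfold B_eq) (auto simp: Hmat_one)
  ultimately have "diag_part L = 1\<^sub>m d"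
    unfolding L_def
    using diag_part_mult[OF GL_carrier[OF K(1)] GL_carrier[OF S(1)] tK tS] ab ba
    by (simp add: Hmat_mult Hmat_one_one)
  then have "unitriang L"
    using triang_mult(1)[OF GL_carrier[OF K(1)] GL_carrier[OF S(1)] tK tS] by (simp add: unitriang_iff_diag_part L_def)
  with L have LN: "L \<in> N_pts m n" by (simp add: N_pts_iff Aut_pts_iff)
  have "L * Hmat A A' a b = M"
  proof -
    have "?S * Hmat A A' a b = Hmat A A' 1 1" using A ba ab by (simp add: Hmat_mult)
    moreover have "Hmat A' A 1 1 * Hmat A A' 1 1 = 1\<^sub>m d" using A AA' A'A by (intro Hmat_GL) auto
    moreover have "L * Hmat A A' a b = M * (Hmat A' A 1 1 * (?S * Hmat A A' a b))"
      unfolding L_def K_def using c(1)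
      by (simp only: assoc_mult_mat[of _ d d _ d _ d] Hmat_carrier mult_carrier_mat[of _ d d _ d])
    ultimately have "L * Hmat A A' a b = M * 1\<^sub>m d" by simp
    then show ?thesis using c by simp
  qed
  then show thesis using that[OF LN AGL(1) ab] AGL(2) by simp
qed

lemma N_subset_Aut: "N_pts m n \<subseteq> (Aut_pts m n :: 'r::comm_ring_1 mat set)"
  by (auto simp: N_pts_iff)

lemma triang_Hmat: "triang (Hmat A A' a b)"
  by (simp add: triang_def Hmat_def)

lemma triang_Aut:
  assumes "M \<in> Aut_pts m n"
  shows "triang (M :: 'r::comm_ring_1 mat)"
proof -
  obtain K A a b where K: "K \<in> N_pts m n" and M: "M = K * Hmat A (inv\<^bsub>GL n\<^esub> A) a b"
    by (rule Aut_decompose[OF assms])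
  then have "K \<in> carrier_mat d d" "triang K"
    by (auto simp: N_pts_iff Aut_pts_iff unitriang_def GL_carrier)
  then show ?thesis unfolding M by (intro triang_mult(1) Hmat_carrier triang_Hmat)
qed

lemma semidirect_N_H: "semidirect (Aut_grp m n :: 'r::comm_ring_1 mat monoid) (N_pts m n) (H_pts m n)"
proof -
  interpret GL: group "GL d :: 'r mat monoid" by (rule group_GL)
  interpret A: group "Aut_grp m n :: 'r mat monoid"
    unfolding Aut_grp_def by (rule group_subgroup_GL[OF subgroup_Aut])
  have inv: "inv\<^bsub>Aut_grp m n\<^esub> M = inv\<^bsub>GL d\<^esub> M" if "M \<in> Aut_pts m n" for M :: "'r mat"
    unfolding Aut_grp_def using that by (rule GL.m_inv_consistent[OF subgroup_Aut])
  have invA: "inv\<^bsub>GL d\<^esub> M \<in> Aut_pts m n" if "M \<in> Aut_pts m n" for M :: "'r mat"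
    using that by (rule subgroup.m_inv_closed[OF subgroup_Aut])
  have multA: "M * K \<in> Aut_pts m n" if "M \<in> Aut_pts m n" "K \<in> Aut_pts m n" for M K :: "'r mat"
    using subgroup.m_closed[OF subgroup_Aut that] by simp
  have carr: "M \<in> carrier_mat d d" if "M \<in> Aut_pts m n" for M :: "'r mat"
    using that by (simp add: Aut_pts_iff GL_carrier)
  have triA: "triang M" if "M \<in> Aut_pts m n" for M :: "'r mat" using that by (rule triang_Aut)
  have N: "K \<in> N_pts m n \<longleftrightarrow> K \<in> Aut_pts m n \<and> diag_part K = 1\<^sub>m d" for K :: "'r mat"
    using triA unitriang_iff_diag_part by (auto simp: N_pts_iff)
  have diag_mult: "diag_part (M * K) = diag_part M * diag_part K"
    if "M \<in> Aut_pts m n" "K \<in> Aut_pts m n" for M K :: "'r mat"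
    using that by (intro diag_part_mult carr triA)
  have diag_inv: "diag_part M * diag_part (inv\<^bsub>GL d\<^esub> M) = 1\<^sub>m d" if "M \<in> Aut_pts m n" for M :: "'r mat"
    using diag_mult[OF that invA[OF that]] that by (simp add: Aut_pts_iff GL_inv diag_part_one)
  have conj: "M * K * inv\<^bsub>GL d\<^esub> M \<in> N_pts m n" if "M \<in> Aut_pts m n" "K \<in> N_pts m n" for M K :: "'r mat"
    using that invA[OF that(1)] by (simp add: N diag_mult multA diag_inv right_mult_one_mat[OF diag_part_carrier])
  have subN: "subgroup (N_pts m n) (GL d :: 'r mat monoid)"
  proof (rule GL.subgroupI)
    show "N_pts m n \<subseteq> carrier (GL d :: 'r mat monoid)"
      by (auto simp: N_pts_iff Aut_pts_iff)
    show "N_pts m n \<noteq> ({} :: 'r mat set)" by (auto simp: N_pts_eq)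
  next
    fix M :: "'r mat" assume "M \<in> N_pts m n"
    then have M: "M \<in> Aut_pts m n" "diag_part M = 1\<^sub>m d" by (simp_all add: N)
    then show "inv\<^bsub>GL d\<^esub> M \<in> N_pts m n"
      using diag_inv[OF M(1)] invA[OF M(1)] by (simp add: N left_mult_one_mat[OF diag_part_carrier])
  next
    fix M K :: "'r mat" assume "M \<in> N_pts m n" "K \<in> N_pts m n"
    then show "M \<otimes>\<^bsub>GL d\<^esub> K \<in> N_pts m n" by (simp add: N diag_mult multA)
  qed
  have "N_pts m n \<lhd> (Aut_grp m n :: 'r mat monoid)"
    unfolding A.normal_inv_iff
  proof (intro conjI ballI)
    show "subgroup (N_pts m n) (Aut_grp m n :: 'r mat monoid)"
      unfolding Aut_grp_def by (rule GL.subgroup_incl[OF subN subgroup_Aut N_subset_Aut])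
    fix M K :: "'r mat" assume "M \<in> carrier (Aut_grp m n)" "K \<in> N_pts m n"
    then show "M \<otimes>\<^bsub>Aut_grp m n\<^esub> K \<otimes>\<^bsub>Aut_grp m n\<^esub> inv\<^bsub>Aut_grp m n\<^esub> M \<in> N_pts m n"
      using conj inv by (simp add: Aut_grp_def)
  qed
  moreover have "subgroup (H_pts m n) (Aut_grp m n :: 'r mat monoid)"
    unfolding Aut_grp_def by (rule GL.subgroup_incl[OF subgroup_H subgroup_Aut H_pts_subset_Aut])
  moreover have "N_pts m n \<inter> H_pts m n = {\<one>\<^bsub>Aut_grp m n\<^esub> :: 'r mat}"
  proof (intro equalityI subsetI)
    fix M :: "'r mat" assume "M \<in> N_pts m n \<inter> H_pts m n"
    then have u: "unitriang M" and c: "M \<in> carrier_mat d d" and H: "M \<in> H_pts m n" by (auto simp: N_pts_iff carr)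
    then obtain A a b where MH: "M = Hmat A (inv\<^bsub>GL n\<^esub> A) a b" by (auto simp: H_pts_eq)
    have off: "\<And>e f. e \<in> E \<Longrightarrow> f \<in> F \<Longrightarrow> ent M (X e) (Y f) = 0" "\<And>e i. e \<in> E \<Longrightarrow> i < n \<Longrightarrow> ent M (X e) (Z i) = 0"
      "\<And>f i. f \<in> F \<Longrightarrow> i < n \<Longrightarrow> ent M (Y f) (Z i) = 0"
      unfolding MH Hmat_def by simp_all
    have low: "\<And>e f. e \<in> E \<Longrightarrow> f \<in> F \<Longrightarrow> ent M (Y f) (X e) = 0" "\<And>e i. e \<in> E \<Longrightarrow> i < n \<Longrightarrow> ent M (Z i) (X e) = 0"
      "\<And>f i. f \<in> F \<Longrightarrow> i < n \<Longrightarrow> ent M (Z i) (Y f) = 0"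
      using unitriangD(1)[OF u] by (simp_all add: triang_def)
    have "ent M x y = ent (1\<^sub>m d) x y" if "x \<in> B" "y \<in> B" for x y
      unfolding ent_one[OF that] by (cases x; cases y; insert that) (simp_all add: off low unitriangD(2-4)[OF u])
    then have "M = 1\<^sub>m d" unfolding mat_eq_iff_ent[OF c one_carrier_mat] by blast
    then show "M \<in> {\<one>\<^bsub>Aut_grp m n\<^esub>}" by (simp add: Aut_grp_def)
  next
    fix M :: "'r mat" assume "M \<in> {\<one>\<^bsub>Aut_grp m n\<^esub>}"
    then show "M \<in> N_pts m n \<inter> H_pts m n"
      using subgroup.one_closed[OF subN] subgroup.one_closed[OF subgroup_H] by (simp add: Aut_grp_def)
  qed
  moreover have "N_pts m n <#>\<^bsub>Aut_grp m n\<^esub> H_pts m n = (carrier (Aut_grp m n) :: 'r mat set)"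
  proof (intro equalityI subsetI)
    fix M :: "'r mat" assume "M \<in> N_pts m n <#>\<^bsub>Aut_grp m n\<^esub> H_pts m n"
    then show "M \<in> carrier (Aut_grp m n)"
      using multA N_subset_Aut H_pts_subset_Aut by (auto simp: set_mult_def Aut_grp_def)
  next
    fix M :: "'r mat" assume "M \<in> carrier (Aut_grp m n)"
    then have "M \<in> Aut_pts m n" by (simp add: Aut_grp_def)
    then obtain K A a b where "K \<in> N_pts m n" "A \<in> carrier (GL n)" "a * b = 1" "M = K * Hmat A (inv\<^bsub>GL n\<^esub> A) a b"
      by (rule Aut_decompose)
    then show "M \<in> N_pts m n <#>\<^bsub>Aut_grp m n\<^esub> H_pts m n"
      by (auto simp: set_mult_def Aut_grp_def H_pts_eq) blast
  qed
  ultimately show ?thesis by (simp add: semidirect_def)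
qed

end

section \<open>Integer polynomials that vanish at all complex points\<close>

lemma base_expansion_inj:
  fixes f g :: "nat \<Rightarrow> nat"
  assumes "(\<Sum>i<N. f i * b ^ i) = (\<Sum>i<N. g i * b ^ i)"
    and "\<And>i. i < N \<Longrightarrow> f i < b" "\<And>i. i < N \<Longrightarrow> g i < b" and "i < N"
  shows "f i = g i"
  using assms
proof (induction N arbitrary: f g i)
  case (Suc N)
  have split: "(\<Sum>i<Suc N. h i * b ^ i) = h 0 + b * (\<Sum>i<N. h (Suc i) * b ^ i)" for h :: "nat \<Rightarrow> nat"
    by (simp add: sum.lessThan_Suc_shift sum_distrib_left ac_simps del: sum.lessThan_Suc)
  have b: "f 0 < b" "g 0 < b" using Suc.prems by auto
  have eq: "f 0 + b * (\<Sum>i<N. f (Suc i) * b ^ i) = g 0 + b * (\<Sum>i<N. g (Suc i) * b ^ i)"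
    using Suc.prems(1) by (simp only: split)
  have "f 0 = g 0" using arg_cong[OF eq, of "\<lambda>x. x mod b"] b by simp
  moreover from this eq have "(\<Sum>i<N. f (Suc i) * b ^ i) = (\<Sum>i<N. g (Suc i) * b ^ i)" using b by simp
  then have "f (Suc j) = g (Suc j)" if "j < N" for j
    using Suc.IH[of "\<lambda>i. f (Suc i)" "\<lambda>i. g (Suc i)" j] Suc.prems(2,3) that by auto
  ultimately show ?case using Suc.prems(4) by (cases i) auto
qed simp

text \<open>Kronecker's substitution: the variables are replaced by rapidly growing powers of one
  variable, which keeps the finitely many monomials of a polynomial apart.\<close>

lemma int_mpoly_eq_0I:
  fixes p :: "('v \<Rightarrow>\<^sub>0 nat) \<Rightarrow>\<^sub>0 int"
  assumes "\<And>a :: 'v \<Rightarrow> complex. mpoly_eval of_int a p = 0"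
  shows "p = 0"
proof (rule ccontr)
  assume "p \<noteq> 0"
  then obtain k0 where k0: "k0 \<in> Poly_Mapping.keys p" by (meson keys_eq_empty subsetI subset_antisym empty_iff equals0I)
  let ?K = "Poly_Mapping.keys p"
  define V where "V = \<Union> (Poly_Mapping.keys ` ?K)"
  have V: "finite V" by (auto simp: V_def)
  obtain N and idx :: "'v \<Rightarrow> nat" where idx: "bij_betw idx V {..<N}"
    using ex_bij_betw_finite_nat[OF V] by (auto simp: atLeast0LessThan)
  define b where "b = Suc (\<Sum>k\<in>?K. \<Sum>v\<in>V. Poly_Mapping.lookup k v)"
  have less: "Poly_Mapping.lookup k v < b" if "k \<in> ?K" "v \<in> V" for k v
  proof -
    have "Poly_Mapping.lookup k v \<le> (\<Sum>v\<in>V. Poly_Mapping.lookup k v)"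
      using V that by (intro member_le_sum) auto
    also have "\<dots> \<le> (\<Sum>k\<in>?K. \<Sum>v\<in>V. Poly_Mapping.lookup k v)"
      using that by (intro member_le_sum[of k ?K "\<lambda>k. \<Sum>v\<in>V. Poly_Mapping.lookup k v"]) auto
    finally show ?thesis by (simp add: b_def)
  qed
  define w where "w k = (\<Sum>v\<in>V. Poly_Mapping.lookup k v * b ^ idx v)" for k
  have w_idx: "w k = (\<Sum>i<N. Poly_Mapping.lookup k (inv_into V idx i) * b ^ i)" for k
    unfolding w_def using bij_betw_inv_into_left[OF idx]
    by (subst sum.reindex_bij_betw[OF idx, symmetric]) (auto intro!: sum.cong)
  have inj: "k = l" if kl: "k \<in> ?K" "l \<in> ?K" "w k = w l" for k l
  proof (rule poly_mapping_eqI)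
    fix v
    show "Poly_Mapping.lookup k v = Poly_Mapping.lookup l v"
    proof (cases "v \<in> V")
      case True
      have "inv_into V idx i \<in> V" if "i < N" for i
        using bij_betw_apply[OF bij_betw_inv_into[OF idx]] that by auto
      then have "Poly_Mapping.lookup k (inv_into V idx (idx v)) = Poly_Mapping.lookup l (inv_into V idx (idx v))"
        using base_expansion_inj[of "\<lambda>i. Poly_Mapping.lookup k (inv_into V idx i)" b N
            "\<lambda>i. Poly_Mapping.lookup l (inv_into V idx i)" "idx v"] kl less bij_betw_apply[OF idx True]
        by (simp add: w_idx)
      then show ?thesis using bij_betw_inv_into_left[OF idx True] by simp
    next
      case False
      then have "v \<notin> Poly_Mapping.keys k" "v \<notin> Poly_Mapping.keys l" using kl by (auto simp: V_def)
      then show ?thesis by (simp add: in_keys_iff)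
    qed
  qed
  define q :: "complex poly" where "q = (\<Sum>k\<in>?K. monom (of_int (Poly_Mapping.lookup p k)) (w k))"
  have "coeff q (w k0) = (\<Sum>k\<in>?K. if k = k0 then of_int (Poly_Mapping.lookup p k) else 0)"
    unfolding q_def coeff_sum using inj k0 by (intro sum.cong) (auto simp: coeff_monom)
  then have "coeff q (w k0) \<noteq> 0" using k0 by (simp add: in_keys_iff)
  then have "q \<noteq> 0" by auto
  then have "finite {x. poly q x = 0}" by (rule poly_roots_finite)
  then obtain x where x: "poly q x \<noteq> 0"
    using infinite_UNIV_char_0[where 'a = complex] by (metis (mono_tags) UNIV_I finite_subset mem_Collect_eq subsetI)
  have "mpoly_eval of_int (\<lambda>v. x ^ (b ^ idx v)) p = poly q x"
  proof -
    have "mon_eval (\<lambda>v. x ^ (b ^ idx v)) k = x ^ w k" if "k \<in> ?K" for k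
    proof -
      have "mon_eval (\<lambda>v. x ^ (b ^ idx v)) k = (\<Prod>v\<in>V. (x ^ (b ^ idx v)) ^ Poly_Mapping.lookup k v)"
        using that V by (intro mon_eval_superset) (auto simp: V_def)
      also have "\<dots> = x ^ w k" by (simp add: w_def power_sum power_mult[symmetric] mult.commute)
      finally show ?thesis .
    qed
    then show ?thesis by (simp add: mpoly_eval_def q_def poly_sum poly_monom)
  qed
  then show False using assms x by simp
qed

section \<open>Clearing denominators in a polynomial in the entries of a matrix\<close>

text \<open>A polynomial in the entries of a matrix is homogenised by the powers of a further variable \<open>u\<close>, so that
  it can be evaluated at the numerators of a matrix with common denominator \<open>u\<close>. As a bound for
  the degrees, their sum is good enough.\<close>

definition tot_deg :: "nat \<Rightarrow> (nat \<times> nat \<Rightarrow>\<^sub>0 nat) \<Rightarrow> nat" where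
  "tot_deg d k = (\<Sum>i<d. \<Sum>j<d. Poly_Mapping.lookup k (i, j))"

definition deg_bound :: "nat \<Rightarrow> 'c::zero entry_poly \<Rightarrow> nat" where
  "deg_bound d p = (\<Sum>k\<in>Poly_Mapping.keys p. tot_deg d k)"

definition hom_peval :: "nat \<Rightarrow> ('c::zero \<Rightarrow> 'r::comm_ring_1) \<Rightarrow> 'r \<Rightarrow> 'r mat \<Rightarrow> 'c entry_poly \<Rightarrow> 'r" where
  "hom_peval d h u M p = (\<Sum>k\<in>Poly_Mapping.keys p. h (Poly_Mapping.lookup p k) *
     (u ^ (deg_bound d p - tot_deg d k) * (\<Prod>i<d. \<Prod>j<d. (M $$ (i, j)) ^ Poly_Mapping.lookup k (i, j))))"

lemma hom_peval_smult:
  assumes M: "M \<in> carrier_mat d d"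
  shows "hom_peval d h u (u \<cdot>\<^sub>m M) p = u ^ deg_bound d p * peval h M p"
proof -
  have "u ^ (deg_bound d p - tot_deg d k) * (\<Prod>i<d. \<Prod>j<d. ((u \<cdot>\<^sub>m M) $$ (i, j)) ^ Poly_Mapping.lookup k (i, j)) =
     u ^ deg_bound d p * (\<Prod>i<d. \<Prod>j<d. (M $$ (i, j)) ^ Poly_Mapping.lookup k (i, j))"
    if "k \<in> Poly_Mapping.keys p" for k
  proof -
    have "tot_deg d k \<le> deg_bound d p" unfolding deg_bound_def using that by (intro member_le_sum) auto
    moreover have "(\<Prod>i<d. \<Prod>j<d. ((u \<cdot>\<^sub>m M) $$ (i, j)) ^ Poly_Mapping.lookup k (i, j)) =
      u ^ tot_deg d k * (\<Prod>i<d. \<Prod>j<d. (M $$ (i, j)) ^ Poly_Mapping.lookup k (i, j))"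
      using M by (simp add: power_mult_distrib prod.distrib tot_deg_def power_sum)
    ultimately show ?thesis by (simp flip: mult.assoc power_add)
  qed
  then show ?thesis
    using M by (simp add: hom_peval_def peval_def sum_distrib_left mult.left_commute)
qed

lemma (in comm_ring_hom) hom_hom_peval:
  "M \<in> carrier_mat d d \<Longrightarrow> hom (hom_peval d h u M p) = hom_peval d (\<lambda>c. hom (h c)) (hom u) (map_mat hom M) p"
  by (simp add: hom_peval_def hom_sum hom_mult hom_power hom_prod)

text \<open>Consider a family of matrices whose entries are integer polynomials divided by one integer polynomial
  \<open>U\<close>. If \<open>p\<close> vanishes at its complex members, then \<open>U\<close> times the homogenised \<open>p\<close>, evaluated at the
  numerators, vanishes at all complex parameters, also at the zeros of \<open>U\<close>. So it is the zero
  polynomial, and \<open>p\<close> vanishes at every member over every ring.\<close>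

lemma family_in_Z_closure:
  fixes U :: "('v \<Rightarrow>\<^sub>0 nat) \<Rightarrow>\<^sub>0 int" and MU :: "(('v \<Rightarrow>\<^sub>0 nat) \<Rightarrow>\<^sub>0 int) mat"
    and M :: "'r::comm_ring_1 mat" and a :: "'v \<Rightarrow> 'r"
  assumes MU: "MU \<in> carrier_mat d d" and M: "M \<in> carrier (GL d)"
    and unit: "mpoly_eval of_int a U * u' = 1"
    and eq: "mpoly_eval of_int a U \<cdot>\<^sub>m M = map_mat (mpoly_eval of_int a) MU"
    and S: "\<And>c :: 'v \<Rightarrow> complex. mpoly_eval of_int c U \<noteq> 0 \<Longrightarrow>
       \<exists>A\<in>S. A \<in> carrier_mat d d \<and> mpoly_eval of_int c U \<cdot>\<^sub>m A = map_mat (mpoly_eval of_int c) MU"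
  shows "M \<in> Z_closure d S"
  unfolding Z_closure_def
proof (intro CollectI conjI M allI impI)
  fix p :: "int entry_poly" assume p: "\<forall>A\<in>S. peval of_int A p = 0"
  let ?P = "U * hom_peval d of_int U MU p"
  have ev: "mpoly_eval of_int c ?P = mpoly_eval of_int c U *
      hom_peval d of_int (mpoly_eval of_int c U) (map_mat (mpoly_eval of_int c) MU) p" for c :: "'v \<Rightarrow> 's::comm_ring_1"
  proof -
    interpret comm_ring_hom "mpoly_eval of_int c" by (intro comm_ring_hom_mpoly_eval comm_ring_hom_of_int)
    show ?thesis by (simp add: hom_mult hom_hom_peval[OF MU] hom_of_int)
  qed
  have "?P = 0"
  proof (rule int_mpoly_eq_0I)
    fix c :: "'v \<Rightarrow> complex"
    show "mpoly_eval of_int c ?P = 0"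
    proof (cases "mpoly_eval of_int c U = 0")
      case True
      then show ?thesis by (simp add: ev)
    next
      case False
      then obtain A where "A \<in> S" "A \<in> carrier_mat d d"
        "mpoly_eval of_int c U \<cdot>\<^sub>m A = map_mat (mpoly_eval of_int c) MU" using S by blast
      then show ?thesis using p by (simp add: ev hom_peval_smult flip: \<open>_ \<cdot>\<^sub>m A = _\<close>)
    qed
  qed
  then have "mpoly_eval of_int a U * hom_peval d of_int (mpoly_eval of_int a U) (mpoly_eval of_int a U \<cdot>\<^sub>m M) p = 0"
    using ev[of a] by (simp only: eq) (simp add: mpoly_eval_def[of _ _ 0])
  then have "mpoly_eval of_int a U ^ Suc (deg_bound d p) * peval of_int M p = 0"
    by (simp add: hom_peval_smult[OF GL_carrier[OF M]] mult.assoc)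
  then have "u' ^ Suc (deg_bound d p) * (mpoly_eval of_int a U ^ Suc (deg_bound d p) * peval of_int M p) = 0"
    by simp
  moreover have "u' ^ Suc (deg_bound d p) * mpoly_eval of_int a U ^ Suc (deg_bound d p) = 1"
    using unit by (metis mult.commute power_mult_distrib power_one)
  ultimately show "peval of_int M p = 0" by (simp flip: mult.assoc)
qed

section \<open>Equations for a closure\<close>

definition entry_var :: "nat \<Rightarrow> nat \<Rightarrow> int entry_poly" where
  "entry_var i j = Poly_Mapping.single (Poly_Mapping.single (i, j) 1) 1"

lemma peval_entry_var:
  "M \<in> carrier_mat d d \<Longrightarrow> i < d \<Longrightarrow> j < d \<Longrightarrow> peval of_int M (entry_var i j) = M $$ (i, j)"
  by (simp add: entry_var_def peval_eq_mpoly_eval mpoly_eval_single entry_assign_def)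

lemma Z_closure_mono: "S \<subseteq> T \<Longrightarrow> Z_closure d S \<subseteq> Z_closure d T"
  by (auto simp: Z_closure_def)

lemma Z_closure_GL: "M \<in> Z_closure d S \<Longrightarrow> M \<in> carrier (GL d)"
  by (simp add: Z_closure_def)

lemma Z_closure_entry:
  assumes M: "M \<in> Z_closure d S" and S: "S \<subseteq> carrier_mat d d" "\<And>A. A \<in> S \<Longrightarrow> A $$ (i, j) = of_int c"
    and ij: "i < d" "j < d"
  shows "(M :: 'r::comm_ring_1 mat) $$ (i, j) = of_int c"
proof -
  have ev: "peval of_int A (entry_var i j - of_int c) = A $$ (i, j) - of_int c"
    if "A \<in> carrier_mat d d" for A :: "'s::comm_ring_1 mat"
  proof -
    interpret comm_ring_hom "peval of_int A" by (intro comm_ring_hom_peval comm_ring_hom_of_int)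
    show ?thesis using that ij by (simp add: hom_minus hom_of_int peval_entry_var)
  qed
  have "\<forall>A\<in>S. peval of_int A (entry_var i j - of_int c) = 0"
  proof
    fix A assume "A \<in> S"
    then show "peval of_int A (entry_var i j - of_int c) = 0" using S ev[of A] by auto
  qed
  then have "peval of_int M (entry_var i j - of_int c) = 0"
    using M unfolding Z_closure_def by blast
  then show ?thesis using ev[OF GL_carrier[OF Z_closure_GL[OF M]]] by simp
qed

section \<open>A polynomial parametrisation of the automorphism group\<close>

text \<open>Needed to clear the denominator \<open>det A\<close> of the inverse matrix in a symmetric power.\<close>

lemma sym_coeff_smult:
  fixes A :: "'r::comm_ring_1 mat"
  assumes A: "A \<in> carrier_mat n n"
  shows "e \<in> expos n k \<Longrightarrow> f \<in> expos n k \<Longrightarrow> sym_coeff (u \<cdot>\<^sub>m A) e f = u ^ k * sym_coeff A e f"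
proof (induction k arbitrary: e f)
  case 0
  then show ?case using A by (simp add: sym_coeff_0[of _ n])
next
  case (Suc k)
  then obtain i e' where e: "i < n" "e' \<in> expos n k" "e = inc i e'"
    using expos_Suc_ex_inc by blast
  note len = expos_length[OF e(2)] expos_length[OF Suc.prems(2)]
  have "shift_coeff (u \<cdot>\<^sub>m A) j e' f = u ^ k * shift_coeff A j e' f" if "j < n" for j
    using Suc.IH[OF e(2) expos_dec[OF Suc.prems(2) that]] by (simp add: shift_coeff_def)
  then show ?case
    using A e len by (simp add: sym_coeff_inc[of _ n] sum_distrib_left ac_simps)
qed

lemma (in comm_ring_hom) hom_adj_mat:
  assumes "A \<in> carrier_mat n n"
  shows "map_mat hom (adj_mat A) = adj_mat (map_mat hom A)"
proof -
  have "hom (cofactor A j i) = cofactor (map_mat hom A) j i" if "i < n" "j < n" for i j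
  proof -
    have "mat_delete (map_mat hom A) j i = map_mat hom (mat_delete A j i)"
      using assms that by (intro eq_matI) (auto simp: mat_delete_def)
    then show ?thesis by (simp add: cofactor_def hom_mult hom_power hom_uminus hom_det)
  qed
  then show ?thesis using assms by (intro eq_matI) (auto simp: adj_mat_def)
qed

lemma one_smult: "(1 :: 'r::comm_ring_1) \<cdot>\<^sub>m M = M"
  by (rule eq_matI) auto

lemma adj_inverse:
  fixes A :: "'r::comm_ring_1 mat"
  assumes A: "A \<in> carrier_mat n n" and u: "det A * u = 1"
  shows "A \<in> carrier (GL n)" "inv\<^bsub>GL n\<^esub> A = u \<cdot>\<^sub>m adj_mat A"
proof -
  have c: "adj_mat A \<in> carrier_mat n n" using adj_mat[OF A] by simp
  have "A * (u \<cdot>\<^sub>m adj_mat A) = u \<cdot>\<^sub>m (A * adj_mat A)" using A c by (rule mult_smult_distrib)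
  also have "\<dots> = 1\<^sub>m n" using adj_mat(2)[OF A] u by (auto simp: mult.commute intro!: eq_matI)
  finally have 1: "A * (u \<cdot>\<^sub>m adj_mat A) = 1\<^sub>m n" .
  have "(u \<cdot>\<^sub>m adj_mat A) * A = u \<cdot>\<^sub>m (adj_mat A * A)" using c A by (rule mult_smult_assoc_mat)
  also have "\<dots> = 1\<^sub>m n" using adj_mat(3)[OF A] u by (auto simp: mult.commute intro!: eq_matI)
  finally have 2: "(u \<cdot>\<^sub>m adj_mat A) * A = 1\<^sub>m n" .
  show "A \<in> carrier (GL n)" "inv\<^bsub>GL n\<^esub> A = u \<cdot>\<^sub>m adj_mat A"
    using A c 1 2 by (auto simp: GL_iff intro!: GL_inv_eqI bexI[of _ "u \<cdot>\<^sub>m adj_mat A"])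
qed

lemma GL_det_unit:
  fixes A :: "'r::comm_ring_1 mat"
  assumes "A \<in> carrier (GL n)"
  shows "det A * det (inv\<^bsub>GL n\<^esub> A) = 1"
  using det_mult[OF GL_carrier[OF assms] GL_inv(2)[OF assms]] GL_inv(3)[OF assms] by simp

context lie_lattice
begin

text \<open>With \<open>m\<close> factors \<open>det A\<close> and \<open>l\<close>, the denominator suffices for the \<open>x\<close>-block, which is homogeneous of
  degree \<open>m - 1\<close> in the inverse of \<open>A\<close>, and for the single factor \<open>1 / l\<close> in the \<open>y\<close>-block.\<close>

definition denom :: "'r::comm_ring_1 mat \<Rightarrow> 'r \<Rightarrow> 'r" where
  "denom A l = (l * det A) ^ m"

definition numer :: "'r::comm_ring_1 mat \<Rightarrow> 'r \<Rightarrow> 'r mat" where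
  "numer A l = mat_of (blk (\<lambda>e e'. (l ^ Suc m * det A) * sym_coeff (transpose_mat (adj_mat A)) e e')
     (\<lambda>_ _. 0) (\<lambda>_ _. 0) (\<lambda>f f'. (l ^ (m - 1) * det A ^ m) * sym_coeff (transpose_mat A) f' f) (\<lambda>_ _. 0)
     (\<lambda>i j. denom A l * A $$ (i, j)))"

lemma numer_carrier [simp]: "numer A l \<in> carrier_mat d d"
  by (simp add: numer_def)

lemma mat_of_smult: "u \<cdot>\<^sub>m mat_of (blk p c d1 q d2 s) = mat_of (blk (\<lambda>e e'. u * p e e') (\<lambda>e f. u * c e f)
   (\<lambda>e i. u * d1 e i) (\<lambda>f f'. u * q f f') (\<lambda>f i. u * d2 f i) (\<lambda>i j. (u :: 'r::comm_ring_1) * s i j))"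
proof -
  have "u \<cdot>\<^sub>m mat_of (blk p c d1 q d2 s) = map_mat ((*) u) (mat_of (blk p c d1 q d2 s))"
    by (rule eq_matI) auto
  then show ?thesis by (simp add: map_mat_of_blk)
qed

lemma denom_Hmat:
  fixes A :: "'r::comm_ring_1 mat"
  assumes A: "A \<in> carrier (GL n)" and l: "l * l' = 1"
  shows "denom A l \<cdot>\<^sub>m Hmat A (inv\<^bsub>GL n\<^esub> A) l l' = numer A l"
proof -
  note c = GL_carrier[OF A]
  let ?u = "det (inv\<^bsub>GL n\<^esub> A)"
  have u: "det A * ?u = 1" using A by (rule GL_det_unit)
  have inv: "inv\<^bsub>GL n\<^esub> A = ?u \<cdot>\<^sub>m adj_mat A" using c u by (rule adj_inverse)
  have t: "transpose_mat (adj_mat A) \<in> carrier_mat n n" using adj_mat(1)[OF c] by simp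
  have tr: "transpose_mat (?u \<cdot>\<^sub>m adj_mat A) = ?u \<cdot>\<^sub>m transpose_mat (adj_mat A)"
    by (rule eq_matI) auto
  obtain k where k: "m = Suc k" using m by (cases m) auto
  have "det A ^ m * ?u ^ (m - 1) = det A * (det A * ?u) ^ (m - 1)"
    by (simp add: k power_mult_distrib mult.assoc)
  then have pu: "det A ^ m * ?u ^ (m - 1) = det A" by (simp add: u)
  have XX: "denom A l * (l * sym_coeff (transpose_mat (inv\<^bsub>GL n\<^esub> A)) e e') =
      (l ^ Suc m * det A) * sym_coeff (transpose_mat (adj_mat A)) e e'" if "e \<in> E" "e' \<in> E" for e e'
  proof -
    have "sym_coeff (transpose_mat (inv\<^bsub>GL n\<^esub> A)) e e' = ?u ^ (m - 1) * sym_coeff (transpose_mat (adj_mat A)) e e'"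
      unfolding trans[OF arg_cong[OF inv, of transpose_mat] tr] by (rule sym_coeff_smult[OF t that[unfolded E_def]])
    then have "denom A l * (l * sym_coeff (transpose_mat (inv\<^bsub>GL n\<^esub> A)) e e') =
      l ^ Suc m * (det A ^ m * ?u ^ (m - 1)) * sym_coeff (transpose_mat (adj_mat A)) e e'"
      by (simp only: denom_def power_mult_distrib power_Suc ac_simps)
    then show ?thesis by (simp only: pu)
  qed
  have "l ^ m * l' = l ^ (m - 1)"
    using l by (simp add: k mult.commute[of l] mult.assoc)
  moreover have "denom A l * (l' * x) = ((l ^ m * l') * det A ^ m) * x" for x
    by (simp add: denom_def power_mult_distrib ac_simps)
  ultimately have YY: "denom A l * (l' * x) = (l ^ (m - 1) * det A ^ m) * x" for x
    by simp
  show ?thesis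
    unfolding Hmat_def mat_of_smult numer_def
    by (rule mat_of_cong, unfold B_eq) (use XX YY in auto)
qed

lemma numer_natural:
  fixes h :: "'r::comm_ring_1 \<Rightarrow> 's::comm_ring_1"
  assumes h: "comm_ring_hom h" and A: "A \<in> carrier_mat n n"
  shows "map_mat h (numer A l) = numer (map_mat h A) (h l)" "h (denom A l) = denom (map_mat h A) (h l)"
proof -
  interpret h: comm_ring_hom h by fact
  have t: "transpose_mat A \<in> carrier_mat n n" "transpose_mat (adj_mat A) \<in> carrier_mat n n"
    using A adj_mat(1)[OF A] by simp_all
  have tm: "map_mat h (transpose_mat A) = transpose_mat (map_mat h A)"
    "map_mat h (transpose_mat (adj_mat A)) = transpose_mat (adj_mat (map_mat h A))"
    by (simp_all add: map_mat_transpose[symmetric] h.hom_adj_mat[OF A])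
  show den: "h (denom A l) = denom (map_mat h A) (h l)"
    by (simp add: denom_def h.hom_power h.hom_mult h.hom_det)
  have "h (sym_coeff (transpose_mat (adj_mat A)) e e') = sym_coeff (transpose_mat (adj_mat (map_mat h A))) e e'" if "e \<in> E" "e' \<in> E" for e e'
    using h.sym_coeff_hom[OF t(2) that[unfolded E_def]] by (simp add: tm)
  moreover have "h (sym_coeff (transpose_mat A) f' f) = sym_coeff (transpose_mat (map_mat h A)) f' f" if "f \<in> F" "f' \<in> F" for f f'
    using h.sym_coeff_hom[OF t(1) that(2,1)] by (simp add: tm)
  ultimately show "map_mat h (numer A l) = numer (map_mat h A) (h l)"
    unfolding numer_def map_mat_of_blk[of h, OF h.hom_zero] using A
    by (intro mat_of_cong, unfold B_eq) (auto simp: h.hom_mult h.hom_power h.hom_det den)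
qed

lemma Nmat_natural:
  fixes h :: "'r::comm_ring_1 \<Rightarrow> 's::comm_ring_1"
  assumes h: "comm_ring_hom h"
  shows "map_mat h (Nmat b d1 d2) = Nmat (\<lambda>g. h (b g)) (\<lambda>e i. h (d1 e i)) (\<lambda>f i. h (d2 f i))"
proof -
  interpret h: comm_ring_hom h by fact
  show ?thesis
    unfolding Nmat_def map_mat_of_blk[of h, OF h.hom_zero]
    by (rule mat_of_cong, unfold B_eq) auto
qed

text \<open>The coordinates of the parameter space: the entries of \<open>A\<close>, the scalar, the \<open>b\<^sub>g\<close>, and the entries of
  the two blocks that map to the \<open>z\<^sub>i\<close>.\<close>

datatype param = PA nat nat | PL | PB "nat list" | PX "nat list" nat | PY "nat list" nat

definition param_mat :: "(param \<Rightarrow> 'r) \<Rightarrow> 'r mat" where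
  "param_mat a = mat n n (\<lambda>(i, j). a (PA i j))"

lemma param_mat_carrier [simp]: "param_mat a \<in> carrier_mat n n"
  by (simp add: param_mat_def)

definition N_family :: "(param \<Rightarrow> 'r::comm_ring_1) \<Rightarrow> 'r mat" where
  "N_family a = Nmat (\<lambda>g. a (PB g)) (\<lambda>e i. a (PX e i)) (\<lambda>f i. a (PY f i))"

definition H_denom :: "(param \<Rightarrow> 'r::comm_ring_1) \<Rightarrow> 'r" where
  "H_denom a = denom (param_mat a) (a PL)"

definition H_numer :: "(param \<Rightarrow> 'r::comm_ring_1) \<Rightarrow> 'r mat" where
  "H_numer a = numer (param_mat a) (a PL)"

lemma family_carrier [simp]: "N_family a \<in> carrier_mat d d" "H_numer a \<in> carrier_mat d d"
  by (simp_all add: N_family_def H_numer_def)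

lemma family_natural:
  fixes h :: "'r::comm_ring_1 \<Rightarrow> 's::comm_ring_1"
  assumes h: "comm_ring_hom h"
  shows "map_mat h (N_family a) = N_family (\<lambda>v. h (a v))" "map_mat h (H_numer a) = H_numer (\<lambda>v. h (a v))"
    "h (H_denom a) = H_denom (\<lambda>v. h (a v))"
    "map_mat h (N_family a * H_numer a) = N_family (\<lambda>v. h (a v)) * H_numer (\<lambda>v. h (a v))"
proof -
  interpret h: comm_ring_hom h by fact
  have "map_mat h (param_mat a) = param_mat (\<lambda>v. h (a v))" by (rule eq_matI) (auto simp: param_mat_def)
  then show 1: "map_mat h (N_family a) = N_family (\<lambda>v. h (a v))" "map_mat h (H_numer a) = H_numer (\<lambda>v. h (a v))"
    "h (H_denom a) = H_denom (\<lambda>v. h (a v))"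
    by (simp_all add: N_family_def H_numer_def H_denom_def Nmat_natural[OF h] numer_natural[OF h])
  then show "map_mat h (N_family a * H_numer a) = N_family (\<lambda>v. h (a v)) * H_numer (\<lambda>v. h (a v))"
    using h.mat_hom_mult[of "N_family a" d d "H_numer a" d] by simp
qed

lemma H_family_field:
  fixes a :: "param \<Rightarrow> 'k::field"
  assumes "H_denom a \<noteq> 0"
  obtains M where "M \<in> H_pts m n" "M \<in> carrier_mat d d" "H_denom a \<cdot>\<^sub>m M = H_numer a"
proof
  let ?A = "param_mat a" and ?l = "a PL"
  have nz: "?l \<noteq> 0" "det ?A \<noteq> 0" using assms m by (auto simp: H_denom_def denom_def)
  then have A: "?A \<in> carrier (GL n)" using adj_inverse(1)[of ?A n "1 / det ?A"] by simp
  have l: "?l * (1 / ?l) = 1" using nz by simp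
  show "Hmat ?A (inv\<^bsub>GL n\<^esub> ?A) ?l (1 / ?l) \<in> H_pts m n" using A l unfolding H_pts_eq by blast
  show "H_denom a \<cdot>\<^sub>m Hmat ?A (inv\<^bsub>GL n\<^esub> ?A) ?l (1 / ?l) = H_numer a"
    unfolding H_denom_def H_numer_def by (rule denom_Hmat[OF A l])
qed simp

lemma H_family_surj:
  fixes M :: "'r::comm_ring_1 mat"
  assumes "M \<in> H_pts m n"
  obtains A l u' where "A \<in> carrier_mat n n" "denom A l * u' = 1" "denom A l \<cdot>\<^sub>m M = numer A l"
proof -
  obtain A l l' where A: "A \<in> carrier (GL n)" and l: "l * l' = 1" and M: "M = Hmat A (inv\<^bsub>GL n\<^esub> A) l l'"
    using assms by (auto simp: H_pts_eq)
  have "denom A l * (l' * det (inv\<^bsub>GL n\<^esub> A)) ^ m = ((l * l') * (det A * det (inv\<^bsub>GL n\<^esub> A))) ^ m"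
    by (simp only: denom_def power_mult_distrib[symmetric] ac_simps)
  then have "denom A l * (l' * det (inv\<^bsub>GL n\<^esub> A)) ^ m = 1" by (simp add: l GL_det_unit[OF A])
  then show thesis using that GL_carrier[OF A] denom_Hmat[OF A l] M by blast
qed

lemma H_pts_param:
  fixes M :: "'r::comm_ring_1 mat"
  assumes "M \<in> H_pts m n"
  obtains a u' where "H_denom a * u' = 1" "H_denom a \<cdot>\<^sub>m M = H_numer a"
proof -
  obtain A l u' where A: "A \<in> carrier_mat n n" and u': "denom A l * u' = 1" "denom A l \<cdot>\<^sub>m M = numer A l"
    using assms by (rule H_family_surj)
  define a where "a v = (case v of PA i j \<Rightarrow> A $$ (i, j) | _ \<Rightarrow> l)" for v
  have pA: "param_mat a = A" using A by (intro eq_matI) (auto simp: param_mat_def a_def)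
  have "H_numer a = numer A l" "H_denom a = denom A l"
    by (simp_all add: H_numer_def H_denom_def pA) (simp_all add: a_def)
  then show thesis using that[of a u'] u' by simp
qed

lemma N_pts_param:
  fixes M :: "'r::comm_ring_1 mat"
  assumes "M \<in> N_pts m n"
  obtains a where "N_family a = M"
proof -
  obtain b d1 d2 where M: "M = Nmat b d1 d2" using assms by (auto simp: N_pts_eq)
  have "N_family (\<lambda>v. case v of PB g \<Rightarrow> b g | PX e i \<Rightarrow> d1 e i | PY f i \<Rightarrow> d2 f i | _ \<Rightarrow> 0) = M"
    by (simp add: N_family_def M)
  then show thesis by (rule that)
qed

lemma N_family_pts: "N_family a \<in> N_pts m n"
  by (auto simp: N_family_def N_pts_eq)

lemma N_times_Aut: "K \<in> N_pts m n \<Longrightarrow> M \<in> Aut_pts m n \<Longrightarrow> K * (M :: 'r::comm_ring_1 mat) \<in> Aut_pts m n"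
  using subgroup.m_closed[OF subgroup_Aut, of K M] N_subset_Aut by (metis GL_mult subsetD)

section \<open>The three groups are closed subschemes\<close>

text \<open>The generic parameters; every assignment of values in a ring is a specialisation of them.\<close>

definition generic :: "param \<Rightarrow> ((param \<Rightarrow>\<^sub>0 nat) \<Rightarrow>\<^sub>0 int)" where
  "generic v = Poly_Mapping.single (Poly_Mapping.single v 1) 1"

lemma mpoly_eval_generic [simp]: "mpoly_eval of_int a (generic v) = a v"
  by (simp add: generic_def mpoly_eval_single)

lemma comm_ring_hom_eval: "comm_ring_hom (mpoly_eval of_int (a :: 'v \<Rightarrow> 'r::comm_ring_1))"
  by (intro comm_ring_hom_mpoly_eval comm_ring_hom_of_int)

lemma Aut_in_GL: "M \<in> Aut_pts m n \<Longrightarrow> M \<in> carrier (GL d :: 'r::comm_ring_1 mat monoid)"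
  by (simp add: Aut_pts_iff)

lemma Aut_subset_closure: "(Aut_pts m n :: 'r::comm_ring_1 mat set) \<subseteq> Z_closure d (Aut_pts m n)"
proof
  fix M :: "'r mat" assume M: "M \<in> Aut_pts m n"
  obtain K A0 l0 l0' where K: "K \<in> N_pts m n" and A0: "A0 \<in> carrier (GL n)" "l0 * l0' = 1"
    and MK: "M = K * Hmat A0 (inv\<^bsub>GL n\<^esub> A0) l0 l0'"
    by (rule Aut_decompose[OF M])
  have "Hmat A0 (inv\<^bsub>GL n\<^esub> A0) l0 l0' \<in> H_pts m n" using A0 unfolding H_pts_eq by blast
  then obtain aH u' where aH: "H_denom aH * u' = 1" "H_denom aH \<cdot>\<^sub>m Hmat A0 (inv\<^bsub>GL n\<^esub> A0) l0 l0' = H_numer aH"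
    by (rule H_pts_param)
  obtain aN where aN: "N_family aN = K" using K by (rule N_pts_param)
  define a where "a v = (case v of PA i j \<Rightarrow> aH v | PL \<Rightarrow> aH v | _ \<Rightarrow> aN v)" for v
  have fam: "N_family a = K" "H_numer a = H_numer aH" "H_denom a = H_denom aH"
    unfolding aN[symmetric] by (simp_all add: N_family_def H_numer_def H_denom_def param_mat_def a_def)
  have cK: "K \<in> carrier_mat d d" unfolding aN[symmetric] by simp
  show "M \<in> Z_closure d (Aut_pts m n)"
  proof (rule family_in_Z_closure[where U = "H_denom generic" and MU = "N_family generic * H_numer generic" and a = a and u' = u'])
    show "N_family generic * H_numer generic \<in> carrier_mat d d"
      by (rule mult_carrier_mat[OF family_carrier])
    show "M \<in> carrier (GL d)" using M by (rule Aut_in_GL)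
    show "mpoly_eval of_int a (H_denom generic) * u' = 1"
      by (simp add: family_natural(3)[OF comm_ring_hom_eval] fam aH)
    have "H_denom aH \<cdot>\<^sub>m M = K * (H_denom aH \<cdot>\<^sub>m Hmat A0 (inv\<^bsub>GL n\<^esub> A0) l0 l0')"
      unfolding MK by (rule mult_smult_distrib[symmetric, OF cK Hmat_carrier])
    then show "mpoly_eval of_int a (H_denom generic) \<cdot>\<^sub>m M = map_mat (mpoly_eval of_int a) (N_family generic * H_numer generic)"
      by (simp add: family_natural(3,4)[OF comm_ring_hom_eval] fam aH)
  next
    fix c :: "param \<Rightarrow> complex"
    assume "mpoly_eval of_int c (H_denom generic) \<noteq> 0"
    then have nz: "H_denom c \<noteq> 0" by (simp add: family_natural(3)[OF comm_ring_hom_eval])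
    obtain H where H: "H \<in> H_pts m n" "H \<in> carrier_mat d d" "H_denom c \<cdot>\<^sub>m H = H_numer c"
      using nz by (rule H_family_field)
    have "N_family c * H \<in> Aut_pts m n" using H H_pts_subset_Aut N_times_Aut[OF N_family_pts] by blast
    moreover have "H_denom c \<cdot>\<^sub>m (N_family c * H) = N_family c * H_numer c"
      unfolding H(3)[symmetric] by (rule mult_smult_distrib[symmetric, OF family_carrier(1) H(2)])
    ultimately show "\<exists>A\<in>Aut_pts m n. A \<in> carrier_mat d d \<and> mpoly_eval of_int c (H_denom generic) \<cdot>\<^sub>m A =
        map_mat (mpoly_eval of_int c) (N_family generic * H_numer generic)"
      using H(2) by (intro bexI[of _ "N_family c * H"])
        (simp_all add: family_natural(3,4)[OF comm_ring_hom_eval] mult_carrier_mat[of _ d d _ d])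
  qed
qed

lemma H_subset_closure: "(H_pts m n :: 'r::comm_ring_1 mat set) \<subseteq> Z_closure d (H_pts m n)"
proof
  fix M :: "'r mat" assume M: "M \<in> H_pts m n"
  then obtain a u' where u': "H_denom a * u' = 1" and num: "H_denom a \<cdot>\<^sub>m M = H_numer a"
    by (rule H_pts_param)
  show "M \<in> Z_closure d (H_pts m n)"
  proof (rule family_in_Z_closure[where U = "H_denom generic" and MU = "H_numer generic" and a = a and u' = u'])
    show "M \<in> carrier (GL d)" using M H_pts_subset_Aut Aut_in_GL by blast
    show "mpoly_eval of_int a (H_denom generic) * u' = 1"
      by (simp add: family_natural(3)[OF comm_ring_hom_eval] u')
    show "mpoly_eval of_int a (H_denom generic) \<cdot>\<^sub>m M = map_mat (mpoly_eval of_int a) (H_numer generic)"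
      by (simp add: family_natural(2,3)[OF comm_ring_hom_eval] num)
  next
    fix c :: "param \<Rightarrow> complex"
    assume "mpoly_eval of_int c (H_denom generic) \<noteq> 0"
    then have nz: "H_denom c \<noteq> 0" by (simp add: family_natural(3)[OF comm_ring_hom_eval])
    then show "\<exists>A\<in>H_pts m n. A \<in> carrier_mat d d \<and> mpoly_eval of_int c (H_denom generic) \<cdot>\<^sub>m A =
        map_mat (mpoly_eval of_int c) (H_numer generic)"
      by (rule H_family_field) (auto simp: family_natural(2,3)[OF comm_ring_hom_eval])
  qed simp
qed

lemma N_subset_closure: "(N_pts m n :: 'r::comm_ring_1 mat set) \<subseteq> Z_closure d (N_pts m n)"
proof
  fix M :: "'r mat" assume M: "M \<in> N_pts m n"
  obtain a where fam: "N_family a = M" using M by (rule N_pts_param)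
  have one: "mpoly_eval of_int c 1 = 1" for c :: "param \<Rightarrow> 's::comm_ring_1"
  proof -
    interpret comm_ring_hom "mpoly_eval of_int c" by (rule comm_ring_hom_eval)
    show ?thesis by (rule hom_one)
  qed
  show "M \<in> Z_closure d (N_pts m n)"
  proof (rule family_in_Z_closure[where U = 1 and MU = "N_family generic" and a = a and u' = 1])
    show "M \<in> carrier (GL d)" using M N_subset_Aut Aut_in_GL by blast
    show "mpoly_eval of_int a 1 \<cdot>\<^sub>m M = map_mat (mpoly_eval of_int a) (N_family generic)"
      by (simp add: family_natural(1)[OF comm_ring_hom_eval] fam one one_smult)
  next
    fix c :: "param \<Rightarrow> complex"
    show "\<exists>A\<in>N_pts m n. A \<in> carrier_mat d d \<and> mpoly_eval of_int c 1 \<cdot>\<^sub>m A =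
        map_mat (mpoly_eval of_int c) (N_family generic)"
      by (intro bexI[of _ "N_family c"]) 
         (simp_all add: family_natural(1)[OF comm_ring_hom_eval] one one_smult N_family_pts)
  qed (simp_all add: one)
qed

text \<open>The bracket conditions are integer polynomials in the entries.\<close>

lemma closure_subset_Aut: "Z_closure d (Aut_pts m n) \<subseteq> (Aut_pts m n :: 'r::comm_ring_1 mat set)"
proof
  fix M :: "'r mat" assume M: "M \<in> Z_closure d (Aut_pts m n)"
  let ?l = "\<lambda>i j k. of_int (lie_coeff (basis m n ! i) (basis m n ! j) (basis m n ! k)) :: int entry_poly"
  let ?p = "\<lambda>i j k. (\<Sum>x<d. ?l i j x * entry_var x k) - (\<Sum>x<d. \<Sum>y<d. entry_var i x * entry_var j y * ?l x y k)"
  have ev: "peval of_int A (?p i j k) =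
     (\<Sum>x<d. lie (basis m n ! i) (basis m n ! j) (basis m n ! x) * A $$ (x, k)) -
     (\<Sum>x<d. \<Sum>y<d. A $$ (i, x) * A $$ (j, y) * lie (basis m n ! x) (basis m n ! y) (basis m n ! k))"
    if "A \<in> carrier_mat d d" "i < d" "j < d" "k < d" for A :: "'s::comm_ring_1 mat" and i j k
  proof -
    interpret comm_ring_hom "peval of_int A" by (intro comm_ring_hom_peval comm_ring_hom_of_int)
    show ?thesis
      using that by (simp add: hom_minus hom_sum hom_mult hom_of_int peval_entry_var[OF that(1)])
  qed
  have GL: "M \<in> carrier (GL d)" using M by (rule Z_closure_GL)
  have "preserves M"
    unfolding preserves_index
  proof (intro allI impI)
    fix i j k assume ijk: "i < d" "j < d" "k < d"
    have "\<forall>A\<in>Aut_pts m n. peval complex_of_int A (?p i j k) = 0"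
    proof
      fix A :: "complex mat" assume "A \<in> Aut_pts m n"
      then have "A \<in> carrier_mat d d" "preserves A" by (auto simp: Aut_pts_iff GL_carrier)
      then show "peval complex_of_int A (?p i j k) = 0"
        using ijk unfolding preserves_index by (simp only: ev) simp
    qed
    then have "peval of_int M (?p i j k) = 0" using M unfolding Z_closure_def by blast
    then show "(\<Sum>x<d. lie (basis m n ! i) (basis m n ! j) (basis m n ! x) * M $$ (x, k)) =
     (\<Sum>x<d. \<Sum>y<d. M $$ (i, x) * M $$ (j, y) * lie (basis m n ! x) (basis m n ! y) (basis m n ! k))"
      using ijk by (simp only: ev[OF GL_carrier[OF GL]]) simp
  qed
  with GL show "M \<in> Aut_pts m n" by (simp add: Aut_pts_iff)
qed

lemma closure_ent:
  assumes M: "(M :: 'r::comm_ring_1 mat) \<in> Z_closure d S" and S: "S \<subseteq> Aut_pts m n"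
    and ab: "x \<in> B" "y \<in> B" and c: "\<And>A. A \<in> S \<Longrightarrow> ent A x y = of_int c"
  shows "ent M x y = of_int c"
  unfolding ent_def
  using S c ab pos_less by (intro Z_closure_entry[OF M]) (auto simp: ent_def Aut_pts_iff GL_carrier dest!: subsetD)

lemma closure_subset_N: "Z_closure d (N_pts m n) \<subseteq> (N_pts m n :: 'r::comm_ring_1 mat set)"
proof
  fix M :: "'r mat" assume M: "M \<in> Z_closure d (N_pts m n)"
  then have A: "M \<in> Aut_pts m n"
    using closure_subset_Aut Z_closure_mono[OF N_subset_Aut] by blast
  have u: "unitriang A" if "A \<in> N_pts m n" for A :: "complex mat" using that by (simp add: N_pts_iff)
  have delta: "ent M x y = (if x = y then 1 else 0)"
    if "x \<in> B" "y \<in> B" "\<And>A :: complex mat. A \<in> N_pts m n \<Longrightarrow> ent A x y = (if x = y then 1 else 0)" for x y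
    using closure_ent[OF M N_subset_Aut that(1,2), of "if x = y then 1 else 0"] that(3) by auto
  have "unitriang M"
    unfolding unitriang_def using triang_Aut[OF A] unitriangD(2-4)[OF u]
    by (auto simp: delta)
  then show "M \<in> N_pts m n" using A by (simp add: N_pts_iff)
qed

text \<open>This describes \<open>H\<close> inside the automorphism group by integer equations: the unipotent part of a block
  diagonal automorphism is a quotient of block diagonal matrices, so it is 1.\<close>

lemma block_diagonal_Aut_in_H:
  assumes M: "(M :: 'r::comm_ring_1 mat) \<in> Aut_pts m n"
    and z: "\<And>e f. e \<in> E \<Longrightarrow> f \<in> F \<Longrightarrow> ent M (X e) (Y f) = 0" "\<And>e i. e \<in> E \<Longrightarrow> i < n \<Longrightarrow> ent M (X e) (Z i) = 0"
      "\<And>f i. f \<in> F \<Longrightarrow> i < n \<Longrightarrow> ent M (Y f) (Z i) = 0"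
  shows "M \<in> H_pts m n"
proof -
  obtain K A a b where K: "K \<in> N_pts m n" and A: "A \<in> carrier (GL n)" and ab: "a * b = 1"
    and MK: "M = K * Hmat A (inv\<^bsub>GL n\<^esub> A) a b"
    by (rule Aut_decompose[OF M])
  note inv = GL_carrier[OF A] GL_inv(2-4)[OF A]
  let ?H = "Hmat A (inv\<^bsub>GL n\<^esub> A) a b" and ?H' = "Hmat (inv\<^bsub>GL n\<^esub> A) A b a"
  have HH: "?H * ?H' = 1\<^sub>m d" using inv ab by (intro Hmat_GL) auto
  have cM: "M \<in> carrier_mat d d" using M by (simp add: Aut_pts_iff GL_carrier)
  have cK: "K \<in> carrier_mat d d" and uK: "unitriang K" using K by (simp_all add: N_pts_iff Aut_pts_iff GL_carrier)
  have "M * ?H' = K * (?H * ?H')" unfolding MK using cK by (intro assoc_mult_mat[of _ d d _ d _ d]) simp_all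
  then have KM: "K = M * ?H'" using HH cK by simp
  have off: "ent K (X e) (Y f) = 0" "ent K (X e) (Z i) = 0" "ent K (Y f) (Z i) = 0"
    if "e \<in> E" "f \<in> F" "i < n" for e f i
    using that unfolding KM by (simp_all add: ent_mult[OF cM Hmat_carrier] sum_B z) (simp_all add: Hmat_def)
  have ne: "E \<noteq> {}" "F \<noteq> {}" "0 < n"
    using expos_nonempty[of n "m - 1"] expos_nonempty[of n m] n by (auto simp: E_def)
  then obtain e0 f0 where e0: "e0 \<in> E" "f0 \<in> F" by blast
  have low: "\<And>e f. e \<in> E \<Longrightarrow> f \<in> F \<Longrightarrow> ent K (Y f) (X e) = 0" "\<And>e i. e \<in> E \<Longrightarrow> i < n \<Longrightarrow> ent K (Z i) (X e) = 0"
      "\<And>f i. f \<in> F \<Longrightarrow> i < n \<Longrightarrow> ent K (Z i) (Y f) = 0"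
    using unitriangD(1)[OF uK] by (simp_all add: triang_def)
  have "ent K x y = ent (1\<^sub>m d) x y" if "x \<in> B" "y \<in> B" for x y
    unfolding ent_one[OF that]
    by (cases x; cases y; insert that) (simp_all add: off(1)[OF _ _ ne(3)] off(2)[OF _ e0(2)] off(3)[OF e0(1)] low unitriangD(2-4)[OF uK])
  then have "K = 1\<^sub>m d" unfolding mat_eq_iff_ent[OF cK one_carrier_mat] by blast
  then have "M = ?H" using MK by (simp add: left_mult_one_mat[OF Hmat_carrier])
  then show ?thesis using A ab unfolding H_pts_eq by blast
qed

lemma closure_subset_H: "Z_closure d (H_pts m n) \<subseteq> (H_pts m n :: 'r::comm_ring_1 mat set)"
proof
  fix M :: "'r mat" assume M: "M \<in> Z_closure d (H_pts m n)"
  then have A: "M \<in> Aut_pts m n"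
    using closure_subset_Aut Z_closure_mono[OF H_pts_subset_Aut] by blast
  have zero: "ent M x y = 0" if "x \<in> B" "y \<in> B" "\<And>A :: complex mat. A \<in> H_pts m n \<Longrightarrow> ent A x y = 0" for x y
    using closure_ent[OF M H_pts_subset_Aut that(1,2), of 0] that(3) by simp
  show "M \<in> H_pts m n"
    by (rule block_diagonal_Aut_in_H[OF A]; rule zero) (auto simp: H_pts_eq Hmat_def)
qed

lemma closed_subschemes:
  "(Aut_pts m n :: 'r::comm_ring_1 mat set) = Z_closure d (Aut_pts m n)"
  "(N_pts m n :: 'r mat set) = Z_closure d (N_pts m n)"
  "(H_pts m n :: 'r mat set) = Z_closure d (H_pts m n)"
  by (intro equalityI Aut_subset_closure closure_subset_Aut N_subset_closure closure_subset_N
      H_subset_closure closure_subset_H)+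

end

section \<open>The Zariski topology\<close>

lemma comm_ring_hom_id: "comm_ring_hom (id :: 'r::comm_ring_1 \<Rightarrow> 'r)"
  by unfold_locales simp_all

lemma topspace_zariski: "topspace (zariski d) = carrier (GL d :: 'k::field mat monoid)"
proof -
  have "peval id M (1 :: 'k entry_poly) = 1" for M :: "'k mat"
  proof -
    interpret comm_ring_hom "peval id M" by (intro comm_ring_hom_peval comm_ring_hom_id)
    show ?thesis by (rule hom_one)
  qed
  then have "\<exists>p :: 'k entry_poly. peval id M p \<noteq> 0" for M :: "'k mat" by (metis zero_neq_one)
  then show ?thesis unfolding zariski_def topology_generated_by_topspace by auto
qed

lemma openin_zariski_basic: "openin (zariski d) {M \<in> carrier (GL d). peval id M (p :: 'k::field entry_poly) \<noteq> 0}"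
  unfolding zariski_def by (rule topology_generated_by_Basis) blast

text \<open>The sets in the generating family form a base, because the intersection of two of them belongs to
  the product of the polynomials.\<close>

lemma openin_zariski_ex_basic:
  fixes M :: "'k::field mat"
  assumes "openin (zariski d) V" and "M \<in> V"
  shows "\<exists>p. peval id M p \<noteq> 0 \<and> {K \<in> carrier (GL d). peval id K p \<noteq> 0} \<subseteq> V"
proof -
  have "generate_topology_on (range (\<lambda>p :: 'k entry_poly. {M \<in> carrier (GL d). peval id M p \<noteq> 0})) V"
    using assms(1) unfolding zariski_def by (rule openin_topology_generated_by)
  then show ?thesis using assms(2)
  proof (induction arbitrary: M)
    case (Int a b)
    then obtain p q where p: "peval id M p \<noteq> 0" "{K \<in> carrier (GL d). peval id K p \<noteq> 0} \<subseteq> a"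
      and q: "peval id M q \<noteq> 0" "{K \<in> carrier (GL d). peval id K q \<noteq> 0} \<subseteq> b" by blast
    have pq: "peval id K (p * q) = peval id K p * peval id K q" for K :: "'k mat"
    proof -
      interpret comm_ring_hom "peval id K" by (intro comm_ring_hom_peval comm_ring_hom_id)
      show ?thesis by (rule hom_mult)
    qed
    show ?case
    proof (intro exI[of _ "p * q"] conjI subsetI)
      show "peval id M (p * q) \<noteq> 0" unfolding pq using p q by simp
      fix K assume "K \<in> {K \<in> carrier (GL d). peval id K (p * q) \<noteq> 0}"
      then have "K \<in> carrier (GL d)" "peval id K p * peval id K q \<noteq> 0" unfolding pq by auto
      then have "K \<in> {K \<in> carrier (GL d). peval id K p \<noteq> 0}" "K \<in> {K \<in> carrier (GL d). peval id K q \<noteq> 0}" by auto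
      then show "K \<in> a \<inter> b" using p(2) q(2) by blast
    qed
  next
    case (UN K)
    then show ?case by (meson Sup_upper UnionE subset_trans)
  qed auto
qed

lemma closedin_Z_closure: "closedin (zariski d) (Z_closure d S :: 'k::field mat set)"
proof -
  let ?P = "{p :: int entry_poly. \<forall>A\<in>S. peval of_int A p = 0}"
  have "openin (zariski d) (\<Union>p\<in>?P. {M \<in> carrier (GL d). peval id M (int_mpoly p :: 'k entry_poly) \<noteq> 0})"
    by (intro openin_Union) (auto intro: openin_zariski_basic)
  moreover have "(\<Union>p\<in>?P. {M \<in> carrier (GL d). peval id M (int_mpoly p :: 'k entry_poly) \<noteq> 0}) =
    topspace (zariski d) - Z_closure d S"
    unfolding topspace_zariski peval_int_mpoly by (auto simp: Z_closure_def)
  moreover have "Z_closure d S \<subseteq> topspace (zariski d :: 'k mat topology)"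
    unfolding topspace_zariski by (auto simp: Z_closure_def)
  ultimately show ?thesis by (simp add: closedin_def)
qed

text \<open>In a finite field, 1 plus the product of all linear polynomials \<open>X - a\<close> has no root.\<close>

lemma infinite_UNIV_alg_closed: "infinite (UNIV :: 'k::alg_closed_field set)"
proof
  assume fin: "finite (UNIV :: 'k set)"
  define p where "p = (\<Prod>a\<in>(UNIV :: 'k set). [:- a, 1:]) + 1"
  have "poly p x = 1" for x
  proof -
    have "(\<Prod>a\<in>(UNIV :: 'k set). x - a) = 0" using fin by (intro prod_zero) auto
    then show ?thesis by (simp add: p_def poly_prod)
  qed
  moreover have "degree p > 0"
  proof (rule ccontr)
    let ?q = "\<Prod>a\<in>(UNIV :: 'k set). [:- a, 1:]"
    assume "\<not> degree p > 0"
    moreover have "degree ?q = card (UNIV :: 'k set)"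
      by (subst degree_prod_eq_sum_degree) auto
    moreover have "card (UNIV :: 'k set) > 0" using fin by (simp add: finite_UNIV_card_ge_0)
    ultimately show False by (simp add: p_def degree_add_eq_left)
  qed
  ultimately show False using alg_closed_imp_poly_has_root[of p] by simp
qed

lemma comm_ring_hom_poly: "comm_ring_hom (\<lambda>q :: 'k::comm_ring_1 poly. poly q t)"
  by unfold_locales simp_all

text \<open>A set is irreducible if any two of its points lie on a rational curve inside the set: on
  the curve, two functions that do not vanish identically have a common point at which neither
  of them vanishes.\<close>

lemma connectedin_zariski_curves:
  fixes S :: "'k::field mat set"
  assumes inf: "infinite (UNIV :: 'k set)" and S: "S \<subseteq> carrier (GL d)"
    and curve: "\<And>M1 M2. M1 \<in> S \<Longrightarrow> M2 \<in> S \<Longrightarrow> \<exists>u Mt. Mt \<in> carrier_mat d d \<and> poly u 0 \<noteq> 0 \<and> poly u 1 \<noteq> 0 \<and>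
      poly u 0 \<cdot>\<^sub>m M1 = map_mat (\<lambda>q. poly q 0) Mt \<and> poly u 1 \<cdot>\<^sub>m M2 = map_mat (\<lambda>q. poly q 1) Mt \<and>
      (\<forall>t. poly u t \<noteq> 0 \<longrightarrow> (\<exists>M\<in>S. poly u t \<cdot>\<^sub>m M = map_mat (\<lambda>q. poly q t) Mt))"
  shows "connectedin (zariski d) S"
  unfolding connectedin
proof (intro conjI notI)
  show "S \<subseteq> topspace (zariski d)" using S by (simp add: topspace_zariski)
  assume "\<exists>E1 E2. openin (zariski d) E1 \<and> openin (zariski d) E2 \<and> S \<subseteq> E1 \<union> E2 \<and> E1 \<inter> E2 \<inter> S = {} \<and> E1 \<inter> S \<noteq> {} \<and> E2 \<inter> S \<noteq> {}"
  then obtain E1 E2 M1 M2 where E: "openin (zariski d) E1" "openin (zariski d) E2" "E1 \<inter> E2 \<inter> S = {}"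
    and M: "M1 \<in> E1" "M1 \<in> S" "M2 \<in> E2" "M2 \<in> S" by blast
  obtain p1 where p1: "peval id M1 p1 \<noteq> 0" "{K \<in> carrier (GL d). peval id K p1 \<noteq> 0} \<subseteq> E1"
    using openin_zariski_ex_basic[OF E(1) M(1)] by blast
  obtain p2 where p2: "peval id M2 p2 \<noteq> 0" "{K \<in> carrier (GL d). peval id K p2 \<noteq> 0} \<subseteq> E2"
    using openin_zariski_ex_basic[OF E(2) M(3)] by blast
  obtain u Mt where Mt: "Mt \<in> carrier_mat d d" and u: "poly u 0 \<noteq> 0" "poly u 1 \<noteq> 0"
    and ends: "poly u 0 \<cdot>\<^sub>m M1 = map_mat (\<lambda>q. poly q 0) Mt" "poly u 1 \<cdot>\<^sub>m M2 = map_mat (\<lambda>q. poly q 1) Mt"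
    and mid: "\<And>t. poly u t \<noteq> 0 \<Longrightarrow> \<exists>M\<in>S. poly u t \<cdot>\<^sub>m M = map_mat (\<lambda>q. poly q t) Mt"
    using curve[OF M(2,4)] by blast
  define q where "q p = hom_peval d (\<lambda>c :: 'k. [:c:]) u Mt p" for p
  have q: "poly (q p) t = poly u t ^ deg_bound d p * peval id K p"
    if "K \<in> S" "poly u t \<cdot>\<^sub>m K = map_mat (\<lambda>q. poly q t) Mt" for p t K
  proof -
    have "poly (q p) t = hom_peval d id (poly u t) (poly u t \<cdot>\<^sub>m K) p"
      unfolding q_def comm_ring_hom.hom_hom_peval[OF comm_ring_hom_poly Mt] that(2) by (simp add: id_def)
    then show ?thesis using that(1) S by (simp add: hom_peval_smult subset_iff GL_carrier)
  qed
  have "poly (q p1) 0 \<noteq> 0" "poly (q p2) 1 \<noteq> 0"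
    using q[OF M(2) ends(1)] q[OF M(4) ends(2)] u p1 p2 by simp_all
  then have "u * q p1 * q p2 \<noteq> 0" using u by auto
  then have "finite {t. poly (u * q p1 * q p2) t = 0}" by (rule poly_roots_finite)
  then obtain t where t: "poly (u * q p1 * q p2) t \<noteq> 0"
    using inf by (metis (mono_tags) UNIV_I finite_subset mem_Collect_eq subsetI)
  then obtain K where K: "K \<in> S" "poly u t \<cdot>\<^sub>m K = map_mat (\<lambda>q. poly q t) Mt" using mid by auto
  have "peval id K p1 \<noteq> 0" "peval id K p2 \<noteq> 0" using t by (auto simp: q[OF K])
  then have "K \<in> E1 \<inter> E2 \<inter> S" using p1 p2 K S by blast
  then show False using E by blast
qed

context lie_lattice
begin

definition line :: "(param \<Rightarrow> 'k::comm_ring_1) \<Rightarrow> (param \<Rightarrow> 'k) \<Rightarrow> param \<Rightarrow> 'k poly" where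
  "line a1 a2 v = [:a1 v, a2 v - a1 v:]"

lemma poly_line: "(\<lambda>v. poly (line a1 a2 v) 0) = a1" "(\<lambda>v. poly (line a1 a2 v) 1) = a2"
  by (simp_all add: line_def fun_eq_iff)

lemma connectedin_N: "connectedin (zariski d) (N_pts m n :: 'k::alg_closed_field mat set)"
proof (rule connectedin_zariski_curves[OF infinite_UNIV_alg_closed])
  show "N_pts m n \<subseteq> carrier (GL d :: 'k mat monoid)" using N_subset_Aut Aut_in_GL by blast
  fix M1 M2 :: "'k mat" assume "M1 \<in> N_pts m n" "M2 \<in> N_pts m n"
  then obtain a1 a2 where a: "N_family a1 = M1" "N_family a2 = M2" by (metis N_pts_param)
  show "\<exists>u Mt. Mt \<in> carrier_mat d d \<and> poly u 0 \<noteq> 0 \<and> poly u 1 \<noteq> 0 \<and>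
      poly u 0 \<cdot>\<^sub>m M1 = map_mat (\<lambda>q. poly q 0) Mt \<and> poly u 1 \<cdot>\<^sub>m M2 = map_mat (\<lambda>q. poly q 1) Mt \<and>
      (\<forall>t. poly u t \<noteq> 0 \<longrightarrow> (\<exists>M\<in>N_pts m n. poly u t \<cdot>\<^sub>m M = map_mat (\<lambda>q. poly q t) Mt))"
    by (intro exI[of _ 1] exI[of _ "N_family (line a1 a2)"])
       (auto simp: family_natural(1)[OF comm_ring_hom_poly] poly_line a one_smult intro: N_family_pts)
qed

lemma connectedin_H: "connectedin (zariski d) (H_pts m n :: 'k::alg_closed_field mat set)"
proof (rule connectedin_zariski_curves[OF infinite_UNIV_alg_closed])
  show "H_pts m n \<subseteq> carrier (GL d :: 'k mat monoid)" using H_pts_subset_Aut Aut_in_GL by blast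
  fix M1 M2 :: "'k mat" assume M: "M1 \<in> H_pts m n" "M2 \<in> H_pts m n"
  obtain a1 u1 where a1: "H_denom a1 * u1 = 1" "H_denom a1 \<cdot>\<^sub>m M1 = H_numer a1" using M(1) by (rule H_pts_param)
  obtain a2 u2 where a2: "H_denom a2 * u2 = 1" "H_denom a2 \<cdot>\<^sub>m M2 = H_numer a2" using M(2) by (rule H_pts_param)
  have mid: "\<exists>M\<in>H_pts m n. H_denom a \<cdot>\<^sub>m M = H_numer a" if "H_denom a \<noteq> 0" for a :: "param \<Rightarrow> 'k"
    using that by (rule H_family_field) blast
  show "\<exists>u Mt. Mt \<in> carrier_mat d d \<and> poly u 0 \<noteq> 0 \<and> poly u 1 \<noteq> 0 \<and>
      poly u 0 \<cdot>\<^sub>m M1 = map_mat (\<lambda>q. poly q 0) Mt \<and> poly u 1 \<cdot>\<^sub>m M2 = map_mat (\<lambda>q. poly q 1) Mt \<and>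
      (\<forall>t. poly u t \<noteq> 0 \<longrightarrow> (\<exists>M\<in>H_pts m n. poly u t \<cdot>\<^sub>m M = map_mat (\<lambda>q. poly q t) Mt))"
    using a1 a2 mid
    by (intro exI[of _ "H_denom (line a1 a2)"] exI[of _ "H_numer (line a1 a2)"])
       (auto simp: family_natural(2,3)[OF comm_ring_hom_poly] poly_line)
qed

end

section \<open>Normal unipotent subgroups\<close>

lemma mat_mult_unit_vec:
  "M \<in> carrier_mat n n \<Longrightarrow> r < n \<Longrightarrow> s < n \<Longrightarrow> (M *\<^sub>v unit_vec n s) $ r = (M $$ (r, s) :: 'r::comm_ring_1)"
  by (simp add: scalar_prod_right_unit)

text \<open>If \<open>j\<close> is minimal with \<open>N\<^sup>j = 0\<close>, take \<open>v\<close> in the image of \<open>N\<^bsup>j-2\<^esup>\<close>.\<close>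

lemma nilpotent_ex_vector:
  fixes N :: "'k::field mat"
  assumes N: "N \<in> carrier_mat n n" "N ^\<^sub>m k = 0\<^sub>m n n" "N \<noteq> 0\<^sub>m n n"
  obtains v where "v \<in> carrier_vec n" "N *\<^sub>v v \<noteq> 0\<^sub>v n" "N *\<^sub>v (N *\<^sub>v v) = 0\<^sub>v n"
proof -
  define j where "j = (LEAST j. N ^\<^sub>m j = 0\<^sub>m n n)"
  have j: "N ^\<^sub>m j = 0\<^sub>m n n" unfolding j_def using N(2) by (rule LeastI)
  have less: "N ^\<^sub>m i \<noteq> 0\<^sub>m n n" if "i < j" for i using that not_less_Least unfolding j_def by blast
  have pc: "N ^\<^sub>m i \<in> carrier_mat n n" for i using N(1) by (rule pow_carrier_mat)
  have "j \<noteq> 0"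
  proof
    assume "j = 0"
    then have "1\<^sub>m n = (0\<^sub>m n n :: 'k mat)" using j N(1) by simp
    then have "N * 1\<^sub>m n = N * 0\<^sub>m n n" by simp
    then show False using N by simp
  qed
  moreover have "j \<noteq> 1" using j N by (auto simp: left_mult_one_mat[OF N(1)])
  ultimately obtain i where i: "j = Suc (Suc i)" by (metis One_nat_def not0_implies_Suc)
  have "\<exists>x\<in>carrier_vec n. N ^\<^sub>m Suc i *\<^sub>v x \<noteq> 0\<^sub>v n"
  proof (rule ccontr)
    assume "\<not> ?thesis"
    then have z: "N ^\<^sub>m Suc i *\<^sub>v x = 0\<^sub>v n" if "x \<in> carrier_vec n" for x using that by blast
    have "N ^\<^sub>m Suc i = 0\<^sub>m n n"
    proof (rule eq_matI)
      fix r s assume rs: "r < dim_row (0\<^sub>m n n :: 'k mat)" "s < dim_col (0\<^sub>m n n :: 'k mat)"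
      then have "(N ^\<^sub>m Suc i) $$ (r, s) = (N ^\<^sub>m Suc i *\<^sub>v unit_vec n s) $ r"
        using mat_mult_unit_vec[OF pc[of "Suc i"], of r s] by simp
      then show "(N ^\<^sub>m Suc i) $$ (r, s) = 0\<^sub>m n n $$ (r, s)" using rs z[of "unit_vec n s"] by simp
    qed (use carrier_matD[OF pc[of "Suc i"]] in \<open>simp_all only: index_zero_mat\<close>)
    then show False using less[of "Suc i"] i by blast
  qed
  then obtain x where x: "x \<in> carrier_vec n" "N ^\<^sub>m Suc i *\<^sub>v x \<noteq> 0\<^sub>v n" by blast
  have comm: "N * N ^\<^sub>m l = N ^\<^sub>m Suc l" for l
  proof (induction l)
    case (Suc l)
    have "N * (N ^\<^sub>m l * N) = (N * N ^\<^sub>m l) * N" using N(1) pc by (intro assoc_mult_mat[symmetric]) auto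
    then show ?case using Suc by simp
  qed (use N(1) in \<open>simp add: left_mult_one_mat[OF N(1)]\<close>)
  have step: "N *\<^sub>v (N ^\<^sub>m l *\<^sub>v x) = N ^\<^sub>m Suc l *\<^sub>v x" for l
    unfolding comm[symmetric] using N(1) pc x(1) by (intro assoc_mult_mat_vec[symmetric]) auto
  have c0: "N ^\<^sub>m i *\<^sub>v x \<in> carrier_vec n" using pc x(1) by (rule mult_mat_vec_carrier)
  show thesis
  proof (rule that[OF c0])
    show "N *\<^sub>v (N ^\<^sub>m i *\<^sub>v x) \<noteq> 0\<^sub>v n" unfolding step by (rule x(2))
    show "N *\<^sub>v (N *\<^sub>v (N ^\<^sub>m i *\<^sub>v x)) = 0\<^sub>v n" unfolding step using j[unfolded i] x(1) by auto
  qed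
qed

text \<open>The map is the reflection that sends \<open>x\<close> to \<open>x - \<phi>(x) (v - z)\<close>, for a linear form \<open>\<phi>\<close> with \<open>\<phi>(v) = 1\<close> and
  \<open>\<phi>(z) = -1\<close>. A non-zero minor of \<open>v\<close> and \<open>z\<close> provides such a form, supported on two coordinates.\<close>

lemma swap_involution:
  fixes v z :: "'k::field vec"
  assumes v: "v \<in> carrier_vec n" and z: "z \<in> carrier_vec n" and ij: "i < n" "j < n" "v $ i * z $ j - v $ j * z $ i \<noteq> 0"
  obtains g where "g \<in> carrier_mat n n" "g * g = 1\<^sub>m n" "g *\<^sub>v v = z" "g *\<^sub>v z = v"
proof -
  define D where "D = v $ i * z $ j - v $ j * z $ i"
  have neq: "i \<noteq> j" using ij by auto
  define \<phi> where "\<phi> = vec n (\<lambda>l. if l = i then (z $ j + v $ j) / D else if l = j then - (z $ i + v $ i) / D else 0)"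
  have phi: "\<phi> \<in> carrier_vec n" by (simp add: \<phi>_def)
  have ev: "\<phi> \<bullet> w = ((z $ j + v $ j) * w $ i - (z $ i + v $ i) * w $ j) / D" if "w \<in> carrier_vec n" for w
  proof -
    have "\<phi> \<bullet> w = (\<Sum>l<n. \<phi> $ l * w $ l)" using that by (simp add: scalar_prod_def atLeast0LessThan)
    also have "\<dots> = (\<Sum>l<n. (if l = i then (z $ j + v $ j) / D * w $ i else 0) + (if l = j then - (z $ i + v $ i) / D * w $ j else 0))"
      by (rule sum.cong) (use neq in \<open>auto simp: \<phi>_def\<close>)
    also have "\<dots> = (z $ j + v $ j) / D * w $ i + - (z $ i + v $ i) / D * w $ j"
      using ij by (simp add: sum.distrib)
    also have "\<dots> = ((z $ j + v $ j) * w $ i - (z $ i + v $ i) * w $ j) / D"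
      by (simp add: diff_divide_distrib add_divide_distrib distrib_right minus_divide_left[symmetric] left_diff_distrib)
    finally show ?thesis .
  qed
  have pv: "\<phi> \<bullet> v = 1" and pz: "\<phi> \<bullet> z = - 1"
    using ij v z by (simp_all add: ev D_def field_simps)
  define w where "w = v - z"
  have w: "w \<in> carrier_vec n" using v z by (simp add: w_def)
  define g where "g = mat n n (\<lambda>(r, s). (if r = s then 1 else 0) - w $ r * \<phi> $ s)"
  have g: "g \<in> carrier_mat n n" by (simp add: g_def)
  have gx: "g *\<^sub>v x = x - (\<phi> \<bullet> x) \<cdot>\<^sub>v w" if x: "x \<in> carrier_vec n" for x
  proof (rule eq_vecI)
    fix r assume "r < dim_vec (x - (\<phi> \<bullet> x) \<cdot>\<^sub>v w)"
    then have r: "r < n" using x w by simp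
    have "(g *\<^sub>v x) $ r = (\<Sum>s<n. (if r = s then x $ s else 0) - w $ r * (\<phi> $ s * x $ s))"
      using r x by (auto simp: g_def scalar_prod_def atLeast0LessThan algebra_simps intro!: sum.cong)
    also have "\<dots> = x $ r - w $ r * (\<phi> \<bullet> x)"
      using r x by (simp add: sum_subtractf sum_distrib_left[symmetric] scalar_prod_def atLeast0LessThan)
    finally show "(g *\<^sub>v x) $ r = (x - (\<phi> \<bullet> x) \<cdot>\<^sub>v w) $ r" using r x w by (simp add: mult.commute)
  qed (use x w in \<open>simp add: g_def\<close>)
  have gv: "g *\<^sub>v v = z" using gx[OF v] v z by (auto simp: pv w_def intro!: eq_vecI)
  have gz: "g *\<^sub>v z = v" using gx[OF z] v z by (auto simp: pz w_def intro!: eq_vecI)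
  have gw: "g *\<^sub>v w = - w"
    using mult_minus_distrib_mat_vec[OF g v z] v z by (auto simp: w_def gv gz intro!: eq_vecI)
  have ggx: "g *\<^sub>v (g *\<^sub>v x) = x" if x: "x \<in> carrier_vec n" for x
  proof -
    have "g *\<^sub>v (x - (\<phi> \<bullet> x) \<cdot>\<^sub>v w) = g *\<^sub>v x - (\<phi> \<bullet> x) \<cdot>\<^sub>v (g *\<^sub>v w)"
      using g x w by (simp add: mult_minus_distrib_mat_vec[of _ n n] mult_mat_vec)
    then show ?thesis unfolding gw gx[OF x] using x w by (auto intro!: eq_vecI)
  qed
  have "g * g = 1\<^sub>m n"
  proof (rule eq_matI)
    fix r s assume rs: "r < dim_row (1\<^sub>m n :: 'k mat)" "s < dim_col (1\<^sub>m n :: 'k mat)"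
    have gg: "g * g \<in> carrier_mat n n" using g by simp
    have "(g * g) *\<^sub>v unit_vec n s = unit_vec n s"
      using ggx[of "unit_vec n s"] assoc_mult_mat_vec[OF g g, of "unit_vec n s"] by simp
    then show "(g * g) $$ (r, s) = 1\<^sub>m n $$ (r, s)"
      using mat_mult_unit_vec[OF gg, of r s] rs by simp
  qed (use g in auto)
  then show thesis using that g gv gz by blast
qed

text \<open>Let \<open>u \<noteq> 1\<close> be unipotent and let \<open>u v = v + z\<close>, \<open>u z = z\<close> with linearly independent
  \<open>v\<close>, \<open>z\<close>. If \<open>g\<close> interchanges \<open>v\<close> and \<open>z\<close>, then the product of \<open>u\<close> and its conjugate by \<open>g\<close>
  maps \<open>v\<close> to \<open>v + z\<close> and \<open>z\<close> to \<open>v + 2 z\<close>. Minus the identity, it maps \<open>v\<close> to \<open>z\<close> and \<open>z\<close> to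
  \<open>v + z\<close>; this is invertible on the span of \<open>v\<close> and \<open>z\<close>, so the product is not unipotent.\<close>

lemma normal_unipotent_trivial:
  fixes T :: "'k::field mat set"
  assumes T: "T \<subseteq> carrier_mat n n" and mult: "\<And>x y. x \<in> T \<Longrightarrow> y \<in> T \<Longrightarrow> x * y \<in> T"
    and conj: "\<And>x g g'. x \<in> T \<Longrightarrow> g \<in> carrier_mat n n \<Longrightarrow> g' \<in> carrier_mat n n \<Longrightarrow> g * g' = 1\<^sub>m n \<Longrightarrow> g' * g = 1\<^sub>m n \<Longrightarrow> g * x * g' \<in> T"
    and unip: "\<And>x. x \<in> T \<Longrightarrow> unipotent n x"
    and u: "u \<in> T"
  shows "u = 1\<^sub>m n"
proof (rule ccontr)
  assume neq: "u \<noteq> 1\<^sub>m n"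
  define N where "N = u - 1\<^sub>m n"
  have uc: "u \<in> carrier_mat n n" using u T by blast
  have Nc: "N \<in> carrier_mat n n" unfolding N_def by (rule minus_carrier_mat[OF one_carrier_mat])
  have uN: "u *\<^sub>v x = x + N *\<^sub>v x" if "x \<in> carrier_vec n" for x
    using that uc by (auto simp: N_def minus_mult_distrib_mat_vec[of _ n n] intro!: eq_vecI)
  have "N \<noteq> 0\<^sub>m n n"
  proof
    assume N0: "N = 0\<^sub>m n n"
    have "u = 1\<^sub>m n"
    proof (rule eq_matI)
      fix i j assume ij: "i < dim_row (1\<^sub>m n :: 'k mat)" "j < dim_col (1\<^sub>m n :: 'k mat)"
      then have "N $$ (i, j) = u $$ (i, j) - 1\<^sub>m n $$ (i, j)" using uc by (simp add: N_def)
      then show "u $$ (i, j) = 1\<^sub>m n $$ (i, j)" using N0 ij by simp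
    qed (use uc in auto)
    then show False using neq by simp
  qed
  moreover obtain k where "N ^\<^sub>m k = 0\<^sub>m n n" using unip[OF u] by (auto simp: unipotent_def N_def)
  ultimately obtain v where v: "v \<in> carrier_vec n" "N *\<^sub>v v \<noteq> 0\<^sub>v n" "N *\<^sub>v (N *\<^sub>v v) = 0\<^sub>v n"
    using Nc by (metis nilpotent_ex_vector)
  define z where "z = N *\<^sub>v v"
  have z: "z \<in> carrier_vec n" "z \<noteq> 0\<^sub>v n" "N *\<^sub>v z = 0\<^sub>v n" using Nc v by (auto simp: z_def)
  have "\<exists>i<n. \<exists>j<n. v $ i * z $ j - v $ j * z $ i \<noteq> 0"
  proof (rule ccontr)
    assume "\<not> ?thesis"
    then have minor: "v $ i * z $ j = v $ j * z $ i" if "i < n" "j < n" for i j using that by auto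
    obtain j where j: "j < n" "z $ j \<noteq> 0"
      using z by (metis carrier_vecD eq_vecI index_zero_vec)
    have "v = (v $ j / z $ j) \<cdot>\<^sub>v z"
    proof (rule eq_vecI)
      fix i assume "i < dim_vec ((v $ j / z $ j) \<cdot>\<^sub>v z)"
      then have "i < n" using z by simp
      then show "v $ i = ((v $ j / z $ j) \<cdot>\<^sub>v z) $ i" using minor[of i j] j z by (simp add: field_simps)
    qed (use v z in auto)
    then have "N *\<^sub>v v = (v $ j / z $ j) \<cdot>\<^sub>v (N *\<^sub>v z)" using mult_mat_vec[OF Nc z(1)] by metis
    also have "\<dots> = 0\<^sub>v n" by (auto simp: z(3) intro!: eq_vecI)
    finally show False using v(2) by simp
  qed
  then obtain i j where ij: "i < n" "j < n" "v $ i * z $ j - v $ j * z $ i \<noteq> 0" by blast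
  obtain g where g: "g \<in> carrier_mat n n" "g * g = 1\<^sub>m n" "g *\<^sub>v v = z" "g *\<^sub>v z = v"
    using swap_involution[OF v(1) z(1) ij] by blast
  define w where "w = g * u * g"
  have wT: "w \<in> T" unfolding w_def using u g by (intro conj) auto
  have wc: "w \<in> carrier_mat n n" using wT T by blast
  have uv: "u *\<^sub>v v = v + z" and uz: "u *\<^sub>v z = z"
    using uN[OF v(1)] uN[OF z(1)] v z by (auto simp: z_def[symmetric] z(3))
  have wx: "w *\<^sub>v x = g *\<^sub>v (u *\<^sub>v (g *\<^sub>v x))" if "x \<in> carrier_vec n" for x
    using that g uc by (simp add: w_def assoc_mult_mat_vec[of _ n n _ n])
  have wv: "w *\<^sub>v v = v" using wx[OF v(1)] g uz by simp
  have wz: "w *\<^sub>v z = v + z"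
    using wx[OF z(1)] g uv mult_add_distrib_mat_vec[OF g(1) v(1) z(1)] v z
    by (simp add: comm_add_vec[OF v(1) z(1)])
  define Q where "Q = u * w - 1\<^sub>m n"
  have uw: "u * w \<in> carrier_mat n n" using uc wc by simp
  have Q: "Q \<in> carrier_mat n n" unfolding Q_def by (rule minus_carrier_mat[OF one_carrier_mat])
  have uwx: "(u * w) *\<^sub>v x = u *\<^sub>v (w *\<^sub>v x)" if "x \<in> carrier_vec n" for x
    using uc wc that by (rule assoc_mult_mat_vec)
  have Qx: "Q *\<^sub>v x = u *\<^sub>v (w *\<^sub>v x) - x" if "x \<in> carrier_vec n" for x
    using that uw by (simp add: Q_def minus_mult_distrib_mat_vec[of _ n n] uwx)
  have Qv: "Q *\<^sub>v v = z" using Qx[OF v(1)] v z by (auto simp: wv uv intro!: eq_vecI)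
  have Qz: "Q *\<^sub>v z = v + z"
    using Qx[OF z(1)] v z mult_add_distrib_mat_vec[OF uc v(1) z(1)] by (auto simp: wz uv uz intro!: eq_vecI)
  obtain k where k: "Q ^\<^sub>m k = 0\<^sub>m n n"
    using unip[OF mult[OF u wT]] by (auto simp: unipotent_def Q_def)
  have pc: "Q ^\<^sub>m l \<in> carrier_mat n n" for l using Q by (rule pow_carrier_mat)
  have step: "Q ^\<^sub>m Suc l *\<^sub>v x = Q ^\<^sub>m l *\<^sub>v (Q *\<^sub>v x)" if "x \<in> carrier_vec n" for l x
    using assoc_mult_mat_vec[OF pc Q that] by simp
  have "Q ^\<^sub>m l *\<^sub>v v \<noteq> 0\<^sub>v n \<or> Q ^\<^sub>m l *\<^sub>v z \<noteq> 0\<^sub>v n" for l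
  proof (induction l)
    case 0
    have "v \<noteq> 0\<^sub>v n" using v Nc by auto
    then show ?case using v Q by simp
  next
    case (Suc l)
    have 1: "Q ^\<^sub>m Suc l *\<^sub>v v = Q ^\<^sub>m l *\<^sub>v z" using step[OF v(1)] by (simp only: Qv)
    have 2: "Q ^\<^sub>m Suc l *\<^sub>v z = Q ^\<^sub>m l *\<^sub>v v + Q ^\<^sub>m l *\<^sub>v z"
      using step[OF z(1)] mult_add_distrib_mat_vec[OF pc v(1) z(1)] by (simp only: Qz)
    show ?case
    proof (rule ccontr)
      assume *: "\<not> ?thesis"
      then have "Q ^\<^sub>m l *\<^sub>v z = 0\<^sub>v n" using 1 by simp
      moreover from this * have "Q ^\<^sub>m l *\<^sub>v v + 0\<^sub>v n = 0\<^sub>v n" using 2 by simp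
      then have "Q ^\<^sub>m l *\<^sub>v v = 0\<^sub>v n" using mult_mat_vec_carrier[OF pc v(1)] by simp
      ultimately show False using Suc by blast
    qed
  qed
  from this[of k] show False using v z by (auto simp: k)
qed

context lie_lattice
begin

section \<open>The unipotent radical\<close>

definition Zblk :: "'r::comm_ring_1 mat \<Rightarrow> 'r mat" where
  "Zblk M = mat n n (\<lambda>(i, j). ent M (Z i) (Z j))"

lemma Zblk_carrier [simp]: "Zblk M \<in> carrier_mat n n"
  by (simp add: Zblk_def)

lemma Zblk_mult:
  "M \<in> carrier_mat d d \<Longrightarrow> K \<in> carrier_mat d d \<Longrightarrow> triang M \<Longrightarrow> triang K \<Longrightarrow> Zblk (M * K) = Zblk M * Zblk K"
  by (intro eq_matI) (auto simp: Zblk_def triang_mult(4) scalar_prod_def atLeast0LessThan)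

lemma ent_minus_one:
  "M \<in> carrier_mat d d \<Longrightarrow> x \<in> B \<Longrightarrow> y \<in> B \<Longrightarrow> ent (M - 1\<^sub>m d) x y = ent M x y - ent (1\<^sub>m d) x y"
  by (simp add: ent_def pos_less)

lemma minus_one_carrier: "M - 1\<^sub>m k \<in> carrier_mat k k"
  by (rule minus_carrier_mat[OF one_carrier_mat])

lemma Zblk_minus_one: "M \<in> carrier_mat d d \<Longrightarrow> Zblk (M - 1\<^sub>m d) = Zblk M - 1\<^sub>m n"
  by (intro eq_matI) (auto simp: Zblk_def ent_minus_one ent_one)

lemma triang_minus_one: "M \<in> carrier_mat d d \<Longrightarrow> triang M \<Longrightarrow> triang (M - 1\<^sub>m d)"
  by (simp add: triang_def ent_minus_one ent_one)

lemma triang_pow: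
  assumes M: "M \<in> carrier_mat d d" "triang M"
  shows "triang (M ^\<^sub>m k)" "Zblk (M ^\<^sub>m k) = Zblk M ^\<^sub>m k"
proof -
  have pc: "M ^\<^sub>m i \<in> carrier_mat d d" for i using M(1) by (rule pow_carrier_mat)
  have one: "triang (1\<^sub>m d)" "Zblk (1\<^sub>m d) = 1\<^sub>m n"
    by (auto simp: triang_def ent_one Zblk_def intro!: eq_matI)
  have "triang (M ^\<^sub>m k) \<and> Zblk (M ^\<^sub>m k) = Zblk M ^\<^sub>m k"
  proof (induction k)
    case 0
    have "dim_row M = d" "dim_row (Zblk M) = n" using M by (simp_all add: Zblk_def)
    then show ?case using one by simp
  next
    case (Suc k)
    then show ?case using triang_mult(1)[OF pc M(1) _ M(2)] Zblk_mult[OF pc M(1) _ M(2)] by simp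
  qed
  then show "triang (M ^\<^sub>m k)" "Zblk (M ^\<^sub>m k) = Zblk M ^\<^sub>m k" by simp_all
qed

lemma unipotent_N:
  assumes "(M :: 'k::field mat) \<in> N_pts m n"
  shows "unipotent d M"
proof -
  obtain b d1 d2 where M: "M = Nmat b d1 d2" using assms by (auto simp: N_pts_eq)
  let ?z = "\<lambda>_ _. 0 :: 'k"
  define N where "N = mat_of (blk ?z (\<lambda>e f. b (map2 (+) e f)) d1 ?z d2 ?z)"
  have cM: "M \<in> carrier_mat d d" and cN: "N \<in> carrier_mat d d" by (simp_all add: M N_def)
  have "ent (M - 1\<^sub>m d) x y = ent N x y" if "x \<in> B" "y \<in> B" for x y
    unfolding ent_minus_one[OF cM that] ent_one[OF that]
    by (cases x; cases y; insert that) (simp_all add: M Nmat_def N_def)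
  then have "M - 1\<^sub>m d = N" using mat_eq_iff_ent[OF minus_one_carrier cN] by blast
  moreover have "N ^\<^sub>m 3 = 0\<^sub>m d d"
  proof -
    have "blk ?z ?z ?z ?z ?z ?z x y = 0" for x y by (cases x; cases y) simp_all
    then have zero: "0\<^sub>m d d = mat_of (blk ?z ?z ?z ?z ?z ?z)"
      by (intro eq_matI) (simp_all add: mat_of_def)
    have "1\<^sub>m (dim_row N) * N = N" by (rule left_mult_one_mat') (simp add: N_def mat_of_def)
    then have "N ^\<^sub>m 3 = N * N * N" by (simp add: numeral_3_eq_3)
    also have "\<dots> = 0\<^sub>m d d" unfolding N_def blk_mult zero by (rule mat_of_cong) simp
    finally show ?thesis .
  qed
  ultimately show ?thesis unfolding unipotent_def by blast
qed

text \<open>The \<open>z\<close>-blocks of a normal unipotent subgroup form a set of unipotent matrices that is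
  stable under multiplication and under conjugation by \<open>GL\<^sub>n\<close>, so they are trivial. What remains
  of the complement is the scalar, which must be 1.\<close>

lemma normal_unipotent_subset_N:
  fixes \<Gamma> U :: "'k::field mat set"
  assumes \<Gamma>: "subgroup \<Gamma> (GL d)" "H_pts m n \<subseteq> \<Gamma>" "\<Gamma> \<subseteq> Aut_pts m n"
    and U: "normal U ((GL d)\<lparr>carrier := \<Gamma>\<rparr>)" and unip: "\<And>u. u \<in> U \<Longrightarrow> unipotent d u"
  shows "U \<subseteq> N_pts m n"
proof
  fix u assume uU: "u \<in> U"
  interpret GL: group "GL d :: 'k mat monoid" by (rule group_GL)
  have UG: "U \<subseteq> \<Gamma>" using normal_imp_subgroup[OF U] subgroup.subset by fastforce
  have Umult: "x * y \<in> U" if "x \<in> U" "y \<in> U" for x y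
    using subgroup.m_closed[OF normal_imp_subgroup[OF U] that] by simp
  have conj: "x * h * inv\<^bsub>GL d\<^esub> x \<in> U" if "x \<in> \<Gamma>" "h \<in> U" for x h
    using normal.inv_op_closed2[OF U, of x h] that GL.m_inv_consistent[OF \<Gamma>(1)] by simp
  have Ut: "x \<in> carrier_mat d d" "triang x" if "x \<in> U" for x
  proof -
    have "x \<in> Aut_pts m n" using that UG \<Gamma>(3) by blast
    then show "x \<in> carrier_mat d d" "triang x" using triang_Aut by (simp_all add: Aut_pts_iff GL_carrier)
  qed
  have unipZ: "unipotent n (Zblk x)" if x: "x \<in> U" for x
  proof -
    obtain k where k: "(x - 1\<^sub>m d) ^\<^sub>m k = 0\<^sub>m d d" using unip[OF x] by (auto simp: unipotent_def)
    have "(Zblk x - 1\<^sub>m n) ^\<^sub>m k = Zblk ((x - 1\<^sub>m d) ^\<^sub>m k)"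
      using triang_pow(2)[OF minus_one_carrier triang_minus_one[OF Ut[OF x]]] Zblk_minus_one[OF Ut(1)[OF x]] by simp
    also have "\<dots> = 0\<^sub>m n n" unfolding k by (rule eq_matI) (auto simp: Zblk_def ent_def pos_less)
    finally show ?thesis unfolding unipotent_def by blast
  qed
  have Zu: "Zblk u = 1\<^sub>m n"
  proof (rule normal_unipotent_trivial[of "Zblk ` U"])
    show "Zblk ` U \<subseteq> carrier_mat n n" by auto
    show "unipotent n x" if "x \<in> Zblk ` U" for x using that unipZ by auto
    show "Zblk u \<in> Zblk ` U" using uU by simp
    fix x assume "x \<in> Zblk ` U"
    then obtain h where h: "h \<in> U" "x = Zblk h" by blast
    {
      fix y assume "y \<in> Zblk ` U"
      then obtain l where l: "l \<in> U" "y = Zblk l" by blast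
      have "x * y = Zblk (h * l)" using h l Ut by (simp add: Zblk_mult)
      then show "x * y \<in> Zblk ` U" using Umult h l by blast
    }
    fix g g' :: "'k mat" assume g: "g \<in> carrier_mat n n" "g' \<in> carrier_mat n n" "g * g' = 1\<^sub>m n" "g' * g = 1\<^sub>m n"
    have gGL: "g \<in> carrier (GL n)" "inv\<^bsub>GL n\<^esub> g = g'"
      using g by (auto simp: GL_iff intro: GL_inv_eqI)
    let ?G = "Hmat g g' 1 1" and ?G' = "Hmat g' g 1 1"
    have "Hmat g (inv\<^bsub>GL n\<^esub> g) 1 1 \<in> H_pts m n" unfolding H_pts_eq using gGL(1) by fastforce
    then have "?G \<in> \<Gamma>" using \<Gamma>(2) gGL(2) by auto
    moreover have "inv\<^bsub>GL d\<^esub> ?G = ?G'"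
      using Hmat_GL(2)[OF g] Hmat_GL(2)[OF g(2,1,4,3)] by (intro GL_inv_eqI) auto
    ultimately have "?G * h * ?G' \<in> U" using conj[of ?G h] h by simp
    moreover have "Zblk (?G * h * ?G') = g * x * g'"
    proof -
      have "Zblk (Hmat A A' 1 1) = A" if "A \<in> carrier_mat n n" for A A' :: "'k mat"
        using that by (intro eq_matI) (auto simp: Zblk_def ent_Hmat)
      moreover have "?G * h \<in> carrier_mat d d" using Ut[OF h(1)] by (intro mult_carrier_mat[of _ d d]) auto
      moreover have "triang (?G * h)" using Ut[OF h(1)] by (intro triang_mult(1) triang_Hmat) auto
      ultimately show ?thesis
        using Ut[OF h(1)] g by (simp add: Zblk_mult triang_Hmat h(2))
    qed
    ultimately show "g * x * g' \<in> Zblk ` U" by (metis imageI)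
  qed
  have uA: "u \<in> Aut_pts m n" using uU UG \<Gamma>(3) by blast
  obtain K A a b where K: "K \<in> N_pts m n" and A: "A \<in> carrier (GL n)" and ab: "a * b = 1"
    and uK: "u = K * Hmat A (inv\<^bsub>GL n\<^esub> A) a b"
    by (rule Aut_decompose[OF uA])
  have cK: "K \<in> carrier_mat d d" and uniK: "unitriang K" using K by (simp_all add: N_pts_iff Aut_pts_iff GL_carrier)
  note um = triang_mult[OF cK Hmat_carrier unitriangD(1)[OF uniK] triang_Hmat]
  have "A $$ (i, j) = Zblk u $$ (i, j)" if "i < n" "j < n" for i j
    using that unfolding uK
    by (simp add: Zblk_def um(4)) (subst sum_delta_left[of _ i], auto simp: ent_Hmat unitriangD(4)[OF uniK])
  then have A1: "A = 1\<^sub>m n" using GL_carrier[OF A] Zu by (intro eq_matI) auto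
  let ?H = "Hmat (1\<^sub>m n) (1\<^sub>m n) a b"
  have uH: "u = K * ?H" using uK by (simp add: A1 GL_inv_one)
  have uX: "ent u (X e) (X e') = (if e = e' then a else 0)" if "e \<in> E" "e' \<in> E" for e e'
    unfolding uH um(2)[OF that] using that
    by (subst sum_delta_left[of _ e]) (auto simp: Hmat_one unitriangD(2)[OF uniK])
  note tu = minus_one_carrier[of u d] triang_minus_one[OF Ut[OF uU]]
  have pow: "ent ((u - 1\<^sub>m d) ^\<^sub>m k) (X e) (X e') = (if e = e' then (a - 1) ^ k else 0)" if "e \<in> E" "e' \<in> E" for k e e'
    using that
  proof (induction k arbitrary: e e')
    case 0
    have "dim_row (u - 1\<^sub>m d) = d" using tu(1) by simp
    then show ?case using 0 by (simp add: ent_one)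
  next
    case (Suc k)
    have "ent ((u - 1\<^sub>m d) ^\<^sub>m Suc k) (X e) (X e') = (\<Sum>x\<in>E. ent ((u - 1\<^sub>m d) ^\<^sub>m k) (X e) (X x) * ent (u - 1\<^sub>m d) (X x) (X e'))"
      using triang_mult(2)[OF pow_carrier_mat[OF tu(1)] tu(1) triang_pow(1)[OF tu] tu(2) Suc.prems] by simp
    also have "\<dots> = (\<Sum>x\<in>E. if x = e then (a - 1) ^ k * (if e = e' then a - 1 else 0) else 0)"
      using Suc.prems Suc.IH Ut(1)[OF uU] by (intro sum.cong) (auto simp: ent_minus_one ent_one uX)
    finally show ?case using Suc.prems by simp
  qed
  obtain e0 where e0: "e0 \<in> E" using expos_nonempty[of n "m - 1"] n by (auto simp: E_def)
  obtain k where k: "(u - 1\<^sub>m d) ^\<^sub>m k = 0\<^sub>m d d" using unip[OF uU] by (auto simp: unipotent_def)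
  have "(a - 1) ^ k = 0" using pow[OF e0 e0, of k] e0 unfolding k by (simp add: ent_def pos_less)
  then have "a = 1" by simp
  then have "?H = 1\<^sub>m d" using ab by (simp add: Hmat_one_one)
  then show "u \<in> N_pts m n" using uH K cK by simp
qed

lemma closed_N_H:
  "closedin (zariski d) (N_pts m n :: 'k::field mat set)" "closedin (zariski d) (H_pts m n :: 'k mat set)"
  using closedin_Z_closure[of d "N_pts m n"] closedin_Z_closure[of d "H_pts m n"]
  by (simp_all flip: closed_subschemes(2,3))

lemma unipotent_radical_Aut:
  "is_unipotent_radical d (Aut_pts m n :: 'k::alg_closed_field mat set) (N_pts m n)"
  unfolding is_unipotent_radical_def conn_normal_unipotent_def
proof (intro conjI ballI allI impI)
  show "normal (N_pts m n) ((GL d)\<lparr>carrier := Aut_pts m n :: 'k mat set\<rparr>)"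
    using semidirect_N_H[where 'r = 'k] by (simp add: semidirect_def Aut_grp_def)
  fix U :: "'k mat set"
  assume "closedin (zariski d) U \<and> connectedin (zariski d) U \<and> U \<lhd> (GL d)\<lparr>carrier := Aut_pts m n\<rparr> \<and> Ball U (unipotent d)"
  then show "U \<subseteq> N_pts m n"
    using H_pts_subset_Aut by (intro normal_unipotent_subset_N[OF subgroup_Aut]) auto
qed (use closed_N_H connectedin_N unipotent_N in auto)

text \<open>The trivial group is closed, being the intersection of \<open>N\<close> and \<open>H\<close>.\<close>

lemma reductive_H: "reductive d (H_pts m n :: 'k::alg_closed_field mat set)"
proof -
  have NH: "N_pts m n \<inter> H_pts m n = {1\<^sub>m d :: 'k mat}"
    using semidirect_N_H[where 'r = 'k] by (simp add: semidirect_def Aut_grp_def)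
  interpret H: group "(GL d)\<lparr>carrier := H_pts m n :: 'k mat set\<rparr>"
    by (rule group_subgroup_GL[OF subgroup_H])
  have "conn_normal_unipotent d (H_pts m n) {1\<^sub>m d :: 'k mat}"
    unfolding conn_normal_unipotent_def
  proof (intro conjI ballI)
    show "closedin (zariski d) {1\<^sub>m d :: 'k mat}"
      unfolding NH[symmetric] using closed_N_H by (rule closedin_Int)
    show "connectedin (zariski d) {1\<^sub>m d :: 'k mat}"
      by (simp add: connectedin_sing topspace_zariski one_in_GL)
    show "{1\<^sub>m d} \<lhd> (GL d)\<lparr>carrier := H_pts m n :: 'k mat set\<rparr>"
      using H.one_is_normal by simp
    fix u :: "'k mat" assume "u \<in> {1\<^sub>m d}"
    then show "unipotent d u" using NH unipotent_N by blast
  qed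
  moreover have "U \<subseteq> {1\<^sub>m d}" if "conn_normal_unipotent d (H_pts m n) U" for U :: "'k mat set"
  proof -
    have U: "normal U ((GL d)\<lparr>carrier := H_pts m n\<rparr>)" "\<And>u. u \<in> U \<Longrightarrow> unipotent d u"
      using that by (auto simp: conn_normal_unipotent_def)
    have "U \<subseteq> N_pts m n"
      using normal_unipotent_subset_N[OF subgroup_H order_refl H_pts_subset_Aut U] .
    moreover have "U \<subseteq> H_pts m n"
      using subgroup.subset[OF normal_imp_subgroup[OF U(1)]] by simp
    ultimately show ?thesis using NH by blast
  qed
  ultimately show ?thesis
    unfolding reductive_def is_unipotent_radical_def
    using subgroup_H closed_N_H(2) connectedin_H by blast
qed

end

theorem theorem2p7:
  fixes m n :: nat
  assumes "m \<ge> 1" and "n \<ge> 2"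
  shows
    "card (expos n (m - 1)) = (m + n - 2) choose (n - 1) \<and>
     card (expos n m) = (m + n - 1) choose (n - 1) \<and>
     rk m n = card (expos n (m - 1)) + card (expos n m) + n \<and>
     \<comment> \<open>\<open>G\<close>, \<open>N\<close> and \<open>H\<close> are closed subgroup schemes of \<open>GL\<close> over the integers, and \<open>G = N \<rtimes> H\<close>\<close>
     subgroup (Aut_pts m n) (GL (rk m n) :: 'r::comm_ring_1 mat monoid) \<and>
     (Aut_pts m n :: 'r mat set) = Z_closure (rk m n) (Aut_pts m n) \<and>
     (N_pts m n :: 'r mat set) = Z_closure (rk m n) (N_pts m n) \<and>
     (H_pts m n :: 'r mat set) = Z_closure (rk m n) (H_pts m n) \<and>
     semidirect (Aut_grp m n :: 'r mat monoid) (N_pts m n) (H_pts m n) \<and>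
     \<comment> \<open>geometric fibres\<close>
     is_unipotent_radical (rk m n) (Aut_pts m n :: 'k::alg_closed_field mat set) (N_pts m n) \<and>
     reductive (rk m n) (H_pts m n :: 'k mat set) \<and>
     \<comment> \<open>\<open>H\<close> is isomorphic to \<open>GL\<^sub>n \<times> GL\<^sub>1\<close>, naturally in the ring\<close>
     H_map m n \<in> iso (GL n \<times>\<times> GL 1) ((GL (rk m n) :: 'r mat monoid)\<lparr>carrier := H_pts m n\<rparr>) \<and>
     (\<forall>h :: 'r \<Rightarrow> 's::comm_ring_1. comm_ring_hom h \<longrightarrow>
        (\<forall>A\<in>carrier (GL n). \<forall>l\<in>carrier (GL 1).
           map_mat h (H_map m n (A, l)) = H_map m n (map_mat h A, map_mat h l)))"
proof -
  interpret lie_lattice m n using assms by unfold_locales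
  have "card (expos n (m - 1)) = (m + n - 2) choose (n - 1)"
    using card_expos[of n "m - 1"] assms by (simp add: numeral_2_eq_2)
  moreover have "card (expos n m) = (m + n - 1) choose (n - 1)"
    using card_expos[of n m] assms by simp
  ultimately show ?thesis
    using rk_eq[unfolded E_def] subgroup_Aut closed_subschemes semidirect_N_H unipotent_radical_Aut
      reductive_H H_map_iso H_map_natural
    by (intro conjI allI impI ballI)
qed

end
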